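(* Let $r>0$, let $\Gamma\subset \mathrm{PSL}_2(\mathbb{R})$ be a finite covolume Fuchsian group, and let $A_r:L^2(\Gamma\backslash\mathbb{H})\to L^2(\Gamma\backslash\mathbb{H})$ be the operator of averaging over the circle of radius $r$. Let $f\in L^2(\Gamma\backslash\mathbb{H})$ be such that $f\geq 0$ and $\langle A_r f, f\rangle = 0$. Then $$\frac{\mu(\operatorname{supp} f)}{\mu(\Gamma\backslash\mathbb{H})}\leq \frac{r+1}{e^{r/2}}.$$
   Context: $\mathbb{H}=\{z=x+iy\in\mathbb{C} : y>0\}$ is the hyperbolic plane with metric $(ds)^2=\frac{(dx)^2+(dy)^2}{y^2}$ (constant curvature $-1$), and $\mu$ is the standard hyperbolic area measure. The group $\mathrm{PSL}_2(\mathbb{R})$ acts on $\mathbb{H}$ by Möbius transformations, which are the orientation-preserving isometries; $K=\mathrm{PSO}(2)$ is the stabilizer of $i$, with Haar probability measure $dk$. A Fuchsian group is a discrete subgroup $\Gamma\subset\mathrm{PSL}_2(\mathbb{R})$. A fundamental region for $\Gamma$ is a closed set $F\subseteq\mathbb{H}$ that is the closure of a non-empty open set $F_0$, with $\mu(F\setminus F_0)=0$, such that $\bigcup_{\gamma\in\Gamma}\gamma F=\mathbb{H}$ and $F_0\cap\gamma F_0=\emptyset$ for all $1\ne\gamma\in\Gamma$. The value $\mu(F)$ does not depend on the choice of $F$ and is denoted $\mu(\Gamma\backslash\mathbb{H})$; $\Gamma$ is called finite covolume if this is finite. Functions on $\Gamma\backslash\mathbb{H}$ are identified with $\Gamma$-invariant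 functions on $\mathbb{H}$; the measure induced on $\Gamma\backslash\mathbb{H}$ is that of $\mu$ restricted to $F$, it is again denoted $\mu$, and $L^2(\Gamma\backslash\mathbb{H})$ and $\langle\cdot,\cdot\rangle$ are taken with respect to it. For $r>0$, the averaging operator is given, for $z=gi$ with $g\in\mathrm{PSL}_2(\mathbb{R})$, by $$(A_rf)(z)=\int_K f\left(gk\begin{pmatrix}e^{r/2}&0\\0&e^{-r/2}\end{pmatrix}i\right)dk,$$ i.e. $(A_rf)(z)$ is the average of $f$ over the hyperbolic circle of radius $r$ centered at $z$. It is bounded and self-adjoint on $L^2(\Gamma\backslash\mathbb{H})$. For $f\in L^2(\Gamma\backslash\mathbb{H})$, $\operatorname{supp} f$ denotes the measurable set $\{x : f(x)\neq 0\}$, well defined up to a null set. *)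

theory Defs
  imports "HOL-Analysis.Analysis" "HOL-Algebra.Coset"
begin

section \<open>The group PSL(2,R) and its action on the upper half-plane\<close>

definition SL2R :: "(real^2^2) monoid" where
  "SL2R = \<lparr>carrier = {A. det A = 1}, mult = (**), one = mat 1\<rparr>"

text \<open>Elements are the cosets \<open>{A, - A}\<close>.\<close>

definition PSL2R :: "(real^2^2) set monoid" where
  "PSL2R = SL2R Mod {mat 1, - mat 1}"

definition psl :: "real^2^2 \<Rightarrow> (real^2^2) set" where
  "psl A = {mat 1, - mat 1} #>\<^bsub>SL2R\<^esub> A"

text \<open>The quotient topology; see \<open>quotient_map_psl\<close> below.\<close>

definition PSL2R_topology :: "(real^2^2) set topology" where
  "PSL2R_topology =
     topology (\<lambda>U. U \<subseteq> carrier PSL2R \<and> openin (top_of_set (carrier SL2R)) (\<Union>U))"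

definition fuchsian :: "(real^2^2) set set \<Rightarrow> bool" where
  "fuchsian \<Gamma> \<longleftrightarrow>
     subgroup \<Gamma> PSL2R \<and> subtopology PSL2R_topology \<Gamma> = discrete_topology \<Gamma>"

definition upper_half_plane :: "complex set" where
  "upper_half_plane = {z. Im z > 0}"

definition moebius_map :: "real^2^2 \<Rightarrow> complex \<Rightarrow> complex" where
  "moebius_map A z = (of_real (A$1$1) * z + of_real (A$1$2)) / (of_real (A$2$1) * z + of_real (A$2$2))"

text \<open>The two representatives \<open>A\<close> and \<open>- A\<close> of \<open>\<gamma>\<close> give the same value.\<close>

definition psl_act :: "(real^2^2) set \<Rightarrow> complex \<Rightarrow> complex" where
  "psl_act \<gamma> z = the_elem ((\<lambda>A. moebius_map A z) ` \<gamma>)"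

section \<open>Hyperbolic area and fundamental regions\<close>

definition hyp_area :: "complex measure" where
  "hyp_area = density (restrict_space lborel upper_half_plane) (\<lambda>z. ennreal (1 / (Im z)\<^sup>2))"

text \<open>Closed sets and closures are relative to the upper half-plane: a region with a cusp
  at a real point is not closed in the complex plane.\<close>

definition fundamental_region :: "(real^2^2) set set \<Rightarrow> complex set \<Rightarrow> bool" where
  "fundamental_region \<Gamma> F \<longleftrightarrow>
     closedin (top_of_set upper_half_plane) F \<and>
     (\<exists>F0. openin (top_of_set upper_half_plane) F0 \<and> F0 \<noteq> {} \<and>
        F = top_of_set upper_half_plane closure_of F0 \<and>
        emeasure hyp_area (F - F0) = 0 \<and>
        (\<Union>\<gamma>\<in>\<Gamma>. psl_act \<gamma> ` F) = upper_half_plane \<and>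
        (\<forall>\<gamma>\<in>\<Gamma>. \<gamma> \<noteq> \<one>\<^bsub>PSL2R\<^esub> \<longrightarrow> F0 \<inter> psl_act \<gamma> ` F0 = {}))"

section \<open>Square-integrable functions on the quotient\<close>

text \<open>The measure on the quotient by a group with fundamental region \<open>F\<close>.\<close>

definition quotient_area :: "complex set \<Rightarrow> complex measure" where
  "quotient_area F = restrict_space hyp_area F"

text \<open>Elements of L2 are represented by invariant Borel functions on the upper half-plane;
  every class of functions modulo null sets has such a representative.\<close>

definition L2_quotient :: "(real^2^2) set set \<Rightarrow> complex set \<Rightarrow> (complex \<Rightarrow> real) set" where
  "L2_quotient \<Gamma> F =
     {f. f \<in> borel_measurable hyp_area \<and>
         (\<forall>\<gamma>\<in>\<Gamma>. \<forall>z\<in>upper_half_plane. f (psl_act \<gamma> z) = f z) \<and>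
         integrable (quotient_area F) (\<lambda>z. (f z)\<^sup>2)}"

definition L2_inner :: "complex set \<Rightarrow> (complex \<Rightarrow> real) \<Rightarrow> (complex \<Rightarrow> real) \<Rightarrow> real" where
  "L2_inner F f g = (\<integral>z. f z * g z \<partial>quotient_area F)"

section \<open>The averaging operator\<close>

definition PSO2 :: "(real^2^2) set set" where
  "PSO2 = psl ` {A. orthogonal_matrix A \<and> det A = 1}"

definition PSO2_borel :: "(real^2^2) set measure" where
  "PSO2_borel = sigma PSO2 {U. openin (subtopology PSL2R_topology PSO2) U}"

definition rotation :: "real \<Rightarrow> real^2^2" where
  "rotation t = vector [vector [cos t, - sin t], vector [sin t, cos t]]"

text \<open>Haar probability measure: \<open>rotation\<close> maps \<open>[0, \<pi>)\<close> bijectively onto PSO(2).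
  Normalisation and invariance are \<open>prob_PSO2_haar\<close> and \<open>PSO2_haar_invariant\<close> below.\<close>

definition PSO2_haar :: "(real^2^2) set measure" where
  "PSO2_haar = distr (uniform_measure lborel {0..<pi}) PSO2_borel (\<lambda>t. psl (rotation t))"

definition geodesic_matrix :: "real \<Rightarrow> real^2^2" where
  "geodesic_matrix r = vector [vector [exp (r/2), 0], vector [0, exp (- r/2)]]"

text \<open>By invariance of the Haar measure the value does not depend on the choice of \<open>g\<close>.\<close>

definition averaging :: "real \<Rightarrow> (complex \<Rightarrow> real) \<Rightarrow> complex \<Rightarrow> real" where
  "averaging r f z =
     (let g = (SOME g. g \<in> carrier PSL2R \<and> psl_act g \<i> = z)
      in \<integral>k. f (psl_act (g \<otimes>\<^bsub>PSL2R\<^esub> k \<otimes>\<^bsub>PSL2R\<^esub> psl (geodesic_matrix r)) \<i>) \<partial>PSO2_haar)"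

section \<open>Consistency of the definitions\<close>

lemma psl_eq: "psl A = {A, - A}"
proof -
  have "- mat 1 ** A = - A"
    by (simp add: matrix_matrix_mult_def mat_def vec_eq_iff if_distrib if_distribR sum.delta sum_negf
        cong: if_cong)
  then show ?thesis
    by (auto simp: psl_def r_coset_def SL2R_def)
qed

lemma psl_uminus: "psl (- A) = psl A"
  by (simp add: psl_eq insert_commute)

lemma carrier_PSL2R: "carrier PSL2R = psl ` {A. det A = 1}"
  by (auto simp: PSL2R_def FactGroup_def RCOSETS_def psl_def SL2R_def)

lemma det_neg2: "det (- A :: real^2^2) = det A"
  by (simp add: det_2)

lemma Union_psl_image: "U \<subseteq> carrier PSL2R \<Longrightarrow> \<Union>U = {A. det A = 1 \<and> psl A \<in> U}"
proof (intro subset_antisym subsetI)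
  fix A assume U: "U \<subseteq> carrier PSL2R" and "A \<in> \<Union>U"
  then obtain B where B: "psl B \<in> U" "det B = 1" "A \<in> psl B"
    by (auto simp: carrier_PSL2R)
  then have "A = B \<or> A = - B" by (simp add: psl_eq)
  with B show "A \<in> {A. det A = 1 \<and> psl A \<in> U}"
    by (elim disjE) (simp_all add: det_neg2 psl_uminus)
next
  fix A assume "A \<in> {A. det A = 1 \<and> psl A \<in> U}"
  moreover have "A \<in> psl A" by (simp add: psl_eq)
  ultimately show "A \<in> \<Union>U" by blast
qed

lemma openin_PSL2R_topology:
  "openin PSL2R_topology U \<longleftrightarrow>
     U \<subseteq> carrier PSL2R \<and> openin (top_of_set (carrier SL2R)) {A. det A = 1 \<and> psl A \<in> U}"
proof -
  have "istopology (\<lambda>U. U \<subseteq> carrier PSL2R \<and> openin (top_of_set (carrier SL2R)) (\<Union>U))"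
    unfolding istopology_def
  proof (intro conjI allI impI; (elim conjE)?)
    fix S T assume *: "S \<subseteq> carrier PSL2R" "T \<subseteq> carrier PSL2R"
      "openin (top_of_set (carrier SL2R)) (\<Union>S)" "openin (top_of_set (carrier SL2R)) (\<Union>T)"
    have "\<Union>(S \<inter> T) = \<Union>S \<inter> \<Union>T"
      using * Union_psl_image[of S] Union_psl_image[of T] Union_psl_image[of "S \<inter> T"] by blast
    then show "openin (top_of_set (carrier SL2R)) (\<Union>(S \<inter> T))"
      using * by (simp add: openin_Int)
  next
    fix K assume "\<forall>S\<in>K. S \<subseteq> carrier PSL2R \<and> openin (top_of_set (carrier SL2R)) (\<Union>S)"
    then have "openin (top_of_set (carrier SL2R)) (\<Union>(Union ` K))"
      by (intro openin_Union) auto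
    moreover have "\<Union>(\<Union>K) = \<Union>(Union ` K)" by blast
    ultimately show "openin (top_of_set (carrier SL2R)) (\<Union>(\<Union>K))" by simp
  qed auto
  then show ?thesis
    unfolding PSL2R_topology_def by (auto simp: Union_psl_image)
qed

lemma topspace_PSL2R: "topspace PSL2R_topology = carrier PSL2R"
proof -
  have "{A. det A = 1 \<and> psl A \<in> carrier PSL2R} = carrier SL2R"
    by (auto simp: carrier_PSL2R SL2R_def)
  then have "openin PSL2R_topology (carrier PSL2R)"
    by (simp add: openin_PSL2R_topology del: mem_Collect_eq)
  then show ?thesis
    by (meson openin_PSL2R_topology openin_subset openin_topspace subset_antisym)
qed

lemma quotient_map_psl: "quotient_map (top_of_set (carrier SL2R)) PSL2R_topology psl"
  unfolding quotient_map_def topspace_PSL2R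
proof (intro conjI allI impI)
  show "psl ` topspace (top_of_set (carrier SL2R)) = carrier PSL2R"
    by (simp add: carrier_PSL2R SL2R_def)
next
  fix U assume "U \<subseteq> carrier PSL2R"
  moreover have "{x \<in> topspace (top_of_set (carrier SL2R)). psl x \<in> U} = {A. det A = 1 \<and> psl A \<in> U}"
    by (simp add: SL2R_def)
  ultimately show "openin (top_of_set (carrier SL2R))
      {x \<in> topspace (top_of_set (carrier SL2R)). psl x \<in> U} \<longleftrightarrow> openin PSL2R_topology U"
    by (simp only: openin_PSL2R_topology simp_thms)
qed

lemma psl_act_psl: "psl_act (psl A) z = moebius_map A z"
proof -
  have "moebius_map (- A) z = moebius_map A z"
    using minus_divide_divide[of "of_real (A$1$1) * z + of_real (A$1$2)"
        "of_real (A$2$1) * z + of_real (A$2$2)"]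
    by (simp add: moebius_map_def)
  then show ?thesis by (simp add: psl_act_def psl_eq)
qed

lemma det_rotation: "det (rotation t) = 1"
  by (simp add: rotation_def det_2 flip: power2_eq_square)

lemma psl_rotation_in_PSO2: "psl (rotation t) \<in> PSO2"
proof -
  have "orthogonal_matrix (rotation t)"
    by (simp add: orthogonal_matrix rotation_def vec_eq_iff forall_2 sum_2 transpose_def
        matrix_matrix_mult_def mat_def flip: power2_eq_square)
  then show ?thesis by (simp add: PSO2_def det_rotation)
qed

lemma PSO2_eq_rotations: "PSO2 = range (\<lambda>t. psl (rotation t))"
proof
  show "PSO2 \<subseteq> range (\<lambda>t. psl (rotation t))"
  proof
    fix k assume "k \<in> PSO2"
    then obtain A where A: "orthogonal_matrix A" "det A = 1" "k = psl A"
      by (auto simp: PSO2_def)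
    have o: "A$1$1 * A$1$1 + A$2$1 * A$2$1 = 1" "A$1$2 * A$1$2 + A$2$2 * A$2$2 = 1"
      "A$1$1 * A$1$2 + A$2$1 * A$2$2 = 0"
      using A(1) by (simp_all add: orthogonal_matrix vec_eq_iff forall_2 sum_2 transpose_def
          matrix_matrix_mult_def mat_def)
    have d: "A$1$1 * A$2$2 - A$1$2 * A$2$1 = 1" using A(2) by (simp add: det_2)
    have "A$2$2 * (A$1$1 * A$1$1 + A$2$1 * A$2$1) = A$1$1 * (A$1$1 * A$2$2 - A$1$2 * A$2$1)
            + A$2$1 * (A$1$1 * A$1$2 + A$2$1 * A$2$2)"
      "A$1$2 * (A$1$1 * A$1$1 + A$2$1 * A$2$1) = A$1$1 * (A$1$1 * A$1$2 + A$2$1 * A$2$2)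
            - A$2$1 * (A$1$1 * A$2$2 - A$1$2 * A$2$1)"
      by (simp_all add: algebra_simps)
    then have "A$2$2 = A$1$1" "A$1$2 = - A$2$1"
      unfolding o d by simp_all
    moreover obtain t where "A$1$1 = cos t" "A$2$1 = sin t"
      using sincos_total_2pi[of "A$1$1" "A$2$1"] o(1) by (auto simp: power2_eq_square)
    ultimately have "A = rotation t"
      by (simp add: rotation_def vec_eq_iff forall_2)
    then show "k \<in> range (\<lambda>t. psl (rotation t))" using A by auto
  qed
qed (auto simp: psl_rotation_in_PSO2)

lemma space_PSO2_borel: "space PSO2_borel = PSO2"
  by (simp add: PSO2_borel_def space_measure_of_conv)

lemma openin_imp_sets_PSO2_borel:
  assumes "openin (subtopology PSL2R_topology PSO2) U"
  shows "U \<in> sets PSO2_borel"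
proof -
  have "{U. openin (subtopology PSL2R_topology PSO2) U} \<subseteq> Pow PSO2"
    by (auto simp: openin_subtopology)
  then show ?thesis
    using assms unfolding PSO2_borel_def by (simp add: sets_measure_of sigma_sets.Basic)
qed

lemma measurable_psl_rotation: "(\<lambda>t. psl (rotation t)) \<in> borel \<rightarrow>\<^sub>M PSO2_borel"
  unfolding PSO2_borel_def
proof (rule measurable_measure_of)
  fix U assume "U \<in> {U. openin (subtopology PSL2R_topology PSO2) U}"
  then obtain V where V: "openin PSL2R_topology V" "U = V \<inter> PSO2"
    by (auto simp: openin_subtopology)
  have "openin (top_of_set (carrier SL2R)) {A. det A = 1 \<and> psl A \<in> V}"
    using V by (simp add: openin_PSL2R_topology)
  then obtain W where W: "open W" "{A. det A = 1 \<and> psl A \<in> V} = carrier SL2R \<inter> W"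
    by (auto simp: openin_open)
  have "(\<lambda>t. psl (rotation t)) -` U \<inter> space borel = rotation -` W"
    using W(2) V(2) psl_rotation_in_PSO2 det_rotation by (auto simp: SL2R_def set_eq_iff)
  moreover have "continuous_on UNIV rotation"
  proof -
    have eq: "rotation = (\<lambda>t. \<chi> i j. if i = 1 then (if j = 1 then cos t else - sin t)
                                 else (if j = 1 then sin t else cos t))"
      by (simp add: fun_eq_iff rotation_def vec_eq_iff forall_2)
    have cont: "continuous_on UNIV (\<lambda>t::real. if i = 1 then (if j = 1 then cos t else - sin t)
                                 else (if j = 1 then sin t else cos t))" for i j :: 2
      by (cases "i = 1"; cases "j = 1") (auto intro!: continuous_intros)
    show ?thesis
      unfolding eq by (intro continuous_on_vec_lambda cont)
  qed
  ultimately show "(\<lambda>t. psl (rotation t)) -` U \<inter> space borel \<in> sets borel"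
    using W(1) by (simp add: open_vimage borel_open)
qed (auto simp: psl_rotation_in_PSO2 openin_subtopology)

lemma space_PSO2_haar: "space PSO2_haar = PSO2" and sets_PSO2_haar: "sets PSO2_haar = sets PSO2_borel"
  by (simp_all add: PSO2_haar_def space_PSO2_borel)

lemma measurable_psl_rotation_uniform:
  "(\<lambda>t. psl (rotation t)) \<in> uniform_measure lborel {0..<pi} \<rightarrow>\<^sub>M PSO2_borel"
  using measurable_psl_rotation by (simp cong: measurable_cong_sets)

lemma emeasure_PSO2_haar:
  assumes "U \<in> sets PSO2_borel"
  shows "emeasure PSO2_haar U = emeasure lborel ({0..<pi} \<inter> {t. psl (rotation t) \<in> U}) / ennreal pi"
proof -
  have "{t. psl (rotation t) \<in> U} \<in> sets borel"
    using measurable_sets[OF measurable_psl_rotation assms] by (simp add: vimage_def)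
  then show ?thesis
    unfolding PSO2_haar_def using assms
    by (simp add: emeasure_distr measurable_psl_rotation_uniform vimage_def)
qed

lemma prob_PSO2_haar: "emeasure PSO2_haar (space PSO2_haar) = 1"
proof -
  have "{t. psl (rotation t) \<in> PSO2} = UNIV" by (simp add: psl_rotation_in_PSO2)
  moreover have "PSO2 \<in> sets PSO2_borel"
    using sets.top[of PSO2_borel] by (simp add: space_PSO2_borel)
  ultimately show ?thesis
    by (simp add: space_PSO2_haar emeasure_PSO2_haar ennreal_divide_self)
qed

lemma psl_mult:
  assumes "det A = 1" "det B = 1"
  shows "psl A \<otimes>\<^bsub>PSL2R\<^esub> psl B = psl (A ** B)"
proof -
  have "- A ** B = - (A ** B)" "A ** - B = - (A ** B)" "- A ** - B = A ** B"
    by (simp_all add: matrix_matrix_mult_def vec_eq_iff sum_negf)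
  then show ?thesis
    by (auto simp: PSL2R_def FactGroup_def set_mult_def psl_eq SL2R_def)
qed

lemma rotation_mult: "rotation s ** rotation t = rotation (s + t)"
  by (simp add: rotation_def vec_eq_iff forall_2 sum_2 matrix_matrix_mult_def cos_add sin_add)

lemma psl_rotation_plus_pi: "psl (rotation (t + pi)) = psl (rotation t)"
proof -
  have "rotation (t + pi) = - rotation t"
    by (simp add: rotation_def vec_eq_iff forall_2)
  then show ?thesis by (auto simp: psl_eq)
qed

lemma psl_rotation_representative:
  obtains s where "0 \<le> s" "s < pi" "psl (rotation t) = psl (rotation s)"
proof -
  have *: "psl (rotation (u + real n * pi)) = psl (rotation u)" for u n
  proof (induction n)
    case (Suc n)
    have "u + real (Suc n) * pi = (u + real n * pi) + pi" by (simp add: algebra_simps)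
    then show ?case by (simp only: psl_rotation_plus_pi Suc)
  qed simp
  define m where "m = \<lfloor>t / pi\<rfloor>"
  define s where "s = t - of_int m * pi"
  have "of_int m \<le> t / pi" "t / pi < of_int m + 1" by (auto simp: m_def)
  then have s: "0 \<le> s" "s < pi" by (auto simp: s_def field_simps)
  have "psl (rotation t) = psl (rotation s)"
  proof (cases "m \<ge> 0")
    case True
    then show ?thesis using *[of s "nat m"] by (simp add: s_def)
  next
    case False
    then show ?thesis using *[of t "nat (- m)"] by (simp add: s_def)
  qed
  with s that show thesis by blast
qed

lemma measurable_PSO2_mult:
  assumes "det B = 1" "psl B \<in> PSO2"
  shows "(\<lambda>h. psl B \<otimes>\<^bsub>PSL2R\<^esub> h) \<in> PSO2_borel \<rightarrow>\<^sub>M PSO2_borel"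
proof -
  have closed: "psl B \<otimes>\<^bsub>PSL2R\<^esub> h \<in> PSO2" if h: "h \<in> PSO2" for h
  proof -
    obtain s t where "psl B = psl (rotation s)" "h = psl (rotation t)"
      using assms h by (auto simp: PSO2_eq_rotations)
    then show ?thesis
      by (simp add: psl_mult det_rotation rotation_mult psl_rotation_in_PSO2)
  qed
  have "(\<lambda>h. psl B \<otimes>\<^bsub>PSL2R\<^esub> h) \<in> PSO2_borel \<rightarrow>\<^sub>M
      sigma PSO2 {U. openin (subtopology PSL2R_topology PSO2) U}"
  proof (rule measurable_measure_of)
    fix U assume "U \<in> {U. openin (subtopology PSL2R_topology PSO2) U}"
    then obtain V where V: "openin PSL2R_topology V" "U = V \<inter> PSO2"
      by (auto simp: openin_subtopology)
    define V' where "V' = {g \<in> carrier PSL2R. psl B \<otimes>\<^bsub>PSL2R\<^esub> g \<in> V}"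
    obtain W where W: "open W" "{A. det A = 1 \<and> psl A \<in> V} = carrier SL2R \<inter> W"
      using V by (auto simp: openin_PSL2R_topology openin_open)
    have "psl A \<in> V' \<longleftrightarrow> psl (B ** A) \<in> V" if "det A = 1" for A
      using that assms(1) by (simp add: V'_def carrier_PSL2R psl_mult)
    moreover have "psl (B ** A) \<in> V \<longleftrightarrow> B ** A \<in> W" if "det A = 1" for A
    proof -
      have "det (B ** A) = 1" using that assms(1) by (simp add: det_mul)
      then show ?thesis
        using W(2)[unfolded set_eq_iff, rule_format, of "B ** A"] by (simp add: SL2R_def)
    qed
    ultimately have "{A. det A = 1 \<and> psl A \<in> V'} = carrier SL2R \<inter> (\<lambda>A. B ** A) -` W"
      by (auto simp: SL2R_def)
    moreover have "open ((\<lambda>A. B ** A) -` W)"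
      unfolding matrix_matrix_mult_def
      by (intro open_vimage W continuous_on_vec_lambda continuous_intros)
    ultimately have "openin PSL2R_topology V'"
      unfolding openin_PSL2R_topology openin_open V'_def by blast
    moreover have "(\<lambda>h. psl B \<otimes>\<^bsub>PSL2R\<^esub> h) -` U \<inter> space PSO2_borel = V' \<inter> PSO2"
    proof -
      have "PSO2 \<subseteq> carrier PSL2R" by (auto simp: PSO2_def carrier_PSL2R)
      then show ?thesis
        unfolding V(2) space_PSO2_borel V'_def using closed by blast
    qed
    ultimately have "openin (subtopology PSL2R_topology PSO2)
        ((\<lambda>h. psl B \<otimes>\<^bsub>PSL2R\<^esub> h) -` U \<inter> space PSO2_borel)"
      by (auto simp: openin_subtopology)
    then show "(\<lambda>h. psl B \<otimes>\<^bsub>PSL2R\<^esub> h) -` U \<inter> space PSO2_borel \<in> sets PSO2_borel"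
      by (rule openin_imp_sets_PSO2_borel)
  qed (auto simp: closed space_PSO2_borel openin_subtopology)
  then show ?thesis by (simp add: PSO2_borel_def)
qed

lemma emeasure_lborel_translate:
  fixes S :: "real set"
  assumes "S \<in> sets borel"
  shows "emeasure lborel {t. c + t \<in> S} = emeasure lborel S"
proof -
  have "emeasure lborel S = emeasure (distr lborel borel ((+) c)) S"
    by (simp add: lborel_distr_plus)
  also have "\<dots> = emeasure lborel {t. c + t \<in> S}"
    using assms by (simp add: emeasure_distr vimage_def)
  finally show ?thesis by simp
qed

lemma PSO2_haar_invariant:
  assumes "k \<in> PSO2"
  shows "distr PSO2_haar PSO2_borel (\<lambda>h. k \<otimes>\<^bsub>PSL2R\<^esub> h) = PSO2_haar"
proof -
  obtain s where s: "0 \<le> s" "s < pi" "k = psl (rotation s)"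
  proof -
    obtain t where "k = psl (rotation t)" using assms by (auto simp: PSO2_eq_rotations)
    with psl_rotation_representative[of t] that show thesis by auto
  qed
  have meas: "(\<lambda>h. k \<otimes>\<^bsub>PSL2R\<^esub> h) \<in> PSO2_borel \<rightarrow>\<^sub>M PSO2_borel"
    unfolding s(3) by (intro measurable_PSO2_mult det_rotation psl_rotation_in_PSO2)
  then have meas': "(\<lambda>h. k \<otimes>\<^bsub>PSL2R\<^esub> h) \<in> PSO2_haar \<rightarrow>\<^sub>M PSO2_borel"
    by (simp add: sets_PSO2_haar cong: measurable_cong_sets)
  show ?thesis
  proof (rule measure_eqI)
    fix U assume "U \<in> sets (distr PSO2_haar PSO2_borel (\<lambda>h. k \<otimes>\<^bsub>PSL2R\<^esub> h))"
    then have U: "U \<in> sets PSO2_borel" by simp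
    define S where "S = {t. psl (rotation t) \<in> U}"
    have [measurable]: "S \<in> sets borel"
      unfolding S_def using measurable_sets[OF measurable_psl_rotation U] by (simp add: vimage_def)
    have per: "pi + t \<in> S \<longleftrightarrow> t \<in> S" for t
      using psl_rotation_plus_pi[of t] by (simp add: S_def add.commute)
    let ?V = "(\<lambda>h. k \<otimes>\<^bsub>PSL2R\<^esub> h) -` U \<inter> PSO2"
    have V: "?V \<in> sets PSO2_borel"
      using measurable_sets[OF meas U] by (simp add: space_PSO2_borel)
    have "{0..<pi} \<inter> {t. psl (rotation t) \<in> ?V} = {t. s + t \<in> {s..<s + pi} \<inter> S}"
      by (auto simp: S_def s(3) psl_mult det_rotation rotation_mult psl_rotation_in_PSO2)
    then have "emeasure lborel ({0..<pi} \<inter> {t. psl (rotation t) \<in> ?V})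
        = emeasure lborel ({s..<s + pi} \<inter> S)"
      by (simp only:) (rule emeasure_lborel_translate, measurable)
    also have "{s..<s + pi} \<inter> S = ({s..<pi} \<inter> S) \<union> ({pi..<pi + s} \<inter> S)"
      using s by auto
    also have "emeasure lborel \<dots> =
        emeasure lborel ({s..<pi} \<inter> S) + emeasure lborel ({pi..<pi + s} \<inter> S)"
      by (rule plus_emeasure[symmetric]) auto
    also have "emeasure lborel ({pi..<pi + s} \<inter> S)
        = emeasure lborel {t. pi + t \<in> {pi..<pi + s} \<inter> S}"
      by (rule emeasure_lborel_translate[symmetric]) measurable
    also have "{t. pi + t \<in> {pi..<pi + s} \<inter> S} = {0..<s} \<inter> S"
      using per by auto
    also have "emeasure lborel ({s..<pi} \<inter> S) + emeasure lborel ({0..<s} \<inter> S)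
        = emeasure lborel (({s..<pi} \<inter> S) \<union> ({0..<s} \<inter> S))"
      by (rule plus_emeasure) auto
    also have "({s..<pi} \<inter> S) \<union> ({0..<s} \<inter> S) = {0..<pi} \<inter> S"
      using s by auto
    finally have "emeasure lborel ({0..<pi} \<inter> {t. psl (rotation t) \<in> ?V})
        = emeasure lborel ({0..<pi} \<inter> S)" .
    then have "emeasure PSO2_haar ?V = emeasure PSO2_haar U"
      by (simp only: emeasure_PSO2_haar U V S_def)
    then show "emeasure (distr PSO2_haar PSO2_borel (\<lambda>h. k \<otimes>\<^bsub>PSL2R\<^esub> h)) U = emeasure PSO2_haar U"
      using U meas' by (simp add: emeasure_distr space_PSO2_haar)
  qed (simp add: sets_PSO2_haar)
qed

end

theory Submission
  imports Defs "HOL-Real_Asymp.Real_Asymp"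
begin

text \<open>Let \<open>S\<close> be the support of \<open>f\<close>, let \<open>p\<close> be the fraction of the area of the quotient that it
  occupies, and let \<open>A\<^sub>r\<close> be the average over the circle of radius \<open>r\<close>. As \<open>f \<ge> 0\<close>, the
  vanishing of \<open>\<langle>A\<^sub>r f, f\<rangle>\<close> means that for almost every point of \<open>S\<close> the circle of radius \<open>r\<close>
  about it misses \<open>S\<close> up to a null set of angles, so \<open>\<langle>A\<^sub>r 1\<^sub>S, 1\<^sub>S\<rangle> = 0\<close> as well
  (\<open>support_avoids_radius\<close>). Subtracting its mean \<open>p\<close> from \<open>1\<^sub>S\<close> leaves a function \<open>g\<close> with
  \<open>\<langle>A\<^sub>r g, g\<rangle> = - p\<^sup>2 \<mu>\<close> and \<open>\<langle>g, g\<rangle> = p (1 - p) \<mu>\<close>, where \<open>\<mu>\<close> is the total area. Hence a bound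
  \<open>\<langle>A\<^sub>r g, g\<rangle> \<ge> - c \<langle>g, g\<rangle>\<close> gives \<open>p \<le> c (1 - p)\<close>, which is Hoffman's bound for independent sets.

  The bound holds with \<open>c = (r/\<pi> + 1) / sinh (r/2)\<close>, for every Fuchsian group of finite covolume.
  With \<open>D = sqrt (\<Delta> - 1/4)\<close>, the circle average is a superposition of the wave operators
  \<open>cos (v D)\<close>, \<open>0 \<le> v \<le> r\<close>, with positive weights. On the tempered spectrum \<open>cos (v D) \<ge> -1\<close>, and
  on the exceptional spectrum, where \<open>D\<close> is imaginary, \<open>cos (v D)\<close> is even positive. So \<open>A\<^sub>r\<close> is bounded
  below by minus the total weight, and \<open>c\<close> bounds that weight.

  This argument is carried out without spectral theory. The operators
  \<open>S\<^sub>t = sin (t D) / D\<close> are positive averages of circle means (\<open>abel_mean\<close>), with an inverse square root as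
  weight, and they multiply by the rule \<open>S\<^sub>t S\<^sub>t\<^sub>' = 1/2 \<integral> S\<^sub>v dv\<close> over \<open>\<bar>t - t'\<bar> < v < t + t'\<close>
  (\<open>abel_mean_product\<close>). The rule holds because a rotation-invariant distribution on the half-plane
  is determined by the distribution of the height of a point (\<open>radius_measure_eqI\<close>), because heights
  multiply under composition in the upper triangular group, and because the weight
  makes the logarithm of the height have density \<open>exp (- u/2) / 2\<close> on \<open>\<bar>u\<bar> < t\<close>
  (\<open>abel_mean_height_function\<close>).

  By the rule, non-negativity of the square norm of \<open>(S\<^sub>t - S\<^sub>t\<^sub>') g\<close> is a lower bound for second
  differences of the integral of \<open>s v = \<langle>S\<^sub>v g, g\<rangle>\<close>. Letting the step tend to \<open>0\<close> shows
  that \<open>s v + \<langle>g, g\<rangle> v\<close> is non-decreasing (\<open>second_difference_monotone\<close>): this is the inequality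
  \<open>cos \<ge> -1\<close>. Now \<open>s\<close> is the Abel transform of \<open>cosh r \<mapsto> \<langle>A\<^sub>r g, g\<rangle>\<close>, and the inverse transform is
  an integral against a positive kernel followed by a derivative, so monotonicity turns into the required
  bound (\<open>abel_lower_bound\<close>). It holds for each radius and not only for almost every
  one because \<open>\<langle>A\<^sub>r g, g\<rangle>\<close> is continuous in \<open>r\<close> (\<open>continuous_circle_correlation\<close>).

  Self-adjointness on the quotient follows by unfolding over a countable group from the symmetry of
  circle means on the half-plane (\<open>quotient_circle_mean_symmetric\<close>, \<open>circle_mean_symmetric\<close>), which is
  visible in the coordinates \<open>x + i e\<^sup>t\<close>.\<close>

section \<open>Moebius maps and hyperbolic circles\<close>

lemma det2_eq: "det (A::real^2^2) = A$1$1 * A$2$2 - A$1$2 * A$2$1"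
  by (simp add: det_2)

lemma moebius_denominator_nonzero:
  fixes A :: "real^2^2"
  assumes "det A = 1" "Im z > 0"
  shows "of_real (A$2$1) * z + of_real (A$2$2) \<noteq> 0"
proof
  assume *: "of_real (A$2$1) * z + of_real (A$2$2) = 0"
  then have "A$2$1 * Im z = 0" by (auto simp: complex_eq_iff)
  then have "A$2$1 = 0" using assms by simp
  moreover have "A$2$2 = 0" using * calculation by simp
  ultimately show False using assms by (simp add: det2_eq)
qed

lemma moebius_map_compose:
  assumes "det B = 1" "Im z > 0"
  shows "moebius_map (A ** B) z = moebius_map A (moebius_map B z)"
proof -
  define n where "n = of_real (B$1$1) * z + of_real (B$1$2)"
  define d where "d = of_real (B$2$1) * z + of_real (B$2$2)"
  have d: "d \<noteq> 0" using moebius_denominator_nonzero[OF assms] by (simp add: d_def)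
  have "moebius_map A (moebius_map B z)
      = (of_real (A$1$1) * (n/d) + of_real (A$1$2)) / (of_real (A$2$1) * (n/d) + of_real (A$2$2))"
    by (simp add: moebius_map_def n_def d_def)
  also have "\<dots> = ((of_real (A$1$1) * (n/d) + of_real (A$1$2)) * d) / ((of_real (A$2$1) * (n/d) + of_real (A$2$2)) * d)"
    using d by simp
  also have "(of_real (A$1$1) * (n/d) + of_real (A$1$2)) * d = of_real (A$1$1) * n + of_real (A$1$2) * d"
    using d by (simp add: field_simps)
  also have "(of_real (A$2$1) * (n/d) + of_real (A$2$2)) * d = of_real (A$2$1) * n + of_real (A$2$2) * d"
    using d by (simp add: field_simps)
  finally show ?thesis
    by (simp add: moebius_map_def n_def d_def matrix_matrix_mult_def sum_2 algebra_simps)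
qed

lemma Im_moebius_map:
  assumes "det A = 1"
  shows "Im (moebius_map A z) = Im z / (cmod (of_real (A$2$1) * z + of_real (A$2$2)))\<^sup>2"
proof -
  have "(A$1$1 * Im z) * (A$2$1 * Re z + A$2$2) - (A$1$1 * Re z + A$1$2) * (A$2$1 * Im z)
      = (A$1$1 * A$2$2 - A$1$2 * A$2$1) * Im z"
    by (simp add: algebra_simps)
  also have "\<dots> = Im z" using assms by (simp add: det2_eq)
  finally show ?thesis
    by (simp add: moebius_map_def Im_divide cmod_power2)
qed

lemma Im_moebius_map_pos:
  assumes "det A = 1" "Im z > 0"
  shows "Im (moebius_map A z) > 0"
  using assms moebius_denominator_nonzero[OF assms] by (simp add: Im_moebius_map)

text \<open>The upper triangular matrices act simply transitively on the half-plane; \<open>affine_move z\<close> is the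
  transformation in this group that takes \<open>\<i>\<close> to \<open>z\<close>.\<close>

definition affine_move :: "complex \<Rightarrow> complex \<Rightarrow> complex" where
  "affine_move z p = Complex (Re z + Im z * Re p) (Im z * Im p)"

definition affine_matrix :: "complex \<Rightarrow> real^2^2" where
  "affine_matrix z = vector [vector [sqrt (Im z), Re z / sqrt (Im z)], vector [0, 1 / sqrt (Im z)]]"

lemma det_affine_matrix: "Im z > 0 \<Longrightarrow> det (affine_matrix z) = 1"
  by (simp add: affine_matrix_def det_2)

lemma moebius_affine_matrix:
  assumes "Im z > 0"
  shows "moebius_map (affine_matrix z) p = affine_move z p"
proof -
  have "moebius_map (affine_matrix z) p
      = of_real (sqrt (Im z)) * (of_real (sqrt (Im z)) * p + of_real (Re z / sqrt (Im z)))"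
    by (simp add: moebius_map_def affine_matrix_def divide_simps)
  also have "\<dots> = of_real (Im z) * p + of_real (Re z)"
    using assms by (simp add: complex_eq_iff algebra_simps)
  finally show ?thesis by (simp add: affine_move_def complex_eq_iff)
qed

lemma affine_move_i: "affine_move z \<i> = z"
  by (simp add: affine_move_def complex_eq_iff)

lemma moebius_rotation:
  "moebius_map (rotation t) z = (of_real (cos t) * z - of_real (sin t)) / (of_real (sin t) * z + of_real (cos t))"
  by (simp add: moebius_map_def rotation_def)

lemma stabiliser_of_i:
  assumes "det A = 1" "moebius_map A \<i> = \<i>"
  obtains t where "A = rotation t"
proof -
  have nz: "of_real (A$2$1) * \<i> + of_real (A$2$2) \<noteq> (0::complex)"
    using moebius_denominator_nonzero[OF assms(1), of \<i>] by simp
  have "of_real (A$1$1) * \<i> + of_real (A$1$2) = \<i> * (of_real (A$2$1) * \<i> + of_real (A$2$2))"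
    using assms(2) nz by (simp add: moebius_map_def divide_eq_eq)
  then have e: "A$1$1 = A$2$2" "A$1$2 = - A$2$1" by (simp_all add: complex_eq_iff)
  then have "(A$1$1)\<^sup>2 + (A$2$1)\<^sup>2 = 1"
    using assms(1) by (simp add: det2_eq power2_eq_square)
  then obtain t where "A$1$1 = cos t" "A$2$1 = sin t" using sincos_total_2pi by metis
  with e have "A = rotation t" by (simp add: rotation_def vec_eq_iff forall_2)
  with that show thesis by blast
qed

text \<open>The circle of hyperbolic radius \<open>r\<close> about \<open>\<i>\<close>, written in terms of \<open>X = cosh r\<close>: the formula is
  the image of \<open>e\<^sup>r \<i>\<close> under a rotation (\<open>circle_point_moebius\<close>). Radii are measured by their
  \<open>cosh\<close> throughout, since distances enter all densities below polynomially in this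
  parameter.\<close>

definition circle_point :: "real \<Rightarrow> real \<Rightarrow> complex" where
  "circle_point X t = Complex (sqrt (X\<^sup>2 - 1) * sin (2*t) / (X - sqrt (X\<^sup>2 - 1) * cos (2*t)))
     (1 / (X - sqrt (X\<^sup>2 - 1) * cos (2*t)))"

lemma sqrt_bound:
  assumes "X \<ge> (1::real)"
  shows "sqrt (X\<^sup>2 - 1) < X" "0 \<le> sqrt (X\<^sup>2 - 1)" "(sqrt (X\<^sup>2 - 1))\<^sup>2 = X\<^sup>2 - 1"
proof -
  have "sqrt (X\<^sup>2 - 1) < sqrt (X\<^sup>2)" by (rule real_sqrt_less_mono) simp
  then show "sqrt (X\<^sup>2 - 1) < X" using assms by simp
  have "X\<^sup>2 \<ge> 1" using assms by (simp add: one_le_power)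
  then show "0 \<le> sqrt (X\<^sup>2 - 1)" "(sqrt (X\<^sup>2 - 1))\<^sup>2 = X\<^sup>2 - 1" by simp_all
qed

lemma circle_denominator_pos:
  assumes "X \<ge> 1"
  shows "X - sqrt (X\<^sup>2 - 1) * cos t > 0"
proof -
  have "sqrt (X\<^sup>2 - 1) * cos t \<le> sqrt (X\<^sup>2 - 1) * 1"
    by (rule mult_left_mono) (use sqrt_bound[OF assms] in auto)
  then show ?thesis using sqrt_bound[OF assms] by simp
qed

lemma Im_circle_point_pos: "X \<ge> 1 \<Longrightarrow> Im (circle_point X t) > 0"
  using circle_denominator_pos[of X "2*t"] by (simp add: circle_point_def)

text \<open>With \<open>E = e\<^sup>r = X + sqrt (X\<^sup>2 - 1)\<close> the inverse of \<open>E\<close> is \<open>X - sqrt (X\<^sup>2 - 1)\<close>, so the denominator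
  \<open>E\<^sup>2 sin\<^sup>2 t + cos\<^sup>2 t\<close> of the transformed point is \<open>E\<close> times that of \<open>circle_point\<close>.\<close>

lemma circle_point_moebius:
  assumes "X \<ge> 1"
  shows "circle_point X t = moebius_map (rotation t) (\<i> * of_real (X + sqrt (X\<^sup>2 - 1)))"
proof -
  define s where "s = sqrt (X\<^sup>2 - 1)"
  define E where "E = X + s"
  note sb = sqrt_bound[OF assms, folded s_def]
  have E: "E > 0" "E * (X - s) = 1" using sb assms by (auto simp: E_def algebra_simps power2_eq_square)
  have sc: "cos t * cos t = 1 - sin t * sin t" using sin_cos_squared_add[of t] by (simp add: power2_eq_square)
  have dpos: "X - s * cos (2*t) > 0" using circle_denominator_pos[OF assms] by (simp add: s_def)
  have D: "(sin t * E)\<^sup>2 + (cos t)\<^sup>2 = E * (X - s * cos (2*t))"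
  proof -
    have "E * (X - s * cos (2*t)) = E * ((X - s) * (cos t)\<^sup>2 + E * (sin t)\<^sup>2)"
      unfolding E_def cos_double by (simp add: power2_eq_square sc) (simp add: algebra_simps)
    also have "\<dots> = (E * (X - s)) * (cos t)\<^sup>2 + (sin t * E)\<^sup>2"
      by (simp add: algebra_simps power2_eq_square)
    finally show ?thesis using E by simp
  qed
  have re: "cos t * E * (sin t * E) - sin t * cos t = E * (s * sin (2*t))"
  proof -
    have "E * E - 1 = E * (2 * s)"
      using sb unfolding E_def by (simp add: algebra_simps power2_eq_square)
    moreover have "cos t * E * (sin t * E) - sin t * cos t = (E * E - 1) * (sin t * cos t)"
      by (simp add: algebra_simps)
    ultimately show ?thesis unfolding sin_double by simp
  qed
  have im: "cos t * E * cos t + sin t * (sin t * E) = E"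
  proof -
    have "cos t * E * cos t + sin t * (sin t * E) = E * (sin t * sin t + cos t * cos t)"
      by (simp only: distrib_left mult.commute mult.left_commute add.commute)
    also have "sin t * sin t + cos t * cos t = 1" using sc by simp
    finally show ?thesis by simp
  qed
  let ?m = "moebius_map (rotation t) (\<i> * of_real E)"
  have "Re ?m = (cos t * E * (sin t * E) - sin t * cos t) / ((sin t * E)\<^sup>2 + (cos t)\<^sup>2)"
    unfolding moebius_rotation by (simp add: Re_divide power2_eq_square algebra_simps)
  moreover have "Im ?m = (cos t * E * cos t + sin t * (sin t * E)) / ((sin t * E)\<^sup>2 + (cos t)\<^sup>2)"
    unfolding moebius_rotation by (simp add: Im_divide power2_eq_square algebra_simps)
  ultimately show ?thesis
    using E(1) unfolding re im D circle_point_def s_def[symmetric] E_def[symmetric]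
    by (simp add: complex_eq_iff)
qed

lemma moebius_rotation_circle_point:
  assumes "X \<ge> 1"
  shows "moebius_map (rotation a) (circle_point X t) = circle_point X (t + a)"
proof -
  have "Im (\<i> * of_real (X + sqrt (X\<^sup>2 - 1))) > 0"
    using sqrt_bound(2)[OF assms] assms by (simp del: real_sqrt_ge_0_iff)
  then show ?thesis
    using assms by (simp add: circle_point_moebius moebius_map_compose[symmetric] det_rotation
        rotation_mult add.commute)
qed

lemma circle_point_period: "circle_point X (t + pi) = circle_point X t"
proof -
  have "cos (2 * (t + pi)) = cos (2*t)" "sin (2 * (t + pi)) = sin (2*t)"
    using sin_periodic[of "2*t"] cos_periodic[of "2*t"] by (simp_all add: algebra_simps)
  then show ?thesis by (simp add: circle_point_def)
qed

definition cosh_dist_i :: "complex \<Rightarrow> real" where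
  "cosh_dist_i q = ((Re q)\<^sup>2 + (Im q)\<^sup>2 + 1) / (2 * Im q)"

lemma cosh_dist_i_ge_1:
  assumes "Im q > 0" shows "cosh_dist_i q \<ge> 1"
proof -
  have "2 * Im q \<le> (Im q)\<^sup>2 + 1" using sum_squares_bound[of "Im q" 1] by simp
  then have "2 * Im q \<le> (Re q)\<^sup>2 + (Im q)\<^sup>2 + 1"
    by (rule order_trans) simp
  then show ?thesis using assms by (simp add: cosh_dist_i_def)
qed

text \<open>The distance fixes the radius \<open>X\<close>, and the equation of the circle says that
  \<open>(X - 1 / Im q, Re q / Im q)\<close> lies on the Euclidean circle of radius \<open>sqrt (X\<^sup>2 - 1)\<close>; half its
  angle is the required one.\<close>

lemma polar_decomposition:
  assumes "Im q > 0"
  obtains t where "q = circle_point (cosh_dist_i q) t"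
proof -
  define X where "X = cosh_dist_i q"
  define s where "s = sqrt (X\<^sup>2 - 1)"
  have X: "X \<ge> 1" using cosh_dist_i_ge_1[OF assms] by (simp add: X_def)
  have 0: "2 * Im q * X = (Re q)\<^sup>2 + (Im q)\<^sup>2 + 1" using assms by (simp add: X_def cosh_dist_i_def)
  have s2: "s\<^sup>2 = X\<^sup>2 - 1" "s \<ge> 0" using sqrt_bound[OF X] by (simp_all add: s_def)
  have eq: "(X - 1 / Im q)\<^sup>2 + (Re q / Im q)\<^sup>2 = s\<^sup>2"
  proof -
    have "((X - 1 / Im q)\<^sup>2 + (Re q / Im q)\<^sup>2) * (Im q)\<^sup>2 = (X * Im q - 1)\<^sup>2 + (Re q)\<^sup>2"
      using assms by (simp add: power2_eq_square field_simps)
    also have "\<dots> = (X\<^sup>2 - 1) * (Im q)\<^sup>2 + ((Re q)\<^sup>2 + (Im q)\<^sup>2 + 1 - 2 * Im q * X)"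
      by (simp add: power2_eq_square algebra_simps)
    also have "\<dots> = s\<^sup>2 * (Im q)\<^sup>2" using 0 s2 by simp
    finally show ?thesis using assms by simp
  qed
  obtain u where u: "X - 1 / Im q = s * cos u" "Re q / Im q = s * sin u"
  proof (cases "s = 0")
    case True
    then have "X - 1 / Im q = 0" "Re q / Im q = 0" using eq by (simp_all add: sum_power2_eq_zero_iff)
    then show thesis using that[of 0] True by simp
  next
    case False
    have "((X - 1 / Im q)/s)\<^sup>2 + ((Re q / Im q)/s)\<^sup>2 = ((X - 1 / Im q)\<^sup>2 + (Re q / Im q)\<^sup>2) / s\<^sup>2"
      by (simp only: power_divide add_divide_distrib)
    also have "\<dots> = 1" using eq False by simp
    finally have "((X - 1 / Im q)/s)\<^sup>2 + ((Re q / Im q)/s)\<^sup>2 = 1" .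
    then obtain u where "(X - 1 / Im q)/s = cos u" "(Re q / Im q)/s = sin u" using sincos_total_2pi by metis
    then have "X - 1 / Im q = s * cos u" "Re q / Im q = s * sin u"
      using False by (simp_all add: divide_eq_eq mult.commute)
    then show thesis by (rule that)
  qed
  have d: "X - s * cos (2 * (u/2)) = 1 / Im q" using u by simp
  have "Re q = s * sin u * Im q" using u(2) assms by (simp add: field_simps)
  then have "q = circle_point X (u/2)"
    unfolding circle_point_def s_def[symmetric] d by (simp add: complex_eq_iff)
  then show thesis unfolding X_def by (rule that)
qed

section \<open>Averages over circles\<close>

text \<open>The rotation by \<open>\<pi>\<close> acts trivially, so half a turn parametrises the circle once.\<close>

definition angle_measure :: "real measure" where
  "angle_measure = uniform_measure lborel {0..<pi}"

lemma sets_angle_measure [measurable_cong, simp]: "sets angle_measure = sets borel"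
  by (simp add: angle_measure_def)

lemma space_angle_measure [simp]: "space angle_measure = UNIV"
  by (simp add: angle_measure_def)

lemma emeasure_angle_UNIV: "emeasure angle_measure UNIV = 1"
  by (simp add: angle_measure_def ennreal_divide_self)

interpretation angle: finite_measure angle_measure
  by (rule finite_measureI) (simp add: emeasure_angle_UNIV)

lemma nn_integral_angle:
  assumes [measurable]: "u \<in> borel_measurable borel"
  shows "(\<integral>\<^sup>+t. u t \<partial>angle_measure) = (\<integral>\<^sup>+t. u t * indicator {0..<pi} t \<partial>lborel) / pi"
  unfolding angle_measure_def by (subst nn_integral_uniform_measure) auto

lemma periodic_nat:
  assumes "\<And>t. u (t + pi) = u t"
  shows "u (t + real n * pi) = u t"
proof (induction n)
  case (Suc n)
  have "t + real (Suc n) * pi = (t + real n * pi) + pi" by (simp add: algebra_simps)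
  then show ?case by (simp only: assms Suc)
qed simp

text \<open>Reducing the shift modulo \<open>\<pi>\<close>, the part of the shifted interval that leaves \<open>[0, \<pi>)\<close> on the right comes back on
  the left.\<close>

lemma angle_shift:
  fixes u :: "real \<Rightarrow> ennreal"
  assumes [measurable]: "u \<in> borel_measurable borel" and per: "\<And>t. u (t + pi) = u t"
  shows "(\<integral>\<^sup>+t. u (t + a) \<partial>angle_measure) = (\<integral>\<^sup>+t. u t \<partial>angle_measure)"
proof -
  define m where "m = \<lfloor>a / pi\<rfloor>"
  define b where "b = a - of_int m * pi"
  have "of_int m \<le> a / pi" "a / pi < of_int m + 1" by (auto simp: m_def)
  then have b: "0 \<le> b" "b < pi" by (auto simp: b_def field_simps)
  have ab: "u (t + a) = u (t + b)" for t
  proof (cases "m \<ge> 0")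
    case True
    then have "t + a = (t + b) + real (nat m) * pi" by (simp add: b_def)
    then show ?thesis by (simp only: periodic_nat[of u "t + b" "nat m", OF per])
  next
    case False
    then have "t + b = (t + a) + real (nat (- m)) * pi" by (simp add: b_def)
    then show ?thesis by (simp only: periodic_nat[of u "t + a" "nat (- m)", OF per])
  qed
  have tr: "(\<integral>\<^sup>+t. f (t + c) \<partial>lborel) = (\<integral>\<^sup>+t. f t \<partial>lborel)"
    if [measurable]: "f \<in> borel_measurable borel" for f :: "real \<Rightarrow> ennreal" and c
    using nn_integral_real_affine[of f 1 c] by (simp add: add.commute)
  have "(\<integral>\<^sup>+t. u (t + b) * indicator {0..<pi} t \<partial>lborel)
      = (\<integral>\<^sup>+t. u (t + b) * indicator {b..<b+pi} (t + b) \<partial>lborel)"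
    by (intro nn_integral_cong) (auto split: split_indicator)
  also have "\<dots> = (\<integral>\<^sup>+t. u t * indicator {b..<b+pi} t \<partial>lborel)"
    by (rule tr[of "\<lambda>t. u t * indicator {b..<b+pi} t"]) simp
  also have "\<dots> = (\<integral>\<^sup>+t. u t * indicator {b..<pi} t + u t * indicator {pi..<b+pi} t \<partial>lborel)"
    using b by (intro nn_integral_cong) (auto split: split_indicator)
  also have "\<dots> = (\<integral>\<^sup>+t. u t * indicator {b..<pi} t \<partial>lborel) + (\<integral>\<^sup>+t. u t * indicator {pi..<b+pi} t \<partial>lborel)"
    by (rule nn_integral_add) auto
  also have "(\<integral>\<^sup>+t. u t * indicator {pi..<b+pi} t \<partial>lborel)
      = (\<integral>\<^sup>+t. u (t + pi) * indicator {pi..<b+pi} (t + pi) \<partial>lborel)"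
    by (rule tr[of "\<lambda>t. u t * indicator {pi..<b+pi} t", symmetric]) simp
  also have "\<dots> = (\<integral>\<^sup>+t. u t * indicator {0..<b} t \<partial>lborel)"
    by (intro nn_integral_cong) (auto split: split_indicator simp: per)
  also have "(\<integral>\<^sup>+t. u t * indicator {b..<pi} t \<partial>lborel) + \<dots>
      = (\<integral>\<^sup>+t. u t * indicator {b..<pi} t + u t * indicator {0..<b} t \<partial>lborel)"
    by (rule nn_integral_add[symmetric]) auto
  also have "\<dots> = (\<integral>\<^sup>+t. u t * indicator {0..<pi} t \<partial>lborel)"
    using b by (intro nn_integral_cong) (auto split: split_indicator)
  finally show ?thesis by (simp add: nn_integral_angle ab)
qed

lemma measurable_Complex [measurable (raw)]:
  assumes [measurable]: "f \<in> borel_measurable M" "g \<in> borel_measurable M"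
  shows "(\<lambda>x. Complex (f x) (g x)) \<in> borel_measurable M"
  unfolding Complex_eq by measurable

lemma measurable_affine_move [measurable (raw)]:
  assumes [measurable]: "f \<in> borel_measurable M" "g \<in> borel_measurable M"
  shows "(\<lambda>x. affine_move (f x) (g x)) \<in> borel_measurable M"
  unfolding affine_move_def by measurable

lemma measurable_circle_point [measurable (raw)]:
  assumes [measurable]: "f \<in> borel_measurable M" "g \<in> borel_measurable M"
  shows "(\<lambda>x. circle_point (f x) (g x)) \<in> borel_measurable M"
  unfolding circle_point_def by measurable

lemma measurable_cosh_dist_i [measurable]: "cosh_dist_i \<in> borel_measurable borel"
  unfolding cosh_dist_i_def[abs_def] by measurable

lemma measurable_moebius_map [measurable]: "moebius_map A \<in> borel_measurable borel"
  unfolding moebius_map_def[abs_def] by measurable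

text \<open>Functions take values in the extended non-negative reals: all averages exist and the order of integration may always be
  exchanged. Signs enter only once the square norms of bounded functions are expanded.\<close>

definition circle_mean :: "real \<Rightarrow> (complex \<Rightarrow> ennreal) \<Rightarrow> complex \<Rightarrow> ennreal" where
  "circle_mean X u z = (\<integral>\<^sup>+t. u (affine_move z (circle_point X t)) \<partial>angle_measure)"

lemma measurable_circle_mean [measurable (raw)]:
  assumes [measurable]: "f \<in> borel_measurable M" "g \<in> borel_measurable M" "u \<in> borel_measurable borel"
  shows "(\<lambda>x. circle_mean (f x) u (g x)) \<in> borel_measurable M"
  unfolding circle_mean_def by (rule angle.borel_measurable_nn_integral) measurable

lemma circle_mean_one: "circle_mean X (\<lambda>_. c) z = c"
  by (simp add: circle_mean_def emeasure_angle_UNIV)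

text \<open>Both products take \<open>\<i>\<close> to the same point, so they differ by an element of the stabiliser of \<open>\<i>\<close>.\<close>

lemma moebius_factor:
  assumes "det A = 1" "Im z > 0"
  obtains a where "A ** affine_matrix z = affine_matrix (moebius_map A z) ** rotation a"
proof -
  define w where "w = moebius_map A z"
  define B where "B = affine_matrix w"
  have w: "Im w > 0" unfolding w_def by (rule Im_moebius_map_pos[OF assms])
  have dB: "det B = 1" using w by (simp add: B_def det_affine_matrix)
  then obtain B' where inv: "B ** B' = mat 1" "B' ** B = mat 1"
    by (metis invertible_det_nz invertible_def zero_neq_one)
  define C where "C = B' ** (A ** affine_matrix z)"
  have dBi: "det (B') = 1"
    using arg_cong[OF inv(1), of det] dB by (simp add: det_mul)
  have dC: "det C = 1" using dBi assms by (simp add: C_def det_mul det_affine_matrix)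
  have dAz: "det (A ** affine_matrix z) = 1" using assms by (simp add: det_mul det_affine_matrix)
  have "moebius_map (A ** affine_matrix z) \<i> = w"
    using assms by (simp add: moebius_map_compose det_affine_matrix moebius_affine_matrix affine_move_i w_def)
  also have "w = moebius_map B \<i>" using w by (simp add: B_def moebius_affine_matrix affine_move_i)
  finally have *: "moebius_map (A ** affine_matrix z) \<i> = moebius_map B \<i>" .
  have "moebius_map C \<i> = moebius_map (B') (moebius_map (A ** affine_matrix z) \<i>)"
    unfolding C_def by (rule moebius_map_compose[OF dAz]) simp
  also have "\<dots> = moebius_map (B' ** B) \<i>"
    unfolding * by (rule moebius_map_compose[OF dB, symmetric]) simp
  also have "\<dots> = \<i>" unfolding inv by (simp add: moebius_map_def mat_def)
  finally obtain a where "C = rotation a" using stabiliser_of_i dC by metis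
  then have "B ** rotation a = B ** (B' ** (A ** affine_matrix z))" by (simp only: C_def)
  also have "\<dots> = (B ** B') ** (A ** affine_matrix z)" by (simp only: matrix_mul_assoc)
  finally have "A ** affine_matrix z = B ** rotation a" by (simp add: inv)
  then show thesis using that by (simp add: B_def w_def)
qed

text \<open>By \<open>moebius_factor\<close>, transporting the parametrised circle about \<open>z\<close> by \<open>A\<close> gives the parametrised
  circle about the image of \<open>z\<close> up to a shift of the angle, which the average absorbs.\<close>

lemma circle_mean_moebius:
  assumes A: "det A = 1" and z: "Im z > 0" and X: "X \<ge> 1" and [measurable]: "u \<in> borel_measurable borel"
  shows "circle_mean X (\<lambda>w. u (moebius_map A w)) z = circle_mean X u (moebius_map A z)"
proof -
  let ?w = "moebius_map A z"
  obtain a where a: "A ** affine_matrix z = affine_matrix ?w ** rotation a"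
    using moebius_factor[OF A z] by blast
  have w: "Im ?w > 0" by (rule Im_moebius_map_pos[OF A z])
  have "moebius_map A (affine_move z (circle_point X t)) = affine_move ?w (circle_point X (t + a))" for t
  proof -
    have "moebius_map A (affine_move z (circle_point X t))
        = moebius_map (A ** affine_matrix z) (circle_point X t)"
      using z Im_circle_point_pos[OF X]
      by (simp add: moebius_affine_matrix[symmetric] moebius_map_compose det_affine_matrix)
    also have "\<dots> = affine_move ?w (circle_point X (t + a))"
      using w Im_circle_point_pos[OF X] X
      by (simp add: a moebius_affine_matrix[symmetric] moebius_map_compose det_rotation
          moebius_rotation_circle_point)
    finally show ?thesis .
  qed
  then have "circle_mean X (\<lambda>w. u (moebius_map A w)) z
      = (\<integral>\<^sup>+t. u (affine_move ?w (circle_point X (t + a))) \<partial>angle_measure)"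
    by (simp add: circle_mean_def)
  also have "\<dots> = circle_mean X u ?w"
    unfolding circle_mean_def
    by (rule angle_shift[of "\<lambda>t. u (affine_move ?w (circle_point X t))"])
       (measurable, simp add: circle_point_period)
  finally show ?thesis .
qed

lemma circle_mean_at_moebius:
  assumes A: "det A = 1" and X: "X \<ge> 1" and [measurable]: "u \<in> borel_measurable borel"
  shows "(\<integral>\<^sup>+t. u (moebius_map A (circle_point X t)) \<partial>angle_measure) = circle_mean X u (moebius_map A \<i>)"
proof -
  have "affine_move \<i> p = p" for p by (simp add: affine_move_def complex_eq_iff)
  then show ?thesis
    using circle_mean_moebius[OF A _ X, of \<i> u] by (simp add: circle_mean_def)
qed

definition composed_radius :: "real \<Rightarrow> real \<Rightarrow> real \<Rightarrow> real" where
  "composed_radius X Y t = cosh_dist_i (affine_move (\<i> * of_real (X + sqrt (X\<^sup>2 - 1))) (circle_point Y t))"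

lemma composed_radius_ge_1:
  assumes "X \<ge> 1" "Y \<ge> 1" shows "composed_radius X Y t \<ge> 1"
proof -
  have "X + sqrt (X\<^sup>2 - 1) > 0" using sqrt_bound(2)[OF assms(1)] assms(1) by linarith
  then show ?thesis unfolding composed_radius_def
    by (intro cosh_dist_i_ge_1) (simp add: affine_move_def Im_circle_point_pos[OF assms(2)])
qed

lemma measurable_composed_radius [measurable (raw)]:
  assumes [measurable]: "f \<in> borel_measurable M" "g \<in> borel_measurable M" "h \<in> borel_measurable M"
  shows "(\<lambda>x. composed_radius (f x) (g x) (h x)) \<in> borel_measurable M"
  unfolding composed_radius_def by measurable

text \<open>Seen from \<open>\<i>\<close>, two successive steps end at a rotation by the first angle of a point \<open>q\<close> that depends
  only on the second angle. By the polar decomposition of \<open>q\<close>, the average over the first angle is the circle mean whose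
  radius is the distance of \<open>q\<close> from \<open>\<i>\<close>.\<close>

lemma circle_mean_circle_mean:
  assumes X: "X \<ge> 1" and Y: "Y \<ge> 1" and z: "Im z > 0" and [measurable]: "u \<in> borel_measurable borel"
  shows "circle_mean X (circle_mean Y u) z = (\<integral>\<^sup>+t. circle_mean (composed_radius X Y t) u z \<partial>angle_measure)"
proof -
  interpret pair_sigma_finite angle_measure angle_measure ..
  define w where "w = \<i> * of_real (X + sqrt (X\<^sup>2 - 1))"
  have w: "Im w > 0" using sqrt_bound(2)[OF X] X by (simp add: w_def del: real_sqrt_ge_0_iff)
  define q where "q t' = affine_move w (circle_point Y t')" for t'
  have q: "Im (q t') > 0" for t' using w Im_circle_point_pos[OF Y] by (simp add: q_def affine_move_def)
  have [measurable]: "q \<in> borel_measurable borel" unfolding q_def[abs_def] by measurable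
  have 1: "circle_mean Y u (affine_move z (circle_point X t))
      = (\<integral>\<^sup>+t'. u (affine_move z (moebius_map (rotation t) (q t'))) \<partial>angle_measure)" for t
  proof -
    define A where "A = affine_matrix z ** (rotation t ** affine_matrix w)"
    have dA: "det A = 1" using z w by (simp add: A_def det_mul det_affine_matrix det_rotation)
    have Ap: "moebius_map A p = affine_move z (moebius_map (rotation t) (affine_move w p))" if "Im p > 0" for p
      using that z w unfolding A_def
      by (simp add: moebius_map_compose det_mul det_rotation det_affine_matrix moebius_affine_matrix[symmetric])
    have "moebius_map A \<i> = affine_move z (circle_point X t)"
      using Ap[of \<i>] by (simp add: affine_move_i circle_point_moebius[OF X] w_def)
    then show ?thesis
      using circle_mean_at_moebius[OF dA Y, of u] Ap[OF Im_circle_point_pos[OF Y]]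
      by (simp add: q_def)
  qed
  have 2: "(\<integral>\<^sup>+t. u (affine_move z (moebius_map (rotation t) (q t'))) \<partial>angle_measure)
      = circle_mean (composed_radius X Y t') u z" for t'
  proof -
    obtain a where a: "q t' = circle_point (composed_radius X Y t') a"
      using polar_decomposition[OF q[of t']] by (auto simp: q_def composed_radius_def w_def)
    have "(\<integral>\<^sup>+t. u (affine_move z (moebius_map (rotation t) (q t'))) \<partial>angle_measure)
        = (\<integral>\<^sup>+t. u (affine_move z (circle_point (composed_radius X Y t') (t + a))) \<partial>angle_measure)"
      by (simp add: a moebius_rotation_circle_point[OF composed_radius_ge_1[OF X Y]] add.commute)
    also have "\<dots> = circle_mean (composed_radius X Y t') u z"
      unfolding circle_mean_def
      by (rule angle_shift[of "\<lambda>t. u (affine_move z (circle_point (composed_radius X Y t') t))"])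
         (measurable, simp add: circle_point_period)
    finally show ?thesis .
  qed
  have "circle_mean X (circle_mean Y u) z
      = (\<integral>\<^sup>+t. (\<integral>\<^sup>+t'. u (affine_move z (moebius_map (rotation t) (q t'))) \<partial>angle_measure) \<partial>angle_measure)"
    by (subst circle_mean_def) (simp add: 1)
  also have "\<dots> = (\<integral>\<^sup>+t'. (\<integral>\<^sup>+t. u (affine_move z (moebius_map (rotation t) (q t'))) \<partial>angle_measure) \<partial>angle_measure)"
    by (rule Fubini'[symmetric]) (simp add: moebius_rotation split_beta', measurable)
  finally show ?thesis by (simp add: 2)
qed

section \<open>Substitution rules for non-negative functions on the line\<close>

text \<open>Monotone convergence extends the substitution rule from compact intervals to unbounded or open ones.\<close>

lemma nn_integral_substitution_exhaustion:
  fixes f :: "real \<Rightarrow> ennreal"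
  assumes [measurable]: "f \<in> borel_measurable borel"
    and deriv: "\<And>x. x \<in> I \<Longrightarrow> (g has_real_derivative g' x) (at x)"
    and cont: "continuous_on I g'" and nonneg: "\<And>x. x \<in> I \<Longrightarrow> g' x \<ge> 0"
    and [measurable]: "g \<in> borel_measurable borel" "g' \<in> borel_measurable borel"
    and ab: "\<And>n::nat. a n < b n" "decseq a" "incseq b"
    and I: "(\<Union>n. {a n..b n}) = I" and J: "(\<Union>n. {g (a n)..g (b n)}) = J"
  shows "(\<integral>\<^sup>+y. f y * indicator J y \<partial>lborel) = (\<integral>\<^sup>+x. f (g x) * g' x * indicator I x \<partial>lborel)"
proof -
  have sub: "{a n..b n} \<subseteq> I" for n using I by blast
  have mono_ab: "{a m..b m} \<subseteq> {a n..b n}" if "m \<le> n" for m n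
    using decseqD[OF ab(2) that] incseqD[OF ab(3) that] by auto
  have monog: "g x \<le> g y" if "x \<le> y" "x \<in> {a n..b n}" "y \<in> {a n..b n}" for x y n
  proof (rule DERIV_nonneg_imp_nondecreasing[OF that(1)])
    fix w assume "x \<le> w" "w \<le> y"
    then have "w \<in> {a n..b n}" using that by simp
    then have "w \<in> I" by (rule subsetD[OF sub])
    then show "\<exists>y. (g has_real_derivative y) (at w) \<and> 0 \<le> y" using deriv nonneg by blast
  qed
  have mono_g: "{g (a m)..g (b m)} \<subseteq> {g (a n)..g (b n)}" if "m \<le> n" for m n
  proof -
    have "a n \<le> a m" "b m \<le> b n" using decseqD[OF ab(2) that] incseqD[OF ab(3) that] by auto
    then have "g (a n) \<le> g (a m)" "g (b m) \<le> g (b n)"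
      using monog[of "a n" "a m" n] monog[of "b m" "b n" n] ab(1)[of m] ab(1)[of n] by auto
    then show ?thesis by auto
  qed
  have sup: "(\<integral>\<^sup>+x. h x * indicator K x \<partial>lborel) = (SUP n. \<integral>\<^sup>+x. h x * indicator (A n) x \<partial>lborel)"
    if [measurable]: "h \<in> borel_measurable borel" and A: "\<And>n. A n \<in> sets borel" and inc: "incseq A"
      and K: "(\<Union>n. A n) = K" for h :: "real \<Rightarrow> ennreal" and A :: "nat \<Rightarrow> real set" and K
  proof -
    have "(SUP n. \<integral>\<^sup>+x. h x * indicator (A n) x \<partial>lborel) = (SUP n. emeasure (density lborel h) (A n))"
      using A by (simp add: emeasure_density)
    also have "\<dots> = emeasure (density lborel h) K"
      unfolding K[symmetric] using A inc by (intro SUP_emeasure_incseq) auto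
    also have "K \<in> sets borel" unfolding K[symmetric] using A by auto
    then have "emeasure (density lborel h) K = (\<integral>\<^sup>+x. h x * indicator K x \<partial>lborel)"
      by (simp add: emeasure_density)
    finally show ?thesis by simp
  qed
  have "(\<integral>\<^sup>+y. f y * indicator J y \<partial>lborel) = (SUP n. \<integral>\<^sup>+y. f y * indicator {g (a n)..g (b n)} y \<partial>lborel)"
    by (rule sup) (use J mono_g in \<open>auto simp: incseq_def\<close>)
  also have "\<dots> = (SUP n. \<integral>\<^sup>+x. f (g x) * g' x * indicator {a n..b n} x \<partial>lborel)"
  proof (rule SUP_cong[OF refl])
    fix n
    show "(\<integral>\<^sup>+y. f y * indicator {g (a n)..g (b n)} y \<partial>lborel)
        = (\<integral>\<^sup>+x. f (g x) * g' x * indicator {a n..b n} x \<partial>lborel)"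
      by (rule nn_integral_substitution_aux)
        (use sub[of n] deriv nonneg ab(1) in \<open>auto intro: continuous_on_subset[OF cont]\<close>)
  qed
  also have "\<dots> = (\<integral>\<^sup>+x. f (g x) * g' x * indicator I x \<partial>lborel)"
    by (rule sup[symmetric]) (use I mono_ab in \<open>auto simp: incseq_def\<close>)
  finally show ?thesis .
qed

lemma nn_integral_real_shift:
  fixes f :: "real \<Rightarrow> ennreal"
  assumes [measurable]: "f \<in> borel_measurable borel"
  shows "(\<integral>\<^sup>+t. f (t + c) \<partial>lborel) = (\<integral>\<^sup>+t. f t \<partial>lborel)"
  using nn_integral_real_affine[of f 1 c] by (simp add: add.commute)

lemma nn_integral_real_reflect:
  fixes f :: "real \<Rightarrow> ennreal"
  assumes [measurable]: "f \<in> borel_measurable borel"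
  shows "(\<integral>\<^sup>+t. f (c - t) \<partial>lborel) = (\<integral>\<^sup>+t. f t \<partial>lborel)"
  using nn_integral_real_affine[of f "-1" c] by simp

lemma Union_intervals_positive:
  "(\<Union>n. {1 / (real n + 1)..real n + 2}) = {0<..}"
proof safe
  fix x :: real assume x: "0 < x"
  obtain n where "max (1/x) x < real n" using reals_Archimedean2 by blast
  then have "1/x \<le> real n + 1" "x \<le> real n + 2" by simp_all
  then show "x \<in> (\<Union>n. {1 / (real n + 1)..real n + 2})"
    using x by (intro UN_I[of n]) (auto simp: field_simps)
next
  fix x :: real and n assume "x \<in> {1 / (real n + 1)..real n + 2}"
  moreover have "1 / (real n + 1) > 0" by simp
  ultimately show "0 < x" by (simp only: atLeastAtMost_iff) linarith
qed

lemma nn_integral_exp_substitution: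
  fixes f :: "real \<Rightarrow> ennreal"
  assumes [measurable]: "f \<in> borel_measurable borel"
  shows "(\<integral>\<^sup>+y. f y * indicator {0<..} y \<partial>lborel) = (\<integral>\<^sup>+t. f (exp t) * exp t \<partial>lborel)"
proof -
  have "(\<integral>\<^sup>+y. f y * indicator {0<..} y \<partial>lborel) = (\<integral>\<^sup>+x. f (exp x) * exp x * indicator UNIV x \<partial>lborel)"
  proof (rule nn_integral_substitution_exhaustion[where a="\<lambda>n. - real (Suc n)" and b="\<lambda>n. real (Suc n)"])
    show "(\<Union>n. {- real (Suc n)..real (Suc n)}) = UNIV"
    proof safe
      fix x :: real
      obtain n where "\<bar>x\<bar> < real n" using reals_Archimedean2 by blast
      then show "x \<in> (\<Union>n. {- real (Suc n)..real (Suc n)})" by (intro UN_I[of n]) auto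
    qed simp
    show "(\<Union>n. {exp (- real (Suc n))..exp (real (Suc n))}) = {0<..}"
    proof safe
      fix x :: real assume x: "0 < x"
      obtain n where "\<bar>ln x\<bar> < real n" using reals_Archimedean2 by blast
      then have "exp (- real (Suc n)) \<le> exp (ln x)" "exp (ln x) \<le> exp (real (Suc n))"
        unfolding exp_le_cancel_iff by auto
      then show "x \<in> (\<Union>n. {exp (- real (Suc n))..exp (real (Suc n))})"
        using x by (intro UN_I[of n]) (simp_all only: exp_ln greaterThan_iff atLeastAtMost_iff UNIV_I)
    next
      fix x :: real and n assume "x \<in> {exp (- real (Suc n))..exp (real (Suc n))}"
      then show "0 < x" using exp_gt_zero[of "- real (Suc n)"] by (simp only: atLeastAtMost_iff) linarith
    qed
  qed (auto simp: incseq_def decseq_def intro!: derivative_eq_intros continuous_intros)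
  then show ?thesis by simp
qed

section \<open>Hyperbolic area in horocyclic coordinates\<close>

text \<open>Both measures give a box the product of its side lengths.\<close>

lemma lborel_complex_eq: "(lborel :: complex measure) = distr (lborel \<Otimes>\<^sub>M lborel) borel (\<lambda>(x, y). Complex x y)"
proof (rule lborel_eqI)
  fix l u :: complex
  assume le: "\<And>b. b \<in> Basis \<Longrightarrow> l \<bullet> b \<le> u \<bullet> b"
  have le': "Re l \<le> Re u" "Im l \<le> Im u" using le[of 1] le[of \<i>] by (simp_all add: Basis_complex_def)
  have eq: "(\<lambda>(x, y). Complex x y) -` box l u = {Re l<..<Re u} \<times> {Im l<..<Im u}"
    by (auto simp: box_def Basis_complex_def)
  have "emeasure (distr (lborel \<Otimes>\<^sub>M lborel) borel (\<lambda>(x, y). Complex x y)) (box l u)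
      = emeasure (lborel \<Otimes>\<^sub>M lborel) ((\<lambda>(x, y). Complex x y) -` box l u)"
    by (subst emeasure_distr) (auto simp: split_beta' space_pair_measure)
  also have "\<dots> = emeasure lborel {Re l<..<Re u} * emeasure lborel {Im l<..<Im u}"
    unfolding eq by (rule lborel.emeasure_pair_measure_Times) auto
  also have "\<dots> = (\<Prod>b\<in>Basis. (u - l) \<bullet> b)"
    using le' by (simp add: Basis_complex_def ennreal_mult[symmetric] inner_diff_left)
  finally show "emeasure (distr (lborel \<Otimes>\<^sub>M lborel) borel (\<lambda>(x, y). Complex x y)) (box l u)
      = (\<Prod>b\<in>Basis. (u - l) \<bullet> b)" .
qed simp

lemma nn_integral_lborel_complex:
  fixes u :: "complex \<Rightarrow> ennreal"
  assumes [measurable]: "u \<in> borel_measurable borel"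
  shows "(\<integral>\<^sup>+z. u z \<partial>lborel) = (\<integral>\<^sup>+y. \<integral>\<^sup>+x. u (Complex x y) \<partial>lborel \<partial>lborel)"
proof -
  have "(\<integral>\<^sup>+z. u z \<partial>lborel) = (\<integral>\<^sup>+p. u (case p of (x, y) \<Rightarrow> Complex x y) \<partial>(lborel \<Otimes>\<^sub>M lborel))"
    by (subst lborel_complex_eq, subst nn_integral_distr) (auto simp: split_beta')
  also have "\<dots> = (\<integral>\<^sup>+y. \<integral>\<^sup>+x. u (Complex x y) \<partial>lborel \<partial>lborel)"
    by (subst lborel_pair.nn_integral_snd[symmetric]) (auto simp: split_beta')
  finally show ?thesis .
qed

lemma open_upper_half_plane: "open upper_half_plane"
  unfolding upper_half_plane_def by (rule open_halfspace_Im_gt)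

lemma upper_half_plane_borel [measurable]: "upper_half_plane \<in> sets borel"
  using open_upper_half_plane by (rule borel_open)

lemma sets_hyp_area: "sets hyp_area = sets (restrict_space borel upper_half_plane)"
  by (simp add: hyp_area_def sets_restrict_space)

lemma space_hyp_area: "space hyp_area = upper_half_plane"
  by (simp add: hyp_area_def space_restrict_space)

lemma measurable_hyp_area: "u \<in> borel_measurable borel \<Longrightarrow> u \<in> borel_measurable hyp_area"
  unfolding measurable_cong_sets[OF sets_hyp_area refl] by (rule measurable_restrict_space1)

lemma nn_integral_hyp_area_lborel:
  fixes u :: "complex \<Rightarrow> ennreal"
  assumes [measurable]: "u \<in> borel_measurable borel"
  shows "(\<integral>\<^sup>+z. u z \<partial>hyp_area) = (\<integral>\<^sup>+z. ennreal (1 / (Im z)\<^sup>2) * u z * indicator upper_half_plane z \<partial>lborel)"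
proof -
  have m: "f \<in> borel_measurable (restrict_space lborel upper_half_plane)"
    if "f \<in> borel_measurable borel" for f :: "complex \<Rightarrow> ennreal"
    by (rule measurable_restrict_space1) (simp add: that)
  show ?thesis
    unfolding hyp_area_def
    by (subst nn_integral_density, (rule m; measurable)+, subst nn_integral_restrict_space) auto
qed

text \<open>In the coordinates \<open>x + i e\<^sup>t\<close> the area is \<open>e\<^sup>-\<^sup>t dx dt\<close>.\<close>

lemma nn_integral_hyp_area:
  fixes u :: "complex \<Rightarrow> ennreal"
  assumes [measurable]: "u \<in> borel_measurable borel"
  shows "(\<integral>\<^sup>+z. u z \<partial>hyp_area) = (\<integral>\<^sup>+t. \<integral>\<^sup>+x. ennreal (exp (- t)) * u (Complex x (exp t)) \<partial>lborel \<partial>lborel)"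
proof -
  have "(\<integral>\<^sup>+z. u z \<partial>hyp_area)
      = (\<integral>\<^sup>+y. (\<integral>\<^sup>+x. ennreal (1 / y\<^sup>2) * u (Complex x y) \<partial>lborel) * indicator {0<..} y \<partial>lborel)"
    unfolding nn_integral_hyp_area_lborel[OF assms]
    by (subst nn_integral_lborel_complex, measurable)
       (auto simp: upper_half_plane_def intro!: nn_integral_cong split: split_indicator)
  also have "\<dots> = (\<integral>\<^sup>+t. (\<integral>\<^sup>+x. ennreal (1 / (exp t)\<^sup>2) * u (Complex x (exp t)) \<partial>lborel) * exp t \<partial>lborel)"
    by (rule nn_integral_exp_substitution) measurable
  also have "\<dots> = (\<integral>\<^sup>+t. \<integral>\<^sup>+x. ennreal (exp (- t)) * u (Complex x (exp t)) \<partial>lborel \<partial>lborel)"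
  proof (rule nn_integral_cong)
    fix t :: real
    have *: "ennreal (1 / (exp t)\<^sup>2) * ennreal (exp t) = ennreal (exp (- t))"
      by (subst ennreal_mult[symmetric]) (auto simp: exp_minus power2_eq_square field_simps)
    have "(\<integral>\<^sup>+x. ennreal (1 / (exp t)\<^sup>2) * u (Complex x (exp t)) \<partial>lborel) * ennreal (exp t)
        = (\<integral>\<^sup>+x. ennreal (1 / (exp t)\<^sup>2) * u (Complex x (exp t)) * ennreal (exp t) \<partial>lborel)"
      by (rule nn_integral_multc[symmetric]) measurable
    also have "\<dots> = (\<integral>\<^sup>+x. ennreal (exp (- t)) * u (Complex x (exp t)) \<partial>lborel)"
      unfolding *[symmetric] by (intro nn_integral_cong) (rule mult.commute[THEN trans], rule mult.assoc[symmetric, THEN trans], rule arg_cong[where f="\<lambda>a. a * _"], rule mult.commute)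
    finally show "(\<integral>\<^sup>+x. ennreal (1 / (exp t)\<^sup>2) * u (Complex x (exp t)) \<partial>lborel) * ennreal (exp t)
        = (\<integral>\<^sup>+x. ennreal (exp (- t)) * u (Complex x (exp t)) \<partial>lborel)" .
  qed
  finally show ?thesis .
qed

section \<open>Circles in horocyclic coordinates\<close>

text \<open>The point \<open>x + i e\<^sup>v\<close> lies on the circle about \<open>\<i>\<close> with parameter \<open>X\<close> if and only if
  \<open>\<bar>x\<bar> = exp (v/2) * chord X v\<close>.\<close>

definition chord :: "real \<Rightarrow> real \<Rightarrow> real" where
  "chord X d = sqrt (2 * (X - cosh d))"

text \<open>Up to the factor \<open>exp (- v/2)\<close>, the density at \<open>v\<close> of the logarithm of the height of a random point on either half
  of the circle. What remains after removing that factor is an even function of the difference of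
  logarithmic heights; the symmetry of circle means rests on this.\<close>

definition height_density :: "real \<Rightarrow> real \<Rightarrow> real" where
  "height_density X d = (if cosh d < X then 1 / (2 * pi * chord X d) else 0)"

lemma measurable_chord [measurable (raw)]:
  assumes [measurable]: "f \<in> borel_measurable M" "g \<in> borel_measurable M"
  shows "(\<lambda>x. chord (f x) (g x)) \<in> borel_measurable M"
  unfolding chord_def cosh_def by measurable

lemma measurable_height_density [measurable (raw)]:
  assumes [measurable]: "f \<in> borel_measurable M" "g \<in> borel_measurable M"
  shows "(\<lambda>x. height_density (f x) (g x)) \<in> borel_measurable M"
  unfolding height_density_def cosh_def by measurable

lemma chord_minus: "chord X (- d) = chord X d" "height_density X (- d) = height_density X d"
  by (simp_all add: chord_def height_density_def)

lemma height_density_nonneg: "height_density X d \<ge> 0"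
  by (simp add: height_density_def chord_def)

lemma chord_at_circle_point:
  assumes X: "X \<ge> 1" and d: "d = X - sqrt (X\<^sup>2 - 1) * cos (2*t)"
  shows "exp ((- ln d)/2) * chord X (- ln d) = \<bar>sqrt (X\<^sup>2 - 1) * sin (2*t) / d\<bar>"
    and "cosh (- ln d) \<le> X" "sin (2*t) \<noteq> 0 \<Longrightarrow> X > 1 \<Longrightarrow> cosh (- ln d) < X"
proof -
  define s where "s = sqrt (X\<^sup>2 - 1)"
  have dpos: "d > 0" using circle_denominator_pos[OF X] by (simp add: d)
  have s2: "s\<^sup>2 = X\<^sup>2 - 1" using sqrt_bound[OF X] by (simp add: s_def)
  have ch: "cosh (- ln d) = (d + 1/d)/2"
    using dpos by (simp add: cosh_def exp_minus exp_ln field_simps)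
  have "s\<^sup>2 * (sin (2*t))\<^sup>2 = s\<^sup>2 - (s * cos (2*t))\<^sup>2"
    by (simp add: sin_squared_eq algebra_simps power_mult_distrib)
  also have "s * cos (2*t) = X - d" by (simp add: d s_def)
  finally have *: "s\<^sup>2 * (sin (2*t))\<^sup>2 = 2 * X * d - 1 - d\<^sup>2"
    using s2 by (simp add: power2_eq_square algebra_simps)
  have **: "2 * (X - cosh (- ln d)) = s\<^sup>2 * (sin (2*t))\<^sup>2 / d"
    unfolding ch * using dpos by (simp add: field_simps power2_eq_square)
  have "2 * (X - cosh (- ln d)) \<ge> 0" unfolding ** using dpos by simp
  then show le: "cosh (- ln d) \<le> X" by (simp only: zero_le_mult_iff) auto
  show "cosh (- ln d) < X" if "sin (2*t) \<noteq> 0" "X > 1"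
  proof -
    have "s\<^sup>2 > 0" using that(2) s2 by (simp add: one_less_power)
    then have "2 * (X - cosh (- ln d)) > 0" unfolding ** using that dpos by simp
    then show ?thesis by (simp only: zero_less_mult_iff) auto
  qed
  have "(exp ((- ln d)/2))\<^sup>2 = 1 / d"
    using dpos by (simp add: power2_eq_square flip: exp_add) (simp add: exp_minus field_simps)
  then have "(exp ((- ln d)/2) * chord X (- ln d))\<^sup>2 = (1/d) * (s\<^sup>2 * (sin (2*t))\<^sup>2 / d)"
    using ** dpos unfolding power_mult_distrib chord_def by simp
  also have "\<dots> = (s * sin (2*t) / d)\<^sup>2"
    by (simp add: power2_eq_square)
  finally have "\<bar>exp ((- ln d)/2) * chord X (- ln d)\<bar> = \<bar>s * sin (2*t) / d\<bar>"
    by (rule arg_cong[where f=sqrt, of "_\<^sup>2" "_\<^sup>2", unfolded real_sqrt_abs])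
  moreover have "chord X (- ln d) \<ge> 0" unfolding chord_def using le by simp
  ultimately show "exp ((- ln d)/2) * chord X (- ln d) = \<bar>sqrt (X\<^sup>2 - 1) * sin (2*t) / d\<bar>"
    unfolding s_def by (simp only: abs_mult abs_exp_cancel abs_of_nonneg)
qed

lemma cosh_less_imp_abs_less:
  fixes x y :: real
  assumes "cosh x < cosh y" "y \<ge> 0"
  shows "\<bar>x\<bar> < y"
proof (rule ccontr)
  assume "\<not> \<bar>x\<bar> < y"
  then have "cosh y \<le> cosh \<bar>x\<bar>" using assms(2)
    by (subst cosh_real_nonneg_le_iff) auto
  then show False using assms by simp
qed

text \<open>The logarithm \<open>v = - ln (X - sqrt (X\<^sup>2 - 1) cos 2t)\<close> of the height increases on this half of the circle, and
  \<open>dv/dt\<close> is twice the distance \<open>exp (v/2) * chord X v\<close> from the vertical axis, so \<open>v\<close> can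
  replace the angle.\<close>

lemma half_circle_integral:
  assumes X: "X > 1" and [measurable]: "u \<in> borel_measurable borel"
  shows "(\<integral>\<^sup>+t. u (circle_point X t) * indicator {pi/2..pi} t \<partial>lborel)
    = pi * (\<integral>\<^sup>+v. ennreal (exp (- v/2) * height_density X v) * u (Complex (- (exp (v/2) * chord X v)) (exp v)) \<partial>lborel)"
proof -
  define s where "s = sqrt (X\<^sup>2 - 1)"
  have s: "s < X" "0 \<le> s" "s\<^sup>2 = X\<^sup>2 - 1" using sqrt_bound[of X] X by (simp_all add: s_def)
  define D where "D t = X - s * cos (2*t)" for t
  have D: "D t > 0" for t using circle_denominator_pos[of X "2*t"] X by (simp add: D_def s_def)
  define g where "g t = - ln (D t)" for t
  define g' where "g' t = - (2 * s * sin (2*t)) / D t" for t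
  have sin: "sin (2*t) \<le> 0" if "t \<in> {pi/2..pi}" for t
  proof -
    have "sin (2*t) = - sin (2*t - pi)" by simp
    moreover have "sin (2*t - pi) \<ge> 0" using that by (intro sin_ge_zero) auto
    ultimately show ?thesis by simp
  qed
  define f where "f v = ennreal (exp (- v/2) * height_density X v) * u (Complex (- (exp (v/2) * chord X v)) (exp v))" for v
  have [measurable]: "f \<in> borel_measurable borel" unfolding f_def[abs_def] by measurable
  have sub: "(\<integral>\<^sup>+v. f v * indicator {g (pi/2)..g pi} v \<partial>lborel)
      = (\<integral>\<^sup>+t. f (g t) * g' t * indicator {pi/2..pi} t \<partial>lborel)"
  proof (rule nn_integral_substitution_aux)
    show "(g has_real_derivative g' t) (at t)" for t
      unfolding g_def g'_def using D[of t] unfolding D_def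
      by (auto intro!: derivative_eq_intros simp: field_simps)
    show "continuous_on {pi/2..pi} g'"
      unfolding g'_def using D unfolding D_def by (intro continuous_intros) (auto simp: less_imp_neq[THEN not_sym])
    show "g' t \<ge> 0" if "t \<in> {pi/2..pi}" for t
      unfolding g'_def using sin[OF that] D[of t] s(2) by (simp add: divide_le_0_iff mult_nonneg_nonpos)
  qed auto
  have r: "D pi * D (pi/2) = 1"
    using s(3) by (simp add: D_def power2_eq_square algebra_simps)
  then have "ln (D pi) + ln (D (pi/2)) = 0" using D[of pi] D[of "pi/2"] by (simp add: ln_mult_pos[symmetric])
  then have gpi: "g (pi/2) = - g pi" by (simp add: g_def)
  have "D pi \<le> 1"
  proof (rule ccontr)
    assume "\<not> D pi \<le> 1"
    moreover have "D pi \<le> D (pi/2)" using s by (simp add: D_def)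
    ultimately have "D pi * D (pi/2) > 1 * 1" by (intro mult_strict_mono) auto
    then show False using r by simp
  qed
  then have gpos: "g pi \<ge> 0" using D[of pi] by (simp add: g_def)
  have coshg: "cosh (g pi) = X"
  proof -
    have "1 / D pi = D (pi/2)" using r D[of pi] by (simp add: field_simps)
    then have "cosh (g pi) = (D pi + D (pi/2)) / 2"
      using D[of pi] by (simp add: cosh_def g_def exp_minus inverse_eq_divide)
    then show ?thesis by (simp add: D_def)
  qed
  have "(\<integral>\<^sup>+v. f v * indicator {g (pi/2)..g pi} v \<partial>lborel) = (\<integral>\<^sup>+v. f v \<partial>lborel)"
  proof (rule nn_integral_cong)
    fix v
    have "v \<in> {g (pi/2)..g pi}" if "f v \<noteq> 0"
    proof -
      have "cosh v < X" using that by (auto simp: f_def height_density_def split: if_splits)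
      then have "\<bar>v\<bar> < g pi" using coshg gpos by (intro cosh_less_imp_abs_less) auto
      then show ?thesis unfolding gpi by auto
    qed
    then show "f v * indicator {g (pi/2)..g pi} v = f v" by (cases "f v = 0") auto
  qed
  moreover have "(\<integral>\<^sup>+t. f (g t) * g' t * indicator {pi/2..pi} t \<partial>lborel)
      = (\<integral>\<^sup>+t. ennreal (1/pi) * (u (circle_point X t) * indicator {pi/2..pi} t) \<partial>lborel)"
  proof (rule nn_integral_cong_AE)
    have "AE t in lborel. t \<noteq> pi/2 \<and> t \<noteq> pi"
      using AE_lborel_singleton[of "pi/2"] AE_lborel_singleton[of pi] by eventually_elim simp
    then show "AE t in lborel. f (g t) * g' t * indicator {pi/2..pi} t
      = ennreal (1/pi) * (u (circle_point X t) * indicator {pi/2..pi} t)"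
    proof eventually_elim
      fix t assume ne: "t \<noteq> pi/2 \<and> t \<noteq> pi"
      show "f (g t) * g' t * indicator {pi/2..pi} t
        = ennreal (1/pi) * (u (circle_point X t) * indicator {pi/2..pi} t)"
      proof (cases "t \<in> {pi/2..pi}")
        case True
        have "sin (2*t) = - sin (2*t - pi)" by simp
        moreover have "sin (2*t - pi) > 0" using True ne by (intro sin_gt_zero) auto
        ultimately have sn: "sin (2*t) < 0" by simp
        have spos: "s > 0" using s X by (metis less_eq_real_def one_less_power pos2 power_zero_numeral diff_gt_0_iff_gt less_irrefl)
        define h where "h = exp (g t / 2) * chord X (g t)"
        have h: "h = - (s * sin (2*t) / D t)"
        proof -
          have "h = \<bar>s * sin (2*t) / D t\<bar>"
            using chord_at_circle_point(1)[of X "D t" t] X by (simp add: h_def g_def s_def D_def)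
          then show ?thesis using sn spos D[of t] by (simp add: abs_mult)
        qed
        have hpos: "h > 0" unfolding h using sn spos D[of t] by (simp add: divide_neg_pos mult_pos_neg)
        have lt: "cosh (g t) < X"
          using chord_at_circle_point(3)[of X "D t" t] X sn by (simp add: g_def D_def s_def)
        have ch: "chord X (g t) \<noteq> 0" using hpos by (auto simp: h_def)
        have "exp (- g t / 2) * height_density X (g t) * g' t = 1 / pi"
        proof -
          have "exp (- g t / 2) * height_density X (g t) = 1 / (2 * pi * h)"
            using lt by (simp add: height_density_def h_def exp_minus divide_simps)
          moreover have "g' t = 2 * h" by (simp add: g'_def h)
          ultimately show ?thesis using hpos by simp
        qed
        then have *: "ennreal (exp (- g t / 2) * height_density X (g t)) * ennreal (g' t) = ennreal (1/pi)"
          by (subst ennreal_mult''[symmetric]) (use h hpos in \<open>auto simp: g'_def\<close>)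
        have "Complex (- (exp (g t/2) * chord X (g t))) (exp (g t)) = circle_point X t"
        proof -
          have "exp (g t) = 1 / D t" using D[of t] by (simp add: g_def exp_minus inverse_eq_divide)
          then show ?thesis using h unfolding h_def[symmetric] circle_point_def s_def[symmetric] D_def[symmetric]
            by simp
        qed
        then have "f (g t) * g' t = ennreal (1/pi) * u (circle_point X t)"
          unfolding f_def *[symmetric] by (simp only: mult.assoc mult.commute[of "u _"])
        then show ?thesis using True by simp
      qed simp
    qed
  qed
  moreover have "\<dots> = ennreal (1/pi) * (\<integral>\<^sup>+t. u (circle_point X t) * indicator {pi/2..pi} t \<partial>lborel)"
    by (rule nn_integral_cmult) measurable
  ultimately have "(\<integral>\<^sup>+v. f v \<partial>lborel) = ennreal (1/pi) * (\<integral>\<^sup>+t. u (circle_point X t) * indicator {pi/2..pi} t \<partial>lborel)"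
    using sub by simp
  then have "ennreal pi * (\<integral>\<^sup>+v. f v \<partial>lborel)
      = (ennreal pi * ennreal (1/pi)) * (\<integral>\<^sup>+t. u (circle_point X t) * indicator {pi/2..pi} t \<partial>lborel)"
    by (simp add: mult.assoc)
  also have "ennreal pi * ennreal (1/pi) = 1" by (subst ennreal_mult[symmetric]) auto
  finally show ?thesis by (simp add: f_def)
qed

text \<open>The reflection \<open>t \<mapsto> \<pi> - t\<close> of the angle reflects the point in the vertical axis and exchanges the two halves of
  the circle.\<close>

lemma circle_mean_i:
  assumes X: "X > 1" and [measurable]: "u \<in> borel_measurable borel"
  shows "circle_mean X u \<i> = (\<integral>\<^sup>+v. ennreal (exp (- v/2) * height_density X v) *
     (u (Complex (exp (v/2) * chord X v) (exp v)) + u (Complex (- (exp (v/2) * chord X v)) (exp v))) \<partial>lborel)"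
proof -
  define p where "p = circle_point X"
  have [measurable]: "p \<in> borel_measurable borel" unfolding p_def by measurable
  define u' where "u' w = u (Complex (- Re w) (Im w))" for w
  have [measurable]: "u' \<in> borel_measurable borel" unfolding u'_def[abs_def] by measurable
  have refl: "u (p (pi - t)) = u' (p t)" for t
  proof -
    have "2 * (pi - t) = - (2 * t) + 2 * pi" by simp
    then have "cos (2 * (pi - t)) = cos (2*t)" "sin (2 * (pi - t)) = - sin (2*t)"
      by (simp_all only: cos_periodic sin_periodic cos_minus sin_minus)
    then show ?thesis by (simp add: p_def u'_def circle_point_def)
  qed
  have "(\<integral>\<^sup>+t. u (p t) * indicator {0..<pi} t \<partial>lborel)
      = (\<integral>\<^sup>+t. u (p t) * indicator {0..pi/2} t + u (p t) * indicator {pi/2..pi} t \<partial>lborel)"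
  proof (rule nn_integral_cong_AE)
    have "AE t in lborel. t \<noteq> pi/2 \<and> t \<noteq> pi"
      using AE_lborel_singleton[of "pi/2"] AE_lborel_singleton[of pi] by eventually_elim simp
    then show "AE t in lborel. u (p t) * indicator {0..<pi} t
        = u (p t) * indicator {0..pi/2} t + u (p t) * indicator {pi/2..pi} t"
      by eventually_elim (auto split: split_indicator)
  qed
  also have "\<dots> = (\<integral>\<^sup>+t. u (p t) * indicator {0..pi/2} t \<partial>lborel) + (\<integral>\<^sup>+t. u (p t) * indicator {pi/2..pi} t \<partial>lborel)"
    by (rule nn_integral_add) measurable
  also have "(\<integral>\<^sup>+t. u (p t) * indicator {0..pi/2} t \<partial>lborel)
      = (\<integral>\<^sup>+t. u (p (pi - t)) * indicator {0..pi/2} (pi - t) \<partial>lborel)"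
    by (rule nn_integral_real_reflect[symmetric]) measurable
  also have "\<dots> = (\<integral>\<^sup>+t. u' (p t) * indicator {pi/2..pi} t \<partial>lborel)"
    by (intro nn_integral_cong) (auto simp: refl split: split_indicator)
  finally have 1: "(\<integral>\<^sup>+t. u (p t) * indicator {0..<pi} t \<partial>lborel)
      = (\<integral>\<^sup>+t. u' (p t) * indicator {pi/2..pi} t \<partial>lborel) + (\<integral>\<^sup>+t. u (p t) * indicator {pi/2..pi} t \<partial>lborel)" .
  have "affine_move \<i> q = q" for q by (simp add: affine_move_def complex_eq_iff)
  then have "circle_mean X u \<i> = (\<integral>\<^sup>+t. u (p t) * indicator {0..<pi} t \<partial>lborel) / pi"
    by (simp add: circle_mean_def p_def nn_integral_angle)
  also have "\<dots> = (ennreal pi * ((\<integral>\<^sup>+v. ennreal (exp (- v/2) * height_density X v) * u' (Complex (- (exp (v/2) * chord X v)) (exp v)) \<partial>lborel)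
      + (\<integral>\<^sup>+v. ennreal (exp (- v/2) * height_density X v) * u (Complex (- (exp (v/2) * chord X v)) (exp v)) \<partial>lborel))) / pi"
    unfolding 1 unfolding p_def half_circle_integral[OF X \<open>u' \<in> borel_measurable borel\<close>]
      half_circle_integral[OF X assms(2)] distrib_left ..
  also have "\<dots> = (\<integral>\<^sup>+v. ennreal (exp (- v/2) * height_density X v) * u' (Complex (- (exp (v/2) * chord X v)) (exp v)) \<partial>lborel)
      + (\<integral>\<^sup>+v. ennreal (exp (- v/2) * height_density X v) * u (Complex (- (exp (v/2) * chord X v)) (exp v)) \<partial>lborel)"
    by (rule ennreal_mult_divide_eq[OF _ _, of "ennreal pi", unfolded mult.commute[of _ "ennreal pi"]]) auto
  also have "\<dots> = (\<integral>\<^sup>+v. ennreal (exp (- v/2) * height_density X v) *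
     (u (Complex (exp (v/2) * chord X v) (exp v)) + u (Complex (- (exp (v/2) * chord X v)) (exp v))) \<partial>lborel)"
    by (subst nn_integral_add[symmetric]) (auto simp: u'_def distrib_left)
  finally show ?thesis .
qed

lemma circle_mean_coordinates:
  assumes X: "X > 1" and [measurable]: "u \<in> borel_measurable borel"
  shows "circle_mean X u (Complex x (exp t)) = (\<integral>\<^sup>+v. ennreal (exp ((t - v)/2) * height_density X (v - t)) *
     (u (Complex (x + exp ((t + v)/2) * chord X (v - t)) (exp v))
      + u (Complex (x - exp ((t + v)/2) * chord X (v - t)) (exp v))) \<partial>lborel)"
proof -
  let ?z = "Complex x (exp t)"
  define F where "F v = ennreal (exp (- v/2) * height_density X v) *
     (u (Complex (x + exp t * (exp (v/2) * chord X v)) (exp t * exp v))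
      + u (Complex (x - exp t * (exp (v/2) * chord X v)) (exp t * exp v)))" for v
  have [measurable]: "F \<in> borel_measurable borel" unfolding F_def[abs_def] by measurable
  have "affine_move \<i> q = q" for q by (simp add: affine_move_def complex_eq_iff)
  then have "circle_mean X u ?z = circle_mean X (\<lambda>w. u (affine_move ?z w)) \<i>"
    by (simp add: circle_mean_def)
  also have "\<dots> = (\<integral>\<^sup>+v. F v \<partial>lborel)"
    using X by (subst circle_mean_i) (auto simp: F_def[abs_def] affine_move_def)
  also have "\<dots> = (\<integral>\<^sup>+v. F (v + - t) \<partial>lborel)"
    by (rule nn_integral_real_shift[symmetric]) measurable
  also have "\<dots> = (\<integral>\<^sup>+v. ennreal (exp ((t - v)/2) * height_density X (v - t)) *
     (u (Complex (x + exp ((t + v)/2) * chord X (v - t)) (exp v))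
      + u (Complex (x - exp ((t + v)/2) * chord X (v - t)) (exp v))) \<partial>lborel)"
  proof (rule nn_integral_cong)
    fix v
    have "exp t * exp ((v - t)/2) = exp ((t + v)/2)" "exp t * exp (v - t) = exp v"
      by (simp_all add: field_simps flip: exp_add)
    moreover have "- (v - t) / 2 = (t - v)/2" by simp
    ultimately show "F (v + - t) = ennreal (exp ((t - v)/2) * height_density X (v - t)) *
     (u (Complex (x + exp ((t + v)/2) * chord X (v - t)) (exp v))
      + u (Complex (x - exp ((t + v)/2) * chord X (v - t)) (exp v)))"
      unfolding F_def mult.assoc[symmetric] by (simp only: add_uminus_conv_diff)
  qed
  finally show ?thesis .
qed

lemma circle_mean_radius_zero: "Im z > 0 \<Longrightarrow> circle_mean 1 u z = u z"
proof -
  have "circle_point 1 t = \<i>" for t by (simp add: circle_point_def complex_eq_iff)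
  then show ?thesis by (simp add: circle_mean_def affine_move_i emeasure_angle_UNIV)
qed

lemma nn_integral_hyp_area_cong:
  "(\<And>z. Im z > 0 \<Longrightarrow> u z = v z) \<Longrightarrow> (\<integral>\<^sup>+z. u z \<partial>hyp_area) = (\<integral>\<^sup>+z. v z \<partial>hyp_area)"
  by (intro nn_integral_cong) (simp add: space_hyp_area upper_half_plane_def)

text \<open>In horocyclic coordinates the circle mean joins the heights \<open>t\<close> and \<open>s\<close> with weight
  \<open>exp ((t - s)/2) * height_density X (s - t)\<close>; multiplied by the factor \<open>exp (- t)\<close> of the area this
  is symmetric in \<open>t\<close> and \<open>s\<close>. The horizontal displacements are \<open>\<plusminus> H t s\<close> with \<open>H\<close> symmetric,
  and a translation in \<open>x\<close> moves them from one function to the other.\<close>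

lemma circle_mean_symmetric:
  assumes X: "X \<ge> 1" and [measurable]: "u \<in> borel_measurable borel" "v \<in> borel_measurable borel"
  shows "(\<integral>\<^sup>+z. v z * circle_mean X u z \<partial>hyp_area) = (\<integral>\<^sup>+z. u z * circle_mean X v z \<partial>hyp_area)"
proof (cases "X = 1")
  case True
  then show ?thesis
    by (intro nn_integral_hyp_area_cong) (simp add: circle_mean_radius_zero mult.commute)
next
  case False
  then have X: "X > 1" using X by simp
  define H where "H t s = exp ((t + s)/2) * chord X (s - t)" for t s
  have Hsym: "H s t = H t s" for s t
    using chord_minus(1)[of X "t - s"] by (simp add: H_def add.commute)
  define W where "W t s = ennreal (exp (- (t + s)/2) * height_density X (s - t))" for t s
  have Wsym: "W s t = W t s" for s t
    using chord_minus(2)[of X "t - s"] by (simp add: W_def add.commute)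
  have [measurable]: "(\<lambda>p. H (f p) (g p)) \<in> borel_measurable M" "(\<lambda>p. W (f p) (g p)) \<in> borel_measurable M"
    if [measurable]: "f \<in> borel_measurable M" "g \<in> borel_measurable M" for f g and M :: "'x measure"
    unfolding H_def W_def by measurable
  define B where "B u v t s = (\<integral>\<^sup>+x. v (Complex x (exp t)) *
      (u (Complex (x + H t s) (exp s)) + u (Complex (x - H t s) (exp s))) \<partial>lborel)"
    for u v :: "complex \<Rightarrow> ennreal" and t s
  have main: "(\<integral>\<^sup>+z. v z * circle_mean X u z \<partial>hyp_area) = (\<integral>\<^sup>+t. \<integral>\<^sup>+s. W t s * B u v t s \<partial>lborel \<partial>lborel)"
    if [measurable]: "u \<in> borel_measurable borel" "v \<in> borel_measurable borel" for u v
  proof -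
    have "(\<integral>\<^sup>+x. ennreal (exp (- t)) * (v (Complex x (exp t)) * circle_mean X u (Complex x (exp t))) \<partial>lborel)
        = (\<integral>\<^sup>+s. W t s * B u v t s \<partial>lborel)" for t
    proof -
      have w: "ennreal (exp (- t)) * ennreal (exp ((t - s)/2) * height_density X (s - t)) = W t s" for s
      proof -
        have "exp (- t) * exp ((t - s)/2) = exp (- (t + s)/2)"
          by (simp add: field_simps flip: exp_add)
        then show ?thesis
          unfolding W_def by (subst ennreal_mult[symmetric]) (auto simp: height_density_nonneg simp flip: mult.assoc)
      qed
      have "(\<integral>\<^sup>+x. ennreal (exp (- t)) * (v (Complex x (exp t)) * circle_mean X u (Complex x (exp t))) \<partial>lborel)
        = (\<integral>\<^sup>+x. (\<integral>\<^sup>+s. W t s * (v (Complex x (exp t)) * (u (Complex (x + H t s) (exp s)) + u (Complex (x - H t s) (exp s)))) \<partial>lborel) \<partial>lborel)"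
      proof (intro nn_integral_cong)
        fix x
        have "ennreal (exp (- t)) * (v (Complex x (exp t)) * circle_mean X u (Complex x (exp t)))
            = (ennreal (exp (- t)) * v (Complex x (exp t))) * circle_mean X u (Complex x (exp t))"
          by (simp only: mult.assoc)
        also have "\<dots> = (\<integral>\<^sup>+s. (ennreal (exp (- t)) * v (Complex x (exp t))) *
            (ennreal (exp ((t - s)/2) * height_density X (s - t)) *
              (u (Complex (x + H t s) (exp s)) + u (Complex (x - H t s) (exp s)))) \<partial>lborel)"
          unfolding circle_mean_coordinates[OF X that(1)] H_def[symmetric]
          by (rule nn_integral_cmult[symmetric]) measurable
        also have "\<dots> = (\<integral>\<^sup>+s. W t s * (v (Complex x (exp t)) * (u (Complex (x + H t s) (exp s)) + u (Complex (x - H t s) (exp s)))) \<partial>lborel)"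
          unfolding w[symmetric] by (simp only: mult.assoc mult.left_commute)
        finally show "ennreal (exp (- t)) * (v (Complex x (exp t)) * circle_mean X u (Complex x (exp t))) = \<dots>" .
      qed
      also have "\<dots> = (\<integral>\<^sup>+s. (\<integral>\<^sup>+x. W t s * (v (Complex x (exp t)) * (u (Complex (x + H t s) (exp s)) + u (Complex (x - H t s) (exp s)))) \<partial>lborel) \<partial>lborel)"
        by (rule lborel_pair.Fubini') measurable
      also have "\<dots> = (\<integral>\<^sup>+s. W t s * B u v t s \<partial>lborel)"
        unfolding B_def by (intro nn_integral_cong nn_integral_cmult) measurable
      finally show ?thesis .
    qed
    then show ?thesis by (subst nn_integral_hyp_area) auto
  qed
  have swap: "B u v t s = B v u s t" for t s
  proof -
    have sh: "(\<integral>\<^sup>+x. v (Complex x (exp t)) * u (Complex (x + c) (exp s)) \<partial>lborel)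
        = (\<integral>\<^sup>+x. u (Complex x (exp s)) * v (Complex (x - c) (exp t)) \<partial>lborel)" for c
      by (subst nn_integral_real_shift[symmetric, where c=c]) (auto simp: mult.commute)
    have "B u v t s = (\<integral>\<^sup>+x. v (Complex x (exp t)) * u (Complex (x + H t s) (exp s)) \<partial>lborel)
        + (\<integral>\<^sup>+x. v (Complex x (exp t)) * u (Complex (x + - H t s) (exp s)) \<partial>lborel)"
      unfolding B_def distrib_left by (subst nn_integral_add) auto
    also have "\<dots> = B v u s t"
      unfolding B_def distrib_left sh by (subst nn_integral_add) (auto simp: Hsym[of s t] add.commute)
    finally show ?thesis .
  qed
  have [measurable]: "(\<lambda>p. B u v (f p) (g p)) \<in> borel_measurable M"
    if [measurable]: "f \<in> borel_measurable M" "g \<in> borel_measurable M" for f g and M :: "'x measure"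
    unfolding B_def by measurable
  have "(\<integral>\<^sup>+z. v z * circle_mean X u z \<partial>hyp_area) = (\<integral>\<^sup>+t. \<integral>\<^sup>+s. W t s * B u v t s \<partial>lborel \<partial>lborel)"
    by (rule main) measurable
  also have "\<dots> = (\<integral>\<^sup>+s. \<integral>\<^sup>+t. W t s * B u v t s \<partial>lborel \<partial>lborel)"
    by (rule lborel_pair.Fubini') (simp add: split_beta', measurable)
  also have "\<dots> = (\<integral>\<^sup>+s. \<integral>\<^sup>+t. W s t * B v u s t \<partial>lborel \<partial>lborel)"
    by (simp only: swap Wsym)
  also have "\<dots> = (\<integral>\<^sup>+z. u z * circle_mean X v z \<partial>hyp_area)"
    by (rule main[symmetric]) measurable
  finally show ?thesis .
qed

text \<open>At a fixed logarithmic height \<open>v\<close> the radius parameter of the point \<open>x + i e\<^sup>v\<close> is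
  \<open>X = cosh v + x\<^sup>2 e\<^sup>-\<^sup>v / 2\<close>, and \<open>dX = x e\<^sup>-\<^sup>v dx\<close> cancels the inverse of \<open>x\<close> in the height density.\<close>

lemma hyp_area_polar:
  assumes [measurable]: "u \<in> borel_measurable borel"
  shows "(\<integral>\<^sup>+z. u z \<partial>hyp_area) = ennreal (2 * pi) * (\<integral>\<^sup>+X. circle_mean X u \<i> * indicator {1<..} X \<partial>lborel)"
proof -
  define G where "G v x = u (Complex x (exp v)) + u (Complex (- x) (exp v))" for v x
  have [measurable]: "(\<lambda>p. G (f p) (g p)) \<in> borel_measurable M"
    if [measurable]: "f \<in> borel_measurable M" "g \<in> borel_measurable M" for f g and M :: "'x measure"
    unfolding G_def by measurable
  have inner: "(\<integral>\<^sup>+X. ennreal (exp (- v/2) * height_density X v) * G v (exp (v/2) * chord X v) * indicator {1<..} X \<partial>lborel)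
      = ennreal (1/(2*pi)) * (ennreal (exp (- v)) * (\<integral>\<^sup>+x. G v x * indicator {0<..} x \<partial>lborel))" for v
  proof -
    define f where "f X = ennreal (exp (- v/2) * height_density X v) * G v (exp (v/2) * chord X v)" for X
    have [measurable]: "f \<in> borel_measurable borel" unfolding f_def[abs_def] by measurable
    define g where "g x = cosh v + x\<^sup>2 * exp (- v) / 2" for x
    have "(\<integral>\<^sup>+X. f X * indicator {cosh v<..} X \<partial>lborel)
        = (\<integral>\<^sup>+x. f (g x) * ennreal (x * exp (- v)) * indicator {0<..} x \<partial>lborel)"
    proof (rule nn_integral_substitution_exhaustion[where a="\<lambda>n. 1 / (real n + 1)" and b="\<lambda>n. real n + 2"])
      show "(g has_real_derivative x * exp (- v)) (at x)" for x
        unfolding g_def by (auto intro!: derivative_eq_intros)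
      show "g \<in> borel_measurable borel" unfolding g_def[abs_def] by measurable
      show UN: "(\<Union>n. {1 / (real n + 1)..real n + 2}) = {0<..}" by (rule Union_intervals_positive)
      show "(\<Union>n. {g (1 / (real n + 1))..g (real n + 2)}) = {cosh v<..}"
      proof safe
        fix X assume X: "cosh v < X"
        define x where "x = sqrt (2 * (X - cosh v) * exp v)"
        have "x > 0" using X by (simp add: x_def)
        have gx: "g x = X" using X by (simp add: g_def x_def exp_minus field_simps)
        have "x \<in> (\<Union>n. {1 / (real n + 1)..real n + 2})" unfolding UN using \<open>x > 0\<close> by simp
        then obtain n where n: "1 / (real n + 1) \<le> x" "x \<le> real n + 2" by (auto simp only: UN_iff atLeastAtMost_iff)
        have "g (1 / (real n + 1)) \<le> X" "X \<le> g (real n + 2)"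
          unfolding gx[symmetric] g_def using n \<open>x > 0\<close>
          by (auto intro!: divide_right_mono mult_right_mono power_mono)
        then show "X \<in> (\<Union>n. {g (1 / (real n + 1))..g (real n + 2)})" by (intro UN_I[of n]) auto
      next
        fix X n assume "X \<in> {g (1 / (real n + 1))..g (real n + 2)}"
        moreover have "g (1 / (real n + 1)) > cosh v" by (simp add: g_def)
        ultimately show "cosh v < X" by (simp only: atLeastAtMost_iff) linarith
      qed
      show "1 / (real n + 1) < real n + 2" for n
      proof -
        have "1 / (real n + 1) \<le> 1" by simp
        then show ?thesis by linarith
      qed
    qed (auto simp: incseq_def decseq_def frac_le intro!: continuous_intros)
    moreover have "f X * indicator {cosh v<..} X = f X * indicator {1<..} X" for X
      using cosh_real_ge_1[of v] by (auto simp: f_def height_density_def split: split_indicator)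
    moreover have "f (g x) * ennreal (x * exp (- v)) * indicator {0<..} x
        = ennreal (1/(2*pi)) * (ennreal (exp (- v)) * (G v x * indicator {0<..} x))" for x
    proof (cases "x > 0")
      case True
      have "chord (g x) v = sqrt (x\<^sup>2 * exp (- v))" by (simp add: chord_def g_def)
      also have "x\<^sup>2 * exp (- v) = (x * exp (- v/2))\<^sup>2"
        unfolding power_mult_distrib exp_double[symmetric] by simp
      finally have c: "chord (g x) v = x * exp (- v/2)" using True by (simp del: real_sqrt_mult)
      have "exp (v/2) * chord (g x) v = x" unfolding c by (simp add: exp_minus)
      moreover have "exp (- v/2) * height_density (g x) v * (x * exp (- v)) = 1/(2*pi) * exp (- v)"
        unfolding height_density_def c using True by (simp add: g_def exp_minus)
      then have "ennreal (exp (- v/2) * height_density (g x) v) * ennreal (x * exp (- v)) = ennreal (1/(2*pi)) * ennreal (exp (- v))"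
        using True by (subst (1 2) ennreal_mult[symmetric]) (auto simp: height_density_nonneg)
      ultimately show ?thesis using True
        by (simp add: f_def) (metis mult.assoc mult.commute)
    qed simp
    ultimately have "(\<integral>\<^sup>+X. f X * indicator {1<..} X \<partial>lborel)
        = (\<integral>\<^sup>+x. ennreal (1/(2*pi)) * (ennreal (exp (- v)) * (G v x * indicator {0<..} x)) \<partial>lborel)"
      by simp
    also have "\<dots> = ennreal (1/(2*pi)) * (ennreal (exp (- v)) * (\<integral>\<^sup>+x. G v x * indicator {0<..} x \<partial>lborel))"
      by (subst nn_integral_cmult, measurable, subst nn_integral_cmult, measurable)
    finally show ?thesis by (simp add: f_def)
  qed
  have full: "(\<integral>\<^sup>+x. G v x * indicator {0<..} x \<partial>lborel) = (\<integral>\<^sup>+x. u (Complex x (exp v)) \<partial>lborel)" for v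
  proof -
    have "(\<integral>\<^sup>+x. G v x * indicator {0<..} x \<partial>lborel)
        = (\<integral>\<^sup>+x. u (Complex x (exp v)) * indicator {0<..} x \<partial>lborel) + (\<integral>\<^sup>+x. u (Complex (- x) (exp v)) * indicator {0<..} x \<partial>lborel)"
      unfolding G_def distrib_right by (rule nn_integral_add) measurable
    also have "(\<integral>\<^sup>+x. u (Complex (- x) (exp v)) * indicator {0<..} x \<partial>lborel)
        = (\<integral>\<^sup>+x. u (Complex x (exp v)) * indicator {..<0} x \<partial>lborel)"
      by (subst nn_integral_real_reflect[symmetric, where c=0])
        (auto intro!: nn_integral_cong split: split_indicator)
    also have "(\<integral>\<^sup>+x. u (Complex x (exp v)) * indicator {0<..} x \<partial>lborel) + \<dots>
        = (\<integral>\<^sup>+x. u (Complex x (exp v)) * indicator {0<..} x + u (Complex x (exp v)) * indicator {..<0} x \<partial>lborel)"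
      by (rule nn_integral_add[symmetric]) measurable
    also have "\<dots> = (\<integral>\<^sup>+x. u (Complex x (exp v)) \<partial>lborel)"
      by (rule nn_integral_cong_AE, use AE_lborel_singleton[of 0] in eventually_elim)
        (auto split: split_indicator)
    finally show ?thesis .
  qed
  have "(\<integral>\<^sup>+X. circle_mean X u \<i> * indicator {1<..} X \<partial>lborel)
      = (\<integral>\<^sup>+X. \<integral>\<^sup>+v. ennreal (exp (- v/2) * height_density X v) * G v (exp (v/2) * chord X v) * indicator {1<..} X \<partial>lborel \<partial>lborel)"
  proof (rule nn_integral_cong)
    fix X :: real
    show "circle_mean X u \<i> * indicator {1<..} X
      = (\<integral>\<^sup>+v. ennreal (exp (- v/2) * height_density X v) * G v (exp (v/2) * chord X v) * indicator {1<..} X \<partial>lborel)"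
      by (cases "X > 1") (simp_all add: circle_mean_i G_def)
  qed
  also have "\<dots> = (\<integral>\<^sup>+v. \<integral>\<^sup>+X. ennreal (exp (- v/2) * height_density X v) * G v (exp (v/2) * chord X v) * indicator {1<..} X \<partial>lborel \<partial>lborel)"
    by (rule lborel_pair.Fubini') measurable
  also have "\<dots> = (\<integral>\<^sup>+v. ennreal (1/(2*pi)) * (ennreal (exp (- v)) * (\<integral>\<^sup>+x. u (Complex x (exp v)) \<partial>lborel)) \<partial>lborel)"
    by (simp only: inner full)
  also have "\<dots> = ennreal (1/(2*pi)) * (\<integral>\<^sup>+v. ennreal (exp (- v)) * (\<integral>\<^sup>+x. u (Complex x (exp v)) \<partial>lborel) \<partial>lborel)"
    by (rule nn_integral_cmult) measurable
  also have "(\<integral>\<^sup>+v. ennreal (exp (- v)) * (\<integral>\<^sup>+x. u (Complex x (exp v)) \<partial>lborel) \<partial>lborel) = (\<integral>\<^sup>+z. u z \<partial>hyp_area)"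
    by (subst nn_integral_hyp_area) (auto intro!: nn_integral_cong nn_integral_cmult[symmetric])
  finally have "ennreal (2*pi) * (\<integral>\<^sup>+X. circle_mean X u \<i> * indicator {1<..} X \<partial>lborel)
      = (ennreal (2*pi) * ennreal (1/(2*pi))) * (\<integral>\<^sup>+z. u z \<partial>hyp_area)"
    by (simp only: mult.assoc)
  also have "ennreal (2*pi) * ennreal (1/(2*pi)) = 1" by (subst ennreal_mult[symmetric]) auto
  finally show ?thesis by simp
qed

lemma hyp_area_affine_invariant:
  assumes z: "Im z > 0" and [measurable]: "u \<in> borel_measurable borel"
  shows "(\<integral>\<^sup>+w. u (affine_move z w) \<partial>hyp_area) = (\<integral>\<^sup>+w. u w \<partial>hyp_area)"
proof -
  (* in logarithmic height, multiplication by Im z is a translation *)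
  define c where "c = ln (Im z)"
  have c: "Im z = exp c" using z by (simp add: c_def)
  define F where "F t = (\<integral>\<^sup>+x. ennreal (exp (- t)) * u (Complex x (exp t)) \<partial>lborel)" for t
  have [measurable]: "F \<in> borel_measurable borel" unfolding F_def[abs_def] by measurable
  have "(\<integral>\<^sup>+x. ennreal (exp (- t)) * u (affine_move z (Complex x (exp t))) \<partial>lborel) = F (t + c)" for t
  proof -
    have "F (t + c) = ennreal \<bar>exp c\<bar> * (\<integral>\<^sup>+x. ennreal (exp (- (t + c))) * u (Complex (Re z + exp c * x) (exp (t + c))) \<partial>lborel)"
      unfolding F_def by (rule nn_integral_real_affine) auto
    also have "\<dots> = (\<integral>\<^sup>+x. (ennreal (exp c) * ennreal (exp (- (t + c)))) * u (Complex (Re z + exp c * x) (exp (t + c))) \<partial>lborel)"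
      unfolding mult.assoc by (subst nn_integral_cmult) auto
    also have "ennreal (exp c) * ennreal (exp (- (t + c))) = ennreal (exp (- t))"
      by (subst ennreal_mult[symmetric]) (auto simp flip: exp_add)
    finally show ?thesis by (simp add: affine_move_def c exp_add mult.commute)
  qed
  then have "(\<integral>\<^sup>+w. u (affine_move z w) \<partial>hyp_area) = (\<integral>\<^sup>+t. F (t + c) \<partial>lborel)"
    by (subst nn_integral_hyp_area) auto
  also have "\<dots> = (\<integral>\<^sup>+t. F t \<partial>lborel)" by (rule nn_integral_real_shift) measurable
  also have "\<dots> = (\<integral>\<^sup>+w. u w \<partial>hyp_area)" by (simp add: F_def nn_integral_hyp_area)
  finally show ?thesis .
qed

text \<open>A matrix of determinant \<open>1\<close> is an affine one times a rotation. Rotations preserve circle means about \<open>\<i>\<close>,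
  and by the polar formula these determine the area.\<close>

lemma hyp_area_moebius_invariant:
  assumes A: "det A = 1" and [measurable]: "u \<in> borel_measurable borel"
  shows "(\<integral>\<^sup>+w. u (moebius_map A w) \<partial>hyp_area) = (\<integral>\<^sup>+w. u w \<partial>hyp_area)"
proof -
  define z where "z = moebius_map A \<i>"
  have z: "Im z > 0" unfolding z_def by (rule Im_moebius_map_pos[OF A]) simp
  have "affine_matrix \<i> = mat 1" by (simp add: affine_matrix_def vec_eq_iff forall_2 mat_def)
  then obtain a where a: "A = affine_matrix z ** rotation a"
    using moebius_factor[OF A, of \<i>] by (auto simp: z_def)
  have "(\<integral>\<^sup>+w. u (moebius_map A w) \<partial>hyp_area) = (\<integral>\<^sup>+w. u (affine_move z (moebius_map (rotation a) w)) \<partial>hyp_area)"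
    by (intro nn_integral_hyp_area_cong)
      (simp add: a moebius_map_compose det_rotation moebius_affine_matrix[OF z])
  also have "\<dots> = (\<integral>\<^sup>+w. u (affine_move z w) \<partial>hyp_area)"
  proof -
    define v where "v w = u (affine_move z w)" for w
    have [measurable]: "v \<in> borel_measurable borel" unfolding v_def[abs_def] by measurable
    have i: "moebius_map (rotation a) \<i> = \<i>"
      using circle_point_moebius[of 1 a] by (simp add: circle_point_def complex_eq_iff)
    have "circle_mean X (\<lambda>w. v (moebius_map (rotation a) w)) \<i> = circle_mean X v \<i>" if "X > 1" for X
      using circle_mean_moebius[OF det_rotation, of \<i> X v a] that by (simp add: i)
    then have "circle_mean X (\<lambda>w. v (moebius_map (rotation a) w)) \<i> * indicator {1<..} X
        = circle_mean X v \<i> * indicator {1<..} X" for X :: real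
      by (cases "X > 1") auto
    then have "(\<integral>\<^sup>+w. v (moebius_map (rotation a) w) \<partial>hyp_area) = (\<integral>\<^sup>+w. v w \<partial>hyp_area)"
      by (subst (1 2) hyp_area_polar) auto
    then show ?thesis by (simp add: v_def)
  qed
  also have "\<dots> = (\<integral>\<^sup>+w. u w \<partial>hyp_area)" by (rule hyp_area_affine_invariant[OF z]) measurable
  finally show ?thesis .
qed

section \<open>Abel averages of circle means\<close>

text \<open>For \<open>T = cosh t\<close>, averaging circle means with this weight gives the operator \<open>sin (t D) / D\<close>, where
  \<open>D = sqrt (\<Delta> - 1/4)\<close>.\<close>

definition abel_weight :: "real \<Rightarrow> real \<Rightarrow> real" where
  "abel_weight T X = (if 1 < X \<and> X < T then 1 / sqrt (2 * (T - X)) else 0)"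

lemma measurable_abel_weight [measurable (raw)]:
  assumes [measurable]: "f \<in> borel_measurable M" "g \<in> borel_measurable M"
  shows "(\<lambda>x. abel_weight (f x) (g x)) \<in> borel_measurable M"
  unfolding abel_weight_def by measurable

lemma abel_weight_nonneg: "abel_weight T X \<ge> 0"
  by (simp add: abel_weight_def)

definition abel_mean :: "real \<Rightarrow> (complex \<Rightarrow> ennreal) \<Rightarrow> complex \<Rightarrow> ennreal" where
  "abel_mean T u z = (\<integral>\<^sup>+X. ennreal (abel_weight T X) * circle_mean X u z \<partial>lborel)"

lemma measurable_abel_mean [measurable (raw)]:
  assumes [measurable]: "f \<in> borel_measurable M" "g \<in> borel_measurable M" "u \<in> borel_measurable borel"
  shows "(\<lambda>x. abel_mean (f x) u (g x)) \<in> borel_measurable M"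
  unfolding abel_mean_def by measurable

definition abel_mass :: "real \<Rightarrow> ennreal" where
  "abel_mass T = (\<integral>\<^sup>+X. ennreal (abel_weight T X) \<partial>lborel)"

lemma abel_mean_const: "abel_mean T (\<lambda>_. c) = (\<lambda>_. abel_mass T * c)"
  by (rule ext) (simp add: abel_mean_def abel_mass_def circle_mean_one nn_integral_multc)

lemma nn_integral_arcsine:
  fixes a b :: real
  assumes "a < b"
  shows "(\<integral>\<^sup>+X. ennreal (if a < X \<and> X < b then 1 / sqrt ((b - X) * (X - a)) else 0) \<partial>lborel) = ennreal pi"
proof -
  define r where "r = (b - a)/2"
  have r: "r > 0" "b = a + 2 * r" using assms by (simp_all add: r_def field_simps)
  define f where "f X = ennreal (if a < X \<and> X < b then 1 / sqrt ((b - X) * (X - a)) else 0)" for X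
  have [measurable]: "f \<in> borel_measurable borel" unfolding f_def[abs_def] by measurable
  define g where "g t = a + r - r * cos t" for t
  have "(\<integral>\<^sup>+X. f X * indicator {g 0..g pi} X \<partial>lborel) = (\<integral>\<^sup>+t. f (g t) * ennreal (r * sin t) * indicator {0..pi} t \<partial>lborel)"
  proof (rule nn_integral_substitution_aux)
    show "(g has_real_derivative r * sin t) (at t)" for t
      unfolding g_def by (auto intro!: derivative_eq_intros)
    show "continuous_on {0..pi} (\<lambda>t. r * sin t)" by (intro continuous_intros)
    show "0 \<le> r * sin t" if "t \<in> {0..pi}" for t using that r by (simp add: sin_ge_zero)
  qed auto
  moreover have "(\<integral>\<^sup>+X. f X * indicator {g 0..g pi} X \<partial>lborel) = (\<integral>\<^sup>+X. f X \<partial>lborel)"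
    by (intro nn_integral_cong) (auto simp: f_def g_def r split: split_indicator)
  moreover have "(\<integral>\<^sup>+t. f (g t) * ennreal (r * sin t) * indicator {0..pi} t \<partial>lborel)
      = (\<integral>\<^sup>+t. indicator {0..pi} t \<partial>lborel)"
  proof (rule nn_integral_cong_AE)
    have "AE t in lborel. t \<noteq> 0 \<and> t \<noteq> pi"
      using AE_lborel_singleton[of 0] AE_lborel_singleton[of pi] by eventually_elim simp
    then show "AE t in lborel. f (g t) * ennreal (r * sin t) * indicator {0..pi} t = indicator {0..pi} t"
    proof eventually_elim
      fix t assume ne: "t \<noteq> 0 \<and> t \<noteq> pi"
      show "f (g t) * ennreal (r * sin t) * indicator {0..pi} t = indicator {0..pi} t"
      proof (cases "t \<in> {0..pi}")
        case True
        then have sn: "sin t > 0" using ne by (intro sin_gt_zero) auto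
        have c: "\<bar>cos t\<bar> < 1"
        proof -
          have "(cos t)\<^sup>2 < 1" using sn by (simp add: cos_squared_eq)
          then show ?thesis by (simp add: abs_square_less_1)
        qed
        then have "- r < r * cos t" "r * cos t < r" using r
          using mult_strict_left_mono[of "-1" "cos t" r] mult_strict_left_mono[of "cos t" 1 r] by auto
        then have in_ab: "a < g t" "g t < b" using r by (simp_all add: g_def)
        have "(b - g t) * (g t - a) = r\<^sup>2 * (1 - (cos t)\<^sup>2)"
          by (simp add: g_def r(2) power2_eq_square algebra_simps)
        also have "\<dots> = (r * sin t)\<^sup>2" by (simp add: cos_squared_eq power_mult_distrib)
        finally have "sqrt ((b - g t) * (g t - a)) = r * sin t" using r sn by simp
        then have "f (g t) = ennreal (1 / (r * sin t))" using in_ab by (simp add: f_def)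
        then have "f (g t) * ennreal (r * sin t) = ennreal (1 / (r * sin t) * (r * sin t))"
          using r sn by (simp only:) (rule ennreal_mult[symmetric], auto)
        then show ?thesis using r sn by simp
      qed simp
    qed
  qed
  ultimately show ?thesis by (simp add: f_def)
qed

text \<open>The weight is chosen so that, multiplied by the height density, it becomes an arcsine density,
  whose total mass does not depend on the height \<open>u\<close> as long as \<open>cosh u < T\<close>.\<close>

lemma abel_weight_height_density:
  "(\<integral>\<^sup>+X. ennreal (abel_weight T X * height_density X u) \<partial>lborel) = (if cosh u < T then ennreal (1/4) else 0)"
proof (cases "cosh u < T")
  case True
  have "ennreal (abel_weight T X * height_density X u)
      = ennreal (1 / (4 * pi)) * ennreal (if cosh u < X \<and> X < T then 1 / sqrt ((T - X) * (X - cosh u)) else 0)" for X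
  proof (cases "cosh u < X \<and> X < T")
    case True
    then have "1 < X" using cosh_real_ge_1[of u] by linarith
    have "abel_weight T X * height_density X u = 1 / (4 * pi) * (1 / sqrt ((T - X) * (X - cosh u)))"
      using True \<open>1 < X\<close> unfolding abel_weight_def height_density_def chord_def real_sqrt_mult
      by (simp add: field_simps)
    then show ?thesis using True by (simp add: ennreal_mult'[symmetric])
  next
    case False
    then show ?thesis by (auto simp: abel_weight_def height_density_def)
  qed
  then have "(\<integral>\<^sup>+X. ennreal (abel_weight T X * height_density X u) \<partial>lborel)
      = ennreal (1 / (4 * pi)) * ennreal pi"
    using nn_integral_arcsine[OF True] by (simp add: nn_integral_cmult)
  also have "\<dots> = ennreal (1/4)" by (subst ennreal_mult[symmetric]) auto
  finally show ?thesis using True by simp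
next
  case False
  then have "ennreal (abel_weight T X * height_density X u) = 0" for X
    by (auto simp: abel_weight_def height_density_def)
  then show ?thesis using False by (simp only: nn_integral_const if_False mult_zero_left)
qed

lemma circle_mean_height_function:
  assumes X: "X > 1" and z: "Im z > 0" and [measurable]: "h \<in> borel_measurable borel"
  shows "circle_mean X (\<lambda>w. h (ln (Im w))) z
    = (\<integral>\<^sup>+u. ennreal (2 * exp (- u/2) * height_density X u) * h (ln (Im z) + u) \<partial>lborel)"
proof -
  define t where "t = ln (Im z)"
  have "z = Complex (Re z) (exp t)" using z by (simp add: t_def complex_eq_iff)
  then have "circle_mean X (\<lambda>w. h (ln (Im w))) z
      = circle_mean X (\<lambda>w. h (ln (Im w))) (Complex (Re z) (exp t))" by simp
  also have "\<dots> = (\<integral>\<^sup>+v. ennreal (exp ((t - v)/2) * height_density X (v - t)) * (h v + h v) \<partial>lborel)"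
    by (subst circle_mean_coordinates[OF X]) auto
  also have "\<dots> = (\<integral>\<^sup>+v. ennreal (exp ((t - (v + t))/2) * height_density X ((v + t) - t)) * (h (v + t) + h (v + t)) \<partial>lborel)"
    by (rule nn_integral_real_shift[symmetric]) measurable
  also have "\<dots> = (\<integral>\<^sup>+u. ennreal (2 * exp (- u/2) * height_density X u) * h (ln (Im z) + u) \<partial>lborel)"
  proof (rule nn_integral_cong)
    fix u
    have "ennreal (2 * exp (- u/2) * height_density X u) = 2 * ennreal (exp (- u/2) * height_density X u)"
      by (simp add: ennreal_mult' height_density_nonneg mult.assoc)
    then show "ennreal (exp ((t - (u + t))/2) * height_density X ((u + t) - t)) * (h (u + t) + h (u + t))
        = ennreal (2 * exp (- u/2) * height_density X u) * h (ln (Im z) + u)"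
      by (simp add: t_def add.commute mult_2[symmetric] mult_ac)
  qed
  finally show ?thesis .
qed

lemma abel_mean_height_function:
  assumes t: "t \<ge> 0" and z: "Im z > 0" and [measurable]: "h \<in> borel_measurable borel"
  shows "abel_mean (cosh t) (\<lambda>w. h (ln (Im w))) z
    = ennreal (1/2) * (\<integral>\<^sup>+u. indicator {-t<..<t} u * (ennreal (exp (- u/2)) * h (ln (Im z) + u)) \<partial>lborel)"
proof -
  have "abel_mean (cosh t) (\<lambda>w. h (ln (Im w))) z
      = (\<integral>\<^sup>+X. \<integral>\<^sup>+u. ennreal (abel_weight (cosh t) X * height_density X u) * (ennreal (2 * exp (- u/2)) * h (ln (Im z) + u)) \<partial>lborel \<partial>lborel)"
    unfolding abel_mean_def
  proof (intro nn_integral_cong)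
    fix X
    show "ennreal (abel_weight (cosh t) X) * circle_mean X (\<lambda>w. h (ln (Im w))) z
      = (\<integral>\<^sup>+u. ennreal (abel_weight (cosh t) X * height_density X u) * (ennreal (2 * exp (- u/2)) * h (ln (Im z) + u)) \<partial>lborel)"
    proof (cases "X > 1")
      case True
      have e: "ennreal (abel_weight (cosh t) X) * (ennreal (2 * exp (- u/2) * height_density X u) * h (ln (Im z) + u))
          = ennreal (abel_weight (cosh t) X * height_density X u) * (ennreal (2 * exp (- u/2)) * h (ln (Im z) + u))" for u
      proof -
        have "ennreal (abel_weight (cosh t) X) * ennreal (2 * exp (- u/2) * height_density X u)
            = ennreal (abel_weight (cosh t) X * height_density X u) * ennreal (2 * exp (- u/2))"
          by (subst (1 2) ennreal_mult[symmetric]) (auto simp: abel_weight_nonneg height_density_nonneg mult_ac)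
        then show ?thesis by (simp only: mult.assoc[symmetric])
      qed
      show ?thesis
        unfolding circle_mean_height_function[OF True z assms(3)] e[symmetric]
        by (rule nn_integral_cmult[symmetric]) measurable
    next
      case False
      then show ?thesis by (simp add: abel_weight_def)
    qed
  qed
  also have "\<dots> = (\<integral>\<^sup>+u. \<integral>\<^sup>+X. ennreal (abel_weight (cosh t) X * height_density X u) * (ennreal (2 * exp (- u/2)) * h (ln (Im z) + u)) \<partial>lborel \<partial>lborel)"
    by (rule lborel_pair.Fubini') measurable
  also have "\<dots> = (\<integral>\<^sup>+u. (if cosh u < cosh t then ennreal (1/4) else 0) * (ennreal (2 * exp (- u/2)) * h (ln (Im z) + u)) \<partial>lborel)"
    by (simp add: nn_integral_multc abel_weight_height_density)
  also have "\<dots> = (\<integral>\<^sup>+u. ennreal (1/2) * (indicator {-t<..<t} u * (ennreal (exp (- u/2)) * h (ln (Im z) + u))) \<partial>lborel)"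
  proof (rule nn_integral_cong)
    fix u
    have iff: "cosh u < cosh t \<longleftrightarrow> u \<in> {-t<..<t}"
      using cosh_real_nonneg_less_iff[of "\<bar>u\<bar>" t] t by auto
    have "ennreal (1/4) * ennreal (2 * exp (- u/2)) = ennreal (1/2) * ennreal (exp (- u/2))"
      by (subst (1 2) ennreal_mult[symmetric]) auto
    then have "ennreal (1/4) * (ennreal (2 * exp (- u/2)) * h (ln (Im z) + u)) = ennreal (1/2) * (ennreal (exp (- u/2)) * h (ln (Im z) + u))"
      by (simp only: mult.assoc[symmetric])
    then show "(if cosh u < cosh t then ennreal (1/4) else 0) * (ennreal (2 * exp (- u/2)) * h (ln (Im z) + u))
       = ennreal (1/2) * (indicator {-t<..<t} u * (ennreal (exp (- u/2)) * h (ln (Im z) + u)))"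
      unfolding iff by (simp split: split_indicator)
  qed
  also have "\<dots> = ennreal (1/2) * (\<integral>\<^sup>+u. indicator {-t<..<t} u * (ennreal (exp (- u/2)) * h (ln (Im z) + u)) \<partial>lborel)"
    by (rule nn_integral_cmult) measurable
  finally show ?thesis .
qed

lemma circle_mean_cong:
  assumes "X \<ge> 1" "Im z > 0" "\<And>w. Im w > 0 \<Longrightarrow> u w = v w"
  shows "circle_mean X u z = circle_mean X v z"
  unfolding circle_mean_def using assms Im_circle_point_pos[OF assms(1)]
  by (intro nn_integral_cong) (simp add: affine_move_def)

lemma abel_mean_cong:
  assumes "Im z > 0" "\<And>w. Im w > 0 \<Longrightarrow> u w = v w"
  shows "abel_mean T u z = abel_mean T v z"
  unfolding abel_mean_def
proof (rule nn_integral_cong)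
  fix X
  show "ennreal (abel_weight T X) * circle_mean X u z = ennreal (abel_weight T X) * circle_mean X v z"
    using circle_mean_cong[of X z u v] assms by (cases "X > 1") (auto simp: abel_weight_def)
qed

text \<open>A function of the logarithmic height that is tuned so that its circle mean about \<open>\<i>\<close> is the indicator function of the radii
  beyond \<open>Y\<close>, up to a constant (\<open>circle_mean_tail_profile\<close>): against the height density it
  becomes an arcsine density on the interval from \<open>Y\<close> to the radius. This is the inversion of the Abel
  transform that sends a distribution of radii to the distribution of heights.\<close>

definition tail_profile :: "real \<Rightarrow> real \<Rightarrow> ennreal" where
  "tail_profile Y u = ennreal (if u > 0 \<and> cosh u > Y then exp (u/2) * sinh u / sqrt (cosh u - Y) else 0)"

lemma circle_mean_tail_profile:
  assumes c: "c \<ge> 1" and Y: "Y \<ge> 1"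
  shows "circle_mean c (\<lambda>w. tail_profile Y (ln (Im w))) \<i> = ennreal (1 / sqrt 2) * indicator {Y<..} c"
proof (cases "c = 1")
  case True
  then show ?thesis using Y by (simp add: circle_mean_radius_zero tail_profile_def)
next
  case False
  then have c: "c > 1" using c by simp
  have [measurable]: "tail_profile Y \<in> borel_measurable borel"
    unfolding tail_profile_def[abs_def] cosh_def sinh_def by measurable
  define f where "f X = ennreal (if Y < X \<and> X < c then 1 / sqrt ((c - X) * (X - Y)) else 0)" for X
  have [measurable]: "f \<in> borel_measurable borel" unfolding f_def[abs_def] by measurable
  have [measurable]: "(cosh :: real \<Rightarrow> real) \<in> borel_measurable borel" "(sinh :: real \<Rightarrow> real) \<in> borel_measurable borel"
    unfolding cosh_def[abs_def] sinh_def[abs_def] by measurable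
  have "circle_mean c (\<lambda>w. tail_profile Y (ln (Im w))) \<i>
      = (\<integral>\<^sup>+u. ennreal (2 * exp (- u/2) * height_density c u) * tail_profile Y u \<partial>lborel)"
    using c by (simp add: circle_mean_height_function)
  also have "\<dots> = (\<integral>\<^sup>+u. ennreal (1 / (pi * sqrt 2)) * (f (cosh u) * ennreal (sinh u) * indicator {0<..} u) \<partial>lborel)"
  proof (rule nn_integral_cong)
    fix u
    show "ennreal (2 * exp (- u/2) * height_density c u) * tail_profile Y u
      = ennreal (1 / (pi * sqrt 2)) * (f (cosh u) * ennreal (sinh u) * indicator {0<..} u)"
    proof (cases "u > 0 \<and> Y < cosh u \<and> cosh u < c")
      case True
      have "2 * exp (- u/2) * height_density c u * (exp (u/2) * sinh u / sqrt (cosh u - Y))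
          = 1 / (pi * sqrt 2) * (1 / sqrt ((c - cosh u) * (cosh u - Y)) * sinh u)"
        using True unfolding height_density_def chord_def real_sqrt_mult
        by (simp add: exp_minus field_simps)
      moreover have "tail_profile Y u = ennreal (exp (u/2) * sinh u / sqrt (cosh u - Y))"
        using True by (simp add: tail_profile_def)
      ultimately have "ennreal (2 * exp (- u/2) * height_density c u) * tail_profile Y u
          = ennreal (1 / (pi * sqrt 2) * (1 / sqrt ((c - cosh u) * (cosh u - Y)) * sinh u))"
        using True by (simp only: ennreal_mult'[symmetric] height_density_nonneg) (subst ennreal_mult'[symmetric], auto simp: height_density_nonneg)
      also have "\<dots> = ennreal (1 / (pi * sqrt 2)) * (ennreal (1 / sqrt ((c - cosh u) * (cosh u - Y))) * ennreal (sinh u))"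
        using True by (subst ennreal_mult', simp, subst ennreal_mult', auto)
      finally show ?thesis using True by (simp add: f_def)
    next
      case False
      then show ?thesis by (auto simp: f_def height_density_def tail_profile_def split: split_indicator)
    qed
  qed
  also have "\<dots> = ennreal (1 / (pi * sqrt 2)) * (\<integral>\<^sup>+u. f (cosh u) * ennreal (sinh u) * indicator {0<..} u \<partial>lborel)"
    by (rule nn_integral_cmult) measurable
  also have "(\<integral>\<^sup>+u. f (cosh u) * ennreal (sinh u) * indicator {0<..} u \<partial>lborel)
      = (\<integral>\<^sup>+X. f X * indicator {1<..} X \<partial>lborel)"
  proof (rule nn_integral_substitution_exhaustion[symmetric, where a="\<lambda>n. 1 / (real n + 1)" and b="\<lambda>n. real n + 2"])
    show UN: "(\<Union>n. {1 / (real n + 1)..real n + 2}) = {0<..}" by (rule Union_intervals_positive)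
    show "(\<Union>n. {cosh (1 / (real n + 1))..cosh (real n + 2)}) = {1<..}"
    proof safe
      fix X :: real assume X: "1 < X"
      have ar: "arcosh X > 0" using arcosh_real_gt_1_iff[of X] X by (metis arcosh_real_strict_mono arcosh_1 order_refl)
      have "arcosh X \<in> (\<Union>n. {1 / (real n + 1)..real n + 2})" unfolding UN using ar by simp
      then obtain n where n: "1 / (real n + 1) \<le> arcosh X" "arcosh X \<le> real n + 2" by (auto simp only: UN_iff atLeastAtMost_iff)
      have "cosh (1 / (real n + 1)) \<le> cosh (arcosh X)" "cosh (arcosh X) \<le> cosh (real n + 2)"
        using n ar by (subst cosh_real_nonneg_le_iff; simp)+
      then show "X \<in> (\<Union>n. {cosh (1 / (real n + 1))..cosh (real n + 2)})" using X by (intro UN_I[of n]) auto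
    next
      fix X :: real and n assume "X \<in> {cosh (1 / (real n + 1))..cosh (real n + 2)}"
      moreover have "cosh (1 / (real n + 1)) > 1" using cosh_real_nonneg_less_iff[of 0 "1 / (real n + 1)"] by simp
      ultimately show "1 < X" by (simp only: atLeastAtMost_iff) linarith
    qed
    show "1 / (real n + 1) < real n + 2" for n
    proof -
      have "1 / (real n + 1) \<le> 1" by simp
      then show ?thesis by linarith
    qed
    show "(cosh has_real_derivative sinh x) (at x)" for x :: real
      by (auto intro!: derivative_eq_intros)
  qed (auto simp: incseq_def decseq_def frac_le intro!: continuous_intros)
  also have "\<dots> = (\<integral>\<^sup>+X. f X \<partial>lborel)"
    using Y by (intro nn_integral_cong) (auto simp: f_def split: split_indicator)
  also have "\<dots> = ennreal pi * indicator {Y<..} c"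
  proof (cases "Y < c")
    case True then show ?thesis using nn_integral_arcsine[of Y c] by (simp add: f_def)
  next
    case False
    then have "f X = 0" for X by (simp add: f_def)
    then show ?thesis using False by simp
  qed
  also have "ennreal (1 / (pi * sqrt 2)) * (ennreal pi * indicator {Y<..} c) = ennreal (1 / sqrt 2) * indicator {Y<..} c"
    unfolding mult.assoc[symmetric] by (subst ennreal_mult[symmetric]) auto
  finally show ?thesis .
qed

text \<open>A rotation-invariant distribution, given by the measure of its radii, is determined by its heights: the tail
  profiles recover all tails \<open>{Y<..}\<close> with \<open>Y \<ge> 1\<close>, and the constant function recovers the total mass.\<close>

lemma radius_measure_eqI:
  fixes N N' :: "real measure"
  assumes sets: "sets N = sets borel" "sets N' = sets borel"
    and ge1: "AE c in N. c \<ge> 1" "AE c in N'. c \<ge> 1"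
    and fin: "emeasure N UNIV < \<infinity>"
    and eq: "\<And>h. h \<in> borel_measurable borel \<Longrightarrow>
      (\<integral>\<^sup>+c. circle_mean c (\<lambda>w. h (ln (Im w))) \<i> \<partial>N) = (\<integral>\<^sup>+c. circle_mean c (\<lambda>w. h (ln (Im w))) \<i> \<partial>N')"
  shows "N = N'"
proof -
  note [measurable_cong] = sets
  have space: "space N = UNIV" "space N' = UNIV"
    using sets_eq_imp_space_eq[OF sets(1)] sets_eq_imp_space_eq[OF sets(2)] by simp_all
  have UN: "emeasure N UNIV = emeasure N' UNIV"
    using eq[of "\<lambda>_. 1"] by (simp add: circle_mean_one space)
  show ?thesis
  proof (rule measure_eqI_lessThan)
    show "emeasure N {Y<..} < \<infinity>" for Y
      using emeasure_space[of N "{Y<..}"] fin by (simp add: space less_top[symmetric]) (metis top.extremum_unique)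
    show "emeasure N {Y<..} = emeasure N' {Y<..}" for Y
    proof (cases "Y \<ge> 1")
      case True
      have [measurable]: "tail_profile Y \<in> borel_measurable borel"
        unfolding tail_profile_def[abs_def] cosh_def sinh_def by measurable
      have *: "ennreal (1 / sqrt 2) * emeasure M {Y<..} = (\<integral>\<^sup>+c. circle_mean c (\<lambda>w. tail_profile Y (ln (Im w))) \<i> \<partial>M)"
        if [measurable_cong]: "sets M = sets borel" and ge1: "AE c in M. c \<ge> 1" for M
      proof -
        have "(\<integral>\<^sup>+c. circle_mean c (\<lambda>w. tail_profile Y (ln (Im w))) \<i> \<partial>M) = (\<integral>\<^sup>+c. ennreal (1 / sqrt 2) * indicator {Y<..} c \<partial>M)"
          by (rule nn_integral_cong_AE, use ge1 in eventually_elim) (simp add: circle_mean_tail_profile True)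
        also have "\<dots> = ennreal (1 / sqrt 2) * emeasure M {Y<..}"
          by (subst nn_integral_cmult_indicator) (auto simp: that)
        finally show ?thesis by simp
      qed
      have "ennreal (1 / sqrt 2) * emeasure N {Y<..} = ennreal (1 / sqrt 2) * emeasure N' {Y<..}"
        unfolding *[OF sets(1) ge1(1)] *[OF sets(2) ge1(2)] by (rule eq) measurable
      then show ?thesis by (subst (asm) ennreal_mult_cancel_left) auto
    next
      case False
      have *: "emeasure M {Y<..} = emeasure M UNIV" if [measurable_cong]: "sets M = sets borel" and ge1: "AE c in M. c \<ge> 1" for M
        by (rule emeasure_eq_AE, use ge1 in eventually_elim) (use False in \<open>auto simp: that\<close>)
      show ?thesis unfolding *[OF sets(1) ge1(1)] *[OF sets(2) ge1(2)] by (rule UN)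
    qed
  qed (use sets in auto)
qed

lemma emeasure_lborel_Ioo': "emeasure lborel {a<..<b} = ennreal (b - a)"
  by (cases "a \<le> b") (auto simp: ennreal_neg)

lemma measurable_abs_less_pairs [measurable]:
  "{p::real \<times> real. \<bar>snd p\<bar> < fst p} \<in> sets (borel \<Otimes>\<^sub>M borel)"
proof -
  have "{p \<in> space (borel \<Otimes>\<^sub>M borel). \<bar>snd p :: real\<bar> < fst p} \<in> sets (borel \<Otimes>\<^sub>M borel)" by measurable
  then show ?thesis by (simp add: space_pair_measure)
qed

text \<open>Both sides integrate \<open>k w\<close> against the length of an interval that depends on \<open>w\<close>: the overlap of
  \<open>(-t, t)\<close> with \<open>(w - t', w + t')\<close> on the left, and the part of \<open>(\<bar>t - t'\<bar>, t + t')\<close> to the right of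
  \<open>\<bar>w\<bar>\<close> on the right.\<close>

lemma nn_integral_two_windows:
  fixes k :: "real \<Rightarrow> ennreal"
  assumes t: "t \<ge> 0" "t' \<ge> 0" and [measurable]: "k \<in> borel_measurable borel"
  shows "(\<integral>\<^sup>+u. indicator {-t<..<t} u * (\<integral>\<^sup>+u'. indicator {-t'<..<t'} u' * k (u + u') \<partial>lborel) \<partial>lborel)
    = (\<integral>\<^sup>+v. indicator {\<bar>t - t'\<bar><..<t + t'} v * (\<integral>\<^sup>+w. indicator {-v<..<v} w * k w \<partial>lborel) \<partial>lborel)"
proof -
  have ind: "indicator {-v<..<v} w = (indicator {p::real \<times> real. \<bar>snd p\<bar> < fst p} (v, w) :: ennreal)" for v w
    by (auto split: split_indicator)
  have "(\<integral>\<^sup>+u. indicator {-t<..<t} u * (\<integral>\<^sup>+u'. indicator {-t'<..<t'} u' * k (u + u') \<partial>lborel) \<partial>lborel)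
      = (\<integral>\<^sup>+u. \<integral>\<^sup>+w. indicator {-t<..<t} u * indicator {-t'<..<t'} (w - u) * k w \<partial>lborel \<partial>lborel)"
  proof (rule nn_integral_cong)
    fix u
    have "(\<integral>\<^sup>+u'. indicator {-t'<..<t'} u' * k (u + u') \<partial>lborel)
        = (\<integral>\<^sup>+w. indicator {-t'<..<t'} (w + - u) * k (u + (w + - u)) \<partial>lborel)"
      by (rule nn_integral_real_shift[symmetric]) measurable
    then show "indicator {-t<..<t} u * (\<integral>\<^sup>+u'. indicator {-t'<..<t'} u' * k (u + u') \<partial>lborel)
        = (\<integral>\<^sup>+w. indicator {-t<..<t} u * indicator {-t'<..<t'} (w - u) * k w \<partial>lborel)"
      by (simp add: mult.assoc nn_integral_cmult)
  qed
  also have "\<dots> = (\<integral>\<^sup>+w. \<integral>\<^sup>+u. indicator {-t<..<t} u * indicator {-t'<..<t'} (w - u) * k w \<partial>lborel \<partial>lborel)"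
    by (rule lborel_pair.Fubini') measurable
  also have "\<dots> = (\<integral>\<^sup>+w. emeasure lborel {max (-t) (w - t')<..<min t (w + t')} * k w \<partial>lborel)"
  proof (rule nn_integral_cong)
    fix w
    have "(\<integral>\<^sup>+u. indicator {-t<..<t} u * indicator {-t'<..<t'} (w - u) * k w \<partial>lborel)
        = (\<integral>\<^sup>+u. indicator {max (-t) (w - t')<..<min t (w + t')} u * k w \<partial>lborel)"
      by (intro nn_integral_cong) (auto split: split_indicator)
    then show "(\<integral>\<^sup>+u. indicator {-t<..<t} u * indicator {-t'<..<t'} (w - u) * k w \<partial>lborel)
        = emeasure lborel {max (-t) (w - t')<..<min t (w + t')} * k w"
      by (simp add: nn_integral_multc)
  qed
  also have "\<dots> = (\<integral>\<^sup>+w. emeasure lborel {max \<bar>t - t'\<bar> \<bar>w\<bar><..<t + t'} * k w \<partial>lborel)"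
  proof (intro nn_integral_cong arg_cong2[where f="(*)"] refl)
    fix w
    have "max 0 (min t (w + t') - max (-t) (w - t')) = max 0 (t + t' - max \<bar>t - t'\<bar> \<bar>w\<bar>)"
      using t by (auto simp: min_def max_def abs_if)
    then have "ennreal (min t (w + t') - max (-t) (w - t')) = ennreal (t + t' - max \<bar>t - t'\<bar> \<bar>w\<bar>)"
      by (metis ennreal_max_0 max.commute)
    then show "emeasure lborel {max (-t) (w - t')<..<min t (w + t')} = emeasure lborel {max \<bar>t - t'\<bar> \<bar>w\<bar><..<t + t'}"
      by (simp only: emeasure_lborel_Ioo')
  qed
  also have "\<dots> = (\<integral>\<^sup>+w. \<integral>\<^sup>+v. indicator {\<bar>t - t'\<bar><..<t + t'} v * (indicator {-v<..<v} w * k w) \<partial>lborel \<partial>lborel)"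
  proof (rule nn_integral_cong)
    fix w
    have "(\<integral>\<^sup>+v. indicator {\<bar>t - t'\<bar><..<t + t'} v * (indicator {-v<..<v} w * k w) \<partial>lborel)
        = (\<integral>\<^sup>+v. indicator {max \<bar>t - t'\<bar> \<bar>w\<bar><..<t + t'} v * k w \<partial>lborel)"
      by (intro nn_integral_cong) (auto split: split_indicator)
    then show "emeasure lborel {max \<bar>t - t'\<bar> \<bar>w\<bar><..<t + t'} * k w
        = (\<integral>\<^sup>+v. indicator {\<bar>t - t'\<bar><..<t + t'} v * (indicator {-v<..<v} w * k w) \<partial>lborel)"
      by (simp add: nn_integral_multc)
  qed
  also have "\<dots> = (\<integral>\<^sup>+v. \<integral>\<^sup>+w. indicator {\<bar>t - t'\<bar><..<t + t'} v * (indicator {-v<..<v} w * k w) \<partial>lborel \<partial>lborel)"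
    unfolding ind by (rule lborel_pair.Fubini') measurable
  also have "\<dots> = (\<integral>\<^sup>+v. indicator {\<bar>t - t'\<bar><..<t + t'} v * (\<integral>\<^sup>+w. indicator {-v<..<v} w * k w \<partial>lborel) \<partial>lborel)"
    by (intro nn_integral_cong nn_integral_cmult) measurable
  finally show ?thesis .
qed

definition abel_mean_window :: "real \<Rightarrow> real \<Rightarrow> (complex \<Rightarrow> ennreal) \<Rightarrow> complex \<Rightarrow> ennreal" where
  "abel_mean_window a b u z = ennreal (1/2) * (\<integral>\<^sup>+v. indicator {a<..<b} v * abel_mean (cosh v) u z \<partial>lborel)"

text \<open>Logarithmic heights add under composition. After the factors \<open>exp (- u/2)\<close> are absorbed into the function, two
  independent heights that are uniform on \<open>(-t, t)\<close> and \<open>(-t', t')\<close> are added.\<close>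

lemma abel_mean_product_height_function:
  assumes t: "t \<ge> 0" "t' \<ge> 0" and [measurable]: "h \<in> borel_measurable borel"
  shows "abel_mean (cosh t) (abel_mean (cosh t') (\<lambda>w. h (ln (Im w)))) \<i>
    = abel_mean_window \<bar>t - t'\<bar> (t + t') (\<lambda>w. h (ln (Im w))) \<i>"
proof -
  define k where "k u = ennreal (exp (- u/2)) * h u" for u
  have [measurable]: "k \<in> borel_measurable borel" unfolding k_def[abs_def] by measurable
  define H where "H x = ennreal (1/2) * (\<integral>\<^sup>+u. indicator {-t'<..<t'} u * (ennreal (exp (- u/2)) * h (x + u)) \<partial>lborel)" for x
  have [measurable]: "H \<in> borel_measurable borel" unfolding H_def[abs_def] by measurable
  have "abel_mean (cosh t) (abel_mean (cosh t') (\<lambda>w. h (ln (Im w)))) \<i> = abel_mean (cosh t) (\<lambda>w. H (ln (Im w))) \<i>"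
    by (rule abel_mean_cong) (auto simp: H_def abel_mean_height_function t)
  also have "\<dots> = ennreal (1/2) * (\<integral>\<^sup>+u. indicator {-t<..<t} u * (ennreal (exp (- u/2)) * H u) \<partial>lborel)"
    by (subst abel_mean_height_function) (auto simp: t)
  also have "(\<integral>\<^sup>+u. indicator {-t<..<t} u * (ennreal (exp (- u/2)) * H u) \<partial>lborel)
      = (\<integral>\<^sup>+u. ennreal (1/2) * (indicator {-t<..<t} u * (\<integral>\<^sup>+u'. indicator {-t'<..<t'} u' * k (u + u') \<partial>lborel)) \<partial>lborel)"
  proof (rule nn_integral_cong)
    fix u
    have "ennreal (exp (- u/2)) * (\<integral>\<^sup>+u'. indicator {-t'<..<t'} u' * (ennreal (exp (- u'/2)) * h (u + u')) \<partial>lborel)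
        = (\<integral>\<^sup>+u'. ennreal (exp (- u/2)) * (indicator {-t'<..<t'} u' * (ennreal (exp (- u'/2)) * h (u + u'))) \<partial>lborel)"
      by (rule nn_integral_cmult[symmetric]) measurable
    also have "\<dots> = (\<integral>\<^sup>+u'. indicator {-t'<..<t'} u' * k (u + u') \<partial>lborel)"
    proof (rule nn_integral_cong)
      fix u'
      have "ennreal (exp (- u/2)) * ennreal (exp (- u'/2)) = ennreal (exp (- (u + u')/2))"
        by (subst ennreal_mult[symmetric]) (auto simp: field_simps simp flip: exp_add)
      then show "ennreal (exp (- u/2)) * (indicator {-t'<..<t'} u' * (ennreal (exp (- u'/2)) * h (u + u')))
          = indicator {-t'<..<t'} u' * k (u + u')"
        unfolding k_def by (simp split: split_indicator add: mult.assoc[symmetric])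
    qed
    finally have e: "ennreal (exp (- u/2)) * (\<integral>\<^sup>+u'. indicator {-t'<..<t'} u' * (ennreal (exp (- u'/2)) * h (u + u')) \<partial>lborel)
        = (\<integral>\<^sup>+u'. indicator {-t'<..<t'} u' * k (u + u') \<partial>lborel)" .
    show "indicator {-t<..<t} u * (ennreal (exp (- u/2)) * H u)
        = ennreal (1/2) * (indicator {-t<..<t} u * (\<integral>\<^sup>+u'. indicator {-t'<..<t'} u' * k (u + u') \<partial>lborel))"
      unfolding H_def e[symmetric] by (simp only: mult.left_commute)
  qed
  also have "\<dots> = ennreal (1/2) * (\<integral>\<^sup>+u. indicator {-t<..<t} u * (\<integral>\<^sup>+u'. indicator {-t'<..<t'} u' * k (u + u') \<partial>lborel) \<partial>lborel)"
    by (rule nn_integral_cmult) measurable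
  also have "\<dots> = ennreal (1/2) * (\<integral>\<^sup>+v. indicator {\<bar>t - t'\<bar><..<t + t'} v * (\<integral>\<^sup>+w. indicator {-v<..<v} w * k w \<partial>lborel) \<partial>lborel)"
    by (subst nn_integral_two_windows) (auto simp: t)
  also have "\<dots> = (\<integral>\<^sup>+v. ennreal (1/2) * (indicator {\<bar>t - t'\<bar><..<t + t'} v * (\<integral>\<^sup>+w. indicator {-v<..<v} w * k w \<partial>lborel)) \<partial>lborel)"
  proof (rule nn_integral_cmult[symmetric])
    have ind: "indicator {-v<..<v} w = (indicator {p::real \<times> real. \<bar>snd p\<bar> < fst p} (v, w) :: ennreal)" for v w
      by (auto split: split_indicator)
    show "(\<lambda>v. indicator {\<bar>t - t'\<bar><..<t + t'} v * (\<integral>\<^sup>+w. indicator {-v<..<v} w * k w \<partial>lborel)) \<in> borel_measurable lborel"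
      unfolding ind by measurable
  qed
  also have "\<dots> = (\<integral>\<^sup>+v. indicator {\<bar>t - t'\<bar><..<t + t'} v * abel_mean (cosh v) (\<lambda>w. h (ln (Im w))) \<i> \<partial>lborel)"
  proof (rule nn_integral_cong)
    fix v
    have "v \<ge> 0" if "v \<in> {\<bar>t - t'\<bar><..<t + t'}" using that by auto
    then show "ennreal (1/2) * (indicator {\<bar>t - t'\<bar><..<t + t'} v * (\<integral>\<^sup>+w. indicator {-v<..<v} w * k w \<partial>lborel))
        = indicator {\<bar>t - t'\<bar><..<t + t'} v * abel_mean (cosh v) (\<lambda>w. h (ln (Im w))) \<i>"
      by (cases "v \<in> {\<bar>t - t'\<bar><..<t + t'}") (simp_all add: abel_mean_height_function k_def)
  qed
  finally show ?thesis unfolding abel_mean_window_def .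
qed

text \<open>The measure on radii through which the composition of two Abel averages acts, see \<open>abel_mean_abel_mean\<close>.\<close>

definition product_radii :: "real \<Rightarrow> real \<Rightarrow> real measure" where
  "product_radii T T' = distr
     (density (lborel \<Otimes>\<^sub>M (lborel \<Otimes>\<^sub>M angle_measure))
       (\<lambda>(X, Y, t). ennreal (abel_weight T X) * ennreal (abel_weight T' Y)))
     borel (\<lambda>(X, Y, t). composed_radius X Y t)"

lemma nn_integral_product_radii:
  assumes [measurable]: "F \<in> borel_measurable borel"
  shows "(\<integral>\<^sup>+c. F c \<partial>product_radii T T') = (\<integral>\<^sup>+X. ennreal (abel_weight T X) *
    (\<integral>\<^sup>+Y. ennreal (abel_weight T' Y) * (\<integral>\<^sup>+t. F (composed_radius X Y t) \<partial>angle_measure) \<partial>lborel) \<partial>lborel)"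
proof -
  interpret A: pair_sigma_finite lborel angle_measure ..
  have "(\<integral>\<^sup>+c. F c \<partial>product_radii T T')
      = (\<integral>\<^sup>+p. (case p of (X, Y, t) \<Rightarrow> ennreal (abel_weight T X) * ennreal (abel_weight T' Y) * F (composed_radius X Y t))
          \<partial>(lborel \<Otimes>\<^sub>M (lborel \<Otimes>\<^sub>M angle_measure)))"
    unfolding product_radii_def
    by (subst nn_integral_distr, simp add: split_beta', measurable, subst nn_integral_density)
       (auto simp: split_beta')
  also have "\<dots> = (\<integral>\<^sup>+X. \<integral>\<^sup>+q. (case q of (Y, t) \<Rightarrow> ennreal (abel_weight T X) * ennreal (abel_weight T' Y) * F (composed_radius X Y t))
          \<partial>(lborel \<Otimes>\<^sub>M angle_measure) \<partial>lborel)"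
    by (subst A.P.nn_integral_fst[symmetric]) (auto simp: split_beta')
  also have "\<dots> = (\<integral>\<^sup>+X. \<integral>\<^sup>+Y. \<integral>\<^sup>+t. ennreal (abel_weight T X) * ennreal (abel_weight T' Y) * F (composed_radius X Y t)
          \<partial>angle_measure \<partial>lborel \<partial>lborel)"
    by (subst angle.nn_integral_fst[symmetric]) (auto simp: split_beta')
  also have "\<dots> = (\<integral>\<^sup>+X. ennreal (abel_weight T X) *
    (\<integral>\<^sup>+Y. ennreal (abel_weight T' Y) * (\<integral>\<^sup>+t. F (composed_radius X Y t) \<partial>angle_measure) \<partial>lborel) \<partial>lborel)"
  proof (rule nn_integral_cong)
    fix X
    have [measurable]: "(\<lambda>Y. \<integral>\<^sup>+t. F (composed_radius X Y t) \<partial>angle_measure) \<in> borel_measurable borel"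
      by (rule angle.borel_measurable_nn_integral) measurable
    have "(\<integral>\<^sup>+t. ennreal (abel_weight T X) * ennreal (abel_weight T' Y) * F (composed_radius X Y t) \<partial>angle_measure)
        = ennreal (abel_weight T X) * (ennreal (abel_weight T' Y) * (\<integral>\<^sup>+t. F (composed_radius X Y t) \<partial>angle_measure))" for Y
      unfolding mult.assoc[symmetric] by (rule nn_integral_cmult) measurable
    then show "(\<integral>\<^sup>+Y. \<integral>\<^sup>+t. ennreal (abel_weight T X) * ennreal (abel_weight T' Y) * F (composed_radius X Y t)
          \<partial>angle_measure \<partial>lborel)
        = ennreal (abel_weight T X) * (\<integral>\<^sup>+Y. ennreal (abel_weight T' Y) * (\<integral>\<^sup>+t. F (composed_radius X Y t) \<partial>angle_measure) \<partial>lborel)"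
      by (simp add: nn_integral_cmult)
  qed
  finally show ?thesis .
qed

lemma abel_mean_abel_mean:
  assumes z: "Im z > 0" and [measurable]: "u \<in> borel_measurable borel"
  shows "abel_mean T (abel_mean T' u) z = (\<integral>\<^sup>+c. circle_mean c u z \<partial>product_radii T T')"
proof -
  interpret A: pair_sigma_finite angle_measure lborel ..
  have "circle_mean X (abel_mean T' u) z
      = (\<integral>\<^sup>+Y. ennreal (abel_weight T' Y) * (\<integral>\<^sup>+t. circle_mean (composed_radius X Y t) u z \<partial>angle_measure) \<partial>lborel)"
    if X: "X > 1" for X
  proof -
    have "circle_mean X (abel_mean T' u) z
        = (\<integral>\<^sup>+Y. \<integral>\<^sup>+t. ennreal (abel_weight T' Y) * circle_mean Y u (affine_move z (circle_point X t)) \<partial>angle_measure \<partial>lborel)"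
      unfolding circle_mean_def[of X] abel_mean_def by (rule A.Fubini'[symmetric]) measurable
    also have "\<dots> = (\<integral>\<^sup>+Y. ennreal (abel_weight T' Y) * circle_mean X (circle_mean Y u) z \<partial>lborel)"
      unfolding circle_mean_def[of X] by (intro nn_integral_cong nn_integral_cmult) measurable
    also have "\<dots> = (\<integral>\<^sup>+Y. ennreal (abel_weight T' Y) * (\<integral>\<^sup>+t. circle_mean (composed_radius X Y t) u z \<partial>angle_measure) \<partial>lborel)"
    proof (rule nn_integral_cong)
      fix Y
      show "ennreal (abel_weight T' Y) * circle_mean X (circle_mean Y u) z
        = ennreal (abel_weight T' Y) * (\<integral>\<^sup>+t. circle_mean (composed_radius X Y t) u z \<partial>angle_measure)"
        using X z by (cases "Y > 1") (simp_all add: circle_mean_circle_mean, simp add: abel_weight_def)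
    qed
    finally show ?thesis .
  qed
  then have "ennreal (abel_weight T X) * circle_mean X (abel_mean T' u) z
      = ennreal (abel_weight T X) * (\<integral>\<^sup>+Y. ennreal (abel_weight T' Y) * (\<integral>\<^sup>+t. circle_mean (composed_radius X Y t) u z \<partial>angle_measure) \<partial>lborel)" for X
    by (cases "X > 1") (auto simp: abel_weight_def)
  then show ?thesis
    unfolding abel_mean_def[of T] by (subst nn_integral_product_radii) auto
qed

text \<open>The measure on radii through which \<open>abel_mean_window\<close> acts, see \<open>abel_mean_window_eq\<close>.\<close>

definition window_radii :: "real \<Rightarrow> real \<Rightarrow> real measure" where
  "window_radii a b = distr
     (density (lborel \<Otimes>\<^sub>M lborel) (\<lambda>(v, X). ennreal (1/2) * (indicator {a<..<b} v * ennreal (abel_weight (cosh v) X))))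
     borel snd"

lemma borel_measurable_cosh [measurable]: "(cosh :: real \<Rightarrow> real) \<in> borel_measurable borel"
  unfolding cosh_def[abs_def] by measurable

lemma nn_integral_window_radii:
  assumes [measurable]: "F \<in> borel_measurable borel"
  shows "(\<integral>\<^sup>+c. F c \<partial>window_radii a b) = ennreal (1/2) * (\<integral>\<^sup>+v. indicator {a<..<b} v *
     (\<integral>\<^sup>+X. ennreal (abel_weight (cosh v) X) * F X \<partial>lborel) \<partial>lborel)"
proof -
  have "(\<integral>\<^sup>+c. F c \<partial>window_radii a b)
      = (\<integral>\<^sup>+p. ennreal (1/2) * (indicator {a<..<b} (fst p) * ennreal (abel_weight (cosh (fst p)) (snd p))) * F (snd p) \<partial>(lborel \<Otimes>\<^sub>M lborel))"
    unfolding window_radii_def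
    by (subst nn_integral_distr, simp add: split_beta', measurable, subst nn_integral_density)
       (auto simp: split_beta')
  also have "\<dots> = (\<integral>\<^sup>+v. \<integral>\<^sup>+X. ennreal (1/2) * (indicator {a<..<b} v * (ennreal (abel_weight (cosh v) X) * F X)) \<partial>lborel \<partial>lborel)"
    by (subst lborel.nn_integral_fst[symmetric]) (auto simp: mult.assoc)
  also have "\<dots> = (\<integral>\<^sup>+v. ennreal (1/2) * (indicator {a<..<b} v * (\<integral>\<^sup>+X. ennreal (abel_weight (cosh v) X) * F X \<partial>lborel)) \<partial>lborel)"
    by (simp add: nn_integral_cmult)
  also have "\<dots> = ennreal (1/2) * (\<integral>\<^sup>+v. indicator {a<..<b} v * (\<integral>\<^sup>+X. ennreal (abel_weight (cosh v) X) * F X \<partial>lborel) \<partial>lborel)"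
    by (rule nn_integral_cmult) measurable
  finally show ?thesis .
qed

lemma abel_mean_window_eq:
  assumes [measurable]: "u \<in> borel_measurable borel"
  shows "abel_mean_window a b u z = (\<integral>\<^sup>+c. circle_mean c u z \<partial>window_radii a b)"
  unfolding abel_mean_window_def abel_mean_def by (subst nn_integral_window_radii) auto

lemma abel_mass_finite: "abel_mass T < \<infinity>"
proof (cases "T \<ge> 1")
  case True
  define t where "t = arcosh T"
  have t: "t \<ge> 0" "T = cosh t" using True by (simp_all add: t_def)
  have "abel_mass T = abel_mean T (\<lambda>_. 1) \<i>"
    by (simp add: abel_mean_const)
  also have "\<dots> = ennreal (1/2) * (\<integral>\<^sup>+u. indicator {-t<..<t} u * ennreal (exp (- u/2)) \<partial>lborel)"
    using abel_mean_height_function[of t \<i> "\<lambda>_. 1"] t by simp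
  also have "\<dots> \<le> ennreal (1/2) * (\<integral>\<^sup>+u. ennreal (exp (t/2)) * indicator {-t<..<t} u \<partial>lborel)"
    by (intro mult_left_mono nn_integral_mono) (auto split: split_indicator simp: ennreal_leI)
  also have "\<dots> = ennreal (1/2) * (ennreal (exp (t/2)) * ennreal (t - - t))"
    by (subst nn_integral_cmult_indicator) (auto simp: emeasure_lborel_Ioo' simp del: emeasure_lborel_Ioo)
  also have "\<dots> < \<infinity>" by (simp add: ennreal_mult_less_top less_top[symmetric] ennreal_mult_eq_top_iff)
  finally show ?thesis .
next
  case False
  then have "abel_weight T X = 0" for X by (simp add: abel_weight_def)
  then show ?thesis by (simp add: abel_mass_def)
qed

text \<open>By \<open>radius_measure_eqI\<close> it suffices to compare the averages of functions of the height, which is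
  \<open>abel_mean_product_height_function\<close>.\<close>

lemma product_radii_eq_window_radii:
  assumes t: "t \<ge> 0" "t' \<ge> 0"
  shows "product_radii (cosh t) (cosh t') = window_radii \<bar>t - t'\<bar> (t + t')"
proof (rule radius_measure_eqI)
  show sets: "sets (product_radii (cosh t) (cosh t')) = sets borel" "sets (window_radii \<bar>t - t'\<bar> (t + t')) = sets borel"
    by (simp_all add: product_radii_def window_radii_def)
  have AE: "AE c in N. c \<ge> 1" if [measurable_cong]: "sets N = sets borel" and z: "(\<integral>\<^sup>+c. indicator {..<1} c \<partial>N) = 0" for N :: "real measure"
  proof -
    have "emeasure N {..<1} = 0" using z by (subst (asm) nn_integral_indicator) (auto simp: that(1))
    then show ?thesis by (intro AE_I[where N="{..<1}"]) (auto simp: that)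
  qed
  show "AE c in product_radii (cosh t) (cosh t'). c \<ge> 1"
  proof (rule AE[OF sets(1)])
    have zero: "ennreal (abel_weight T X) * (\<integral>\<^sup>+Y. ennreal (abel_weight T' Y) * (\<integral>\<^sup>+t. indicator {..<1} (composed_radius X Y t) \<partial>angle_measure) \<partial>lborel) = 0" for T T' X
    proof (cases "X > 1")
      case True
      have "ennreal (abel_weight T' Y) * (\<integral>\<^sup>+t. indicator {..<1} (composed_radius X Y t) \<partial>angle_measure) = 0" for Y
      proof (cases "Y > 1")
        case True
        have "indicator {..<1} (composed_radius X Y t) = (0::ennreal)" for t
          using composed_radius_ge_1[of X Y t] True \<open>X > 1\<close> by simp
        then show ?thesis by simp
      qed (simp add: abel_weight_def)
      then show ?thesis by (simp only: nn_integral_const mult_zero_left mult_zero_right)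
    qed (simp add: abel_weight_def)
    have "(\<integral>\<^sup>+c. indicator {..<1} c \<partial>product_radii (cosh t) (cosh t')) = (\<integral>\<^sup>+X. 0 \<partial>(lborel::real measure))"
      by (subst nn_integral_product_radii) (measurable, simp only: zero)
    then show "(\<integral>\<^sup>+c. indicator {..<1} c \<partial>product_radii (cosh t) (cosh t')) = 0" by simp
  qed
  show "AE c in window_radii \<bar>t - t'\<bar> (t + t'). c \<ge> 1"
  proof (rule AE[OF sets(2)])
    have zero: "ennreal (abel_weight T X) * indicator {..<1} X = 0" for T X :: real
      by (simp add: abel_weight_def split: split_indicator)
    have "(\<integral>\<^sup>+c. indicator {..<1} c \<partial>window_radii \<bar>t - t'\<bar> (t + t'))
        = ennreal (1/2) * (\<integral>\<^sup>+v. indicator {\<bar>t - t'\<bar><..<t + t'} v * (\<integral>\<^sup>+X. 0 \<partial>(lborel::real measure)) \<partial>lborel)"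
      by (subst nn_integral_window_radii) (measurable, simp only: zero)
    then show "(\<integral>\<^sup>+c. indicator {..<1} c \<partial>window_radii \<bar>t - t'\<bar> (t + t')) = 0" by simp
  qed
  show "emeasure (product_radii (cosh t) (cosh t')) UNIV < \<infinity>"
  proof -
    have "emeasure (product_radii (cosh t) (cosh t')) UNIV = (\<integral>\<^sup>+c. 1 \<partial>product_radii (cosh t) (cosh t'))"
      using sets_eq_imp_space_eq[OF sets(1)] by simp
    also have "\<dots> = abel_mean (cosh t) (abel_mean (cosh t') (\<lambda>_. 1)) \<i>"
      by (simp add: abel_mean_abel_mean circle_mean_one)
    also have "\<dots> < \<infinity>" using abel_mass_finite by (simp add: abel_mean_const ennreal_mult_less_top)
    finally show ?thesis .
  qed
  fix h :: "real \<Rightarrow> ennreal" assume [measurable]: "h \<in> borel_measurable borel"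
  show "(\<integral>\<^sup>+c. circle_mean c (\<lambda>w. h (ln (Im w))) \<i> \<partial>product_radii (cosh t) (cosh t'))
    = (\<integral>\<^sup>+c. circle_mean c (\<lambda>w. h (ln (Im w))) \<i> \<partial>window_radii \<bar>t - t'\<bar> (t + t'))"
    using abel_mean_product_height_function[OF t, of h]
    by (simp add: abel_mean_abel_mean abel_mean_window_eq)
qed

text \<open>The operator form of \<open>sin (t x) sin (t' x) / x\<^sup>2 = 1/2 \<integral> sin (v x) / x dv\<close>, integrated over
  \<open>\<bar>t - t'\<bar> < v < t + t'\<close>.\<close>

theorem abel_mean_product:
  assumes "t \<ge> 0" "t' \<ge> 0" "Im z > 0" and [measurable]: "u \<in> borel_measurable borel"
  shows "abel_mean (cosh t) (abel_mean (cosh t') u) z = abel_mean_window \<bar>t - t'\<bar> (t + t') u z"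
  using assms by (simp add: abel_mean_abel_mean abel_mean_window_eq product_radii_eq_window_radii)

section \<open>Discrete groups and their fundamental regions\<close>

lemma one_PSL2R: "\<one>\<^bsub>PSL2R\<^esub> = psl (mat 1)"
  by (simp add: PSL2R_def FactGroup_def psl_eq)

lemma group_PSL2R: "group PSL2R"
proof (rule groupI)
  show "x \<otimes>\<^bsub>PSL2R\<^esub> y \<in> carrier PSL2R" if "x \<in> carrier PSL2R" "y \<in> carrier PSL2R" for x y
    using that by (auto simp: carrier_PSL2R psl_mult det_mul intro!: imageI)
  show "\<one>\<^bsub>PSL2R\<^esub> \<in> carrier PSL2R" by (auto simp: one_PSL2R carrier_PSL2R)
  show "x \<otimes>\<^bsub>PSL2R\<^esub> y \<otimes>\<^bsub>PSL2R\<^esub> z = x \<otimes>\<^bsub>PSL2R\<^esub> (y \<otimes>\<^bsub>PSL2R\<^esub> z)"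
    if "x \<in> carrier PSL2R" "y \<in> carrier PSL2R" "z \<in> carrier PSL2R" for x y z
    using that by (auto simp: carrier_PSL2R psl_mult det_mul matrix_mul_assoc)
  show "\<one>\<^bsub>PSL2R\<^esub> \<otimes>\<^bsub>PSL2R\<^esub> x = x" if "x \<in> carrier PSL2R" for x
    using that by (auto simp: carrier_PSL2R one_PSL2R psl_mult)
  show "\<exists>y\<in>carrier PSL2R. y \<otimes>\<^bsub>PSL2R\<^esub> x = \<one>\<^bsub>PSL2R\<^esub>" if x: "x \<in> carrier PSL2R" for x
  proof -
    obtain A where A: "det A = 1" "x = psl A" using x by (auto simp: carrier_PSL2R)
    then obtain B where B: "A ** B = mat 1" "B ** A = mat 1"
      by (metis invertible_det_nz invertible_def zero_neq_one)
    have "det B = 1" using arg_cong[OF B(2), of det] A by (simp add: det_mul)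
    then show ?thesis using A B by (intro bexI[of _ "psl B"]) (auto simp: psl_mult one_PSL2R carrier_PSL2R)
  qed
qed

lemma carrier_PSL2R_cases:
  assumes "g \<in> carrier PSL2R"
  obtains A where "det A = 1" "g = psl A"
  using assms unfolding carrier_PSL2R by blast

lemma psl_act_eq_moebius_map: "psl_act (psl A) = moebius_map A"
  by (rule ext) (rule psl_act_psl)

lemma psl_act_in_upper: "g \<in> carrier PSL2R \<Longrightarrow> Im z > 0 \<Longrightarrow> Im (psl_act g z) > 0"
  by (erule carrier_PSL2R_cases) (simp add: psl_act_eq_moebius_map Im_moebius_map_pos)

lemma psl_act_mult:
  "g \<in> carrier PSL2R \<Longrightarrow> h \<in> carrier PSL2R \<Longrightarrow> Im z > 0 \<Longrightarrow>
    psl_act (g \<otimes>\<^bsub>PSL2R\<^esub> h) z = psl_act g (psl_act h z)"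
  by (elim carrier_PSL2R_cases) (simp add: psl_act_eq_moebius_map psl_mult moebius_map_compose)

lemma psl_act_one: "psl_act \<one>\<^bsub>PSL2R\<^esub> z = z"
  by (simp add: one_PSL2R psl_act_psl moebius_map_def mat_def)

lemma measurable_psl_act: "g \<in> carrier PSL2R \<Longrightarrow> psl_act g \<in> borel_measurable borel"
  by (erule carrier_PSL2R_cases) (simp only: psl_act_eq_moebius_map measurable_moebius_map)

lemma hyp_area_psl_act_invariant:
  "g \<in> carrier PSL2R \<Longrightarrow> u \<in> borel_measurable borel \<Longrightarrow>
    (\<integral>\<^sup>+w. u (psl_act g w) \<partial>hyp_area) = (\<integral>\<^sup>+w. u w \<partial>hyp_area)"
  by (erule carrier_PSL2R_cases) (simp only: psl_act_eq_moebius_map hyp_area_moebius_invariant)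

lemma circle_mean_psl_act:
  "g \<in> carrier PSL2R \<Longrightarrow> Im z > 0 \<Longrightarrow> X \<ge> 1 \<Longrightarrow> u \<in> borel_measurable borel \<Longrightarrow>
    circle_mean X (\<lambda>w. u (psl_act g w)) z = circle_mean X u (psl_act g z)"
  by (erule carrier_PSL2R_cases) (simp only: psl_act_eq_moebius_map circle_mean_moebius)

lemma continuous_on_psl_act: "g \<in> carrier PSL2R \<Longrightarrow> continuous_on upper_half_plane (psl_act g)"
proof (erule carrier_PSL2R_cases)
  fix A :: "real^2^2" assume A: "det A = 1" "g = psl A"
  show "continuous_on upper_half_plane (psl_act g)"
    unfolding A(2) psl_act_eq_moebius_map moebius_map_def[abs_def]
    by (intro continuous_intros ballI moebius_denominator_nonzero[OF A(1)]) (simp add: upper_half_plane_def)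
qed

text \<open>The circle mean preserves the integral over the half-plane, by symmetry against the constant function \<open>1\<close>.\<close>

lemma circle_mean_null_set:
  assumes [measurable]: "N \<in> sets borel" and N: "(\<integral>\<^sup>+z. indicator N z \<partial>hyp_area) = 0" and X: "X \<ge> 1"
  shows "AE z in hyp_area. circle_mean X (indicator N) z = 0"
proof -
  have "(\<integral>\<^sup>+z. 1 * circle_mean X (indicator N) z \<partial>hyp_area) = (\<integral>\<^sup>+z. indicator N z * circle_mean X (\<lambda>_. 1) z \<partial>hyp_area)"
    by (rule circle_mean_symmetric[OF X]) auto
  then have "(\<integral>\<^sup>+z. circle_mean X (indicator N) z \<partial>hyp_area) = 0" by (simp add: circle_mean_one N)
  then show ?thesis by (subst (asm) nn_integral_0_iff_AE) (auto intro!: measurable_hyp_area)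
qed

lemma circle_mean_AE_cong:
  assumes [measurable]: "u \<in> borel_measurable borel" "v \<in> borel_measurable borel"
    and X: "X \<ge> 1" and uv: "AE z in hyp_area. u z = v z"
  shows "AE z in hyp_area. circle_mean X u z = circle_mean X v z"
proof -
  define N where "N = {z. u z \<noteq> v z}"
  have [measurable]: "N \<in> sets borel" unfolding N_def by measurable
  have "(\<integral>\<^sup>+z. indicator N z \<partial>hyp_area) = 0"
    by (subst nn_integral_0_iff_AE) (use uv in \<open>auto simp: N_def intro!: measurable_hyp_area\<close>)
  then have "AE z in hyp_area. circle_mean X (indicator N) z = 0"
    by (rule circle_mean_null_set[OF _ _ X, rotated]) measurable
  then show ?thesis
  proof eventually_elim
    case (elim z)
    have "AE t in angle_measure. indicator N (affine_move z (circle_point X t)) = (0::ennreal)"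
      using elim unfolding circle_mean_def by (subst (asm) nn_integral_0_iff_AE) auto
    then show ?case unfolding circle_mean_def
      by (intro nn_integral_cong_AE, eventually_elim) (auto simp: N_def split: split_indicator_asm)
  qed
qed

locale fuchsian_region =
  fixes \<Gamma> :: "(real^2^2) set set" and F :: "complex set"
  assumes fuchsian: "fuchsian \<Gamma>" and region: "fundamental_region \<Gamma> F"
begin

lemma subgroup: "subgroup \<Gamma> PSL2R" using fuchsian by (simp add: fuchsian_def)

lemma in_carrier: "g \<in> \<Gamma> \<Longrightarrow> g \<in> carrier PSL2R"
  using subgroup by (rule subgroup.mem_carrier)

lemma inv_in: "g \<in> \<Gamma> \<Longrightarrow> inv\<^bsub>PSL2R\<^esub> g \<in> \<Gamma>"
  using subgroup by (rule subgroup.m_inv_closed)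

lemma act_inv:
  assumes "g \<in> \<Gamma>" "Im z > 0"
  shows "psl_act (inv\<^bsub>PSL2R\<^esub> g) (psl_act g z) = z" "psl_act g (psl_act (inv\<^bsub>PSL2R\<^esub> g) z) = z"
  using assms in_carrier[OF assms(1)] in_carrier[OF inv_in[OF assms(1)]]
  by (simp_all add: psl_act_mult[symmetric] group.l_inv[OF group_PSL2R] group.r_inv[OF group_PSL2R] psl_act_one)

lemma bij_inv: "bij_betw (\<lambda>g. inv\<^bsub>PSL2R\<^esub> g) \<Gamma> \<Gamma>"
  by (rule bij_betw_byWitness[where f'="\<lambda>g. inv\<^bsub>PSL2R\<^esub> g"])
    (auto simp: inv_in in_carrier group.inv_inv[OF group_PSL2R])

text \<open>A fixed choice of the open set whose closure is the fundamental region and whose translates are disjoint.\<close>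

definition core :: "complex set" where
  "core = (SOME F0. openin (top_of_set upper_half_plane) F0 \<and> F0 \<noteq> {} \<and>
        F = top_of_set upper_half_plane closure_of F0 \<and>
        emeasure hyp_area (F - F0) = 0 \<and>
        (\<Union>\<gamma>\<in>\<Gamma>. psl_act \<gamma> ` F) = upper_half_plane \<and>
        (\<forall>\<gamma>\<in>\<Gamma>. \<gamma> \<noteq> \<one>\<^bsub>PSL2R\<^esub> \<longrightarrow> F0 \<inter> psl_act \<gamma> ` F0 = {}))"

lemma core:
  "openin (top_of_set upper_half_plane) core" "core \<noteq> {}"
  "emeasure hyp_area (F - core) = 0"
  "(\<Union>\<gamma>\<in>\<Gamma>. psl_act \<gamma> ` F) = upper_half_plane"
  "\<And>\<gamma>. \<gamma> \<in> \<Gamma> \<Longrightarrow> \<gamma> \<noteq> \<one>\<^bsub>PSL2R\<^esub> \<Longrightarrow> core \<inter> psl_act \<gamma> ` core = {}"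
proof -
  have "\<exists>F0. openin (top_of_set upper_half_plane) F0 \<and> F0 \<noteq> {} \<and>
        F = top_of_set upper_half_plane closure_of F0 \<and>
        emeasure hyp_area (F - F0) = 0 \<and>
        (\<Union>\<gamma>\<in>\<Gamma>. psl_act \<gamma> ` F) = upper_half_plane \<and>
        (\<forall>\<gamma>\<in>\<Gamma>. \<gamma> \<noteq> \<one>\<^bsub>PSL2R\<^esub> \<longrightarrow> F0 \<inter> psl_act \<gamma> ` F0 = {})"
    using region unfolding fundamental_region_def by blast
  from someI_ex[OF this] show
    "openin (top_of_set upper_half_plane) core" "core \<noteq> {}"
    "emeasure hyp_area (F - core) = 0"
    "(\<Union>\<gamma>\<in>\<Gamma>. psl_act \<gamma> ` F) = upper_half_plane"
    "\<And>\<gamma>. \<gamma> \<in> \<Gamma> \<Longrightarrow> \<gamma> \<noteq> \<one>\<^bsub>PSL2R\<^esub> \<Longrightarrow> core \<inter> psl_act \<gamma> ` core = {}"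
    unfolding core_def[symmetric] by blast+
qed

lemma open_core: "open core"
  using core(1) unfolding openin_open_eq[OF open_upper_half_plane] by (rule conjunct1)

lemma core_subset: "core \<subseteq> upper_half_plane"
  using core(1) by (rule openin_imp_subset)

lemma F_closedin: "closedin (top_of_set upper_half_plane) F"
  using region unfolding fundamental_region_def by (rule conjunct1)

lemma F_subset: "F \<subseteq> upper_half_plane"
  using F_closedin by (rule closedin_imp_subset)

lemma F_borel [measurable]: "F \<in> sets borel"
proof -
  obtain T where "closed T" "F = upper_half_plane \<inter> T"
    using F_closedin unfolding closedin_closed by blast
  then show ?thesis by (simp add: borel_closed)
qed

lemma core_translates_disjoint:
  assumes g: "g \<in> \<Gamma>" "h \<in> \<Gamma>" and z: "Im z > 0" and in_core: "psl_act g z \<in> core" "psl_act h z \<in> core"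
  shows "g = h"
proof (rule ccontr)
  assume ne: "g \<noteq> h"
  define k where "k = g \<otimes>\<^bsub>PSL2R\<^esub> inv\<^bsub>PSL2R\<^esub> h"
  have gc: "g \<in> carrier PSL2R" "h \<in> carrier PSL2R" "inv\<^bsub>PSL2R\<^esub> h \<in> carrier PSL2R"
    using g in_carrier inv_in by auto
  have k: "k \<in> \<Gamma>" unfolding k_def using subgroup g inv_in by (simp add: subgroup.m_closed)
  have "k \<noteq> \<one>\<^bsub>PSL2R\<^esub>"
  proof
    assume "k = \<one>\<^bsub>PSL2R\<^esub>"
    then have "inv\<^bsub>PSL2R\<^esub> (inv\<^bsub>PSL2R\<^esub> h) = g"
      unfolding k_def using gc by (intro group.inv_equality[OF group_PSL2R]) auto
    then show False using ne gc by (simp add: group.inv_inv[OF group_PSL2R])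
  qed
  then have disj: "core \<inter> psl_act k ` core = {}" by (rule core(5)[OF k])
  have "psl_act k (psl_act h z) = psl_act g z"
    unfolding k_def using g z gc psl_act_in_upper[OF gc(2) z] by (simp add: psl_act_mult act_inv)
  then have "psl_act g z \<in> psl_act k ` core" using imageI[OF in_core(2), of "psl_act k"] by simp
  then show False using in_core(1) disj by (simp add: disjoint_iff)
qed

text \<open>The translates of the open core are non-empty, open and pairwise disjoint, and the plane has a countable
  base.\<close>

lemma countable_group: "countable \<Gamma>"
proof -
  define U where "U g = {z \<in> upper_half_plane. psl_act g z \<in> core}" for g
  have op: "open (U g)" if "g \<in> \<Gamma>" for g
  proof -
    have "U g = psl_act g -` core \<inter> upper_half_plane" by (auto simp: U_def)
    then show ?thesis
      using continuous_on_open_vimage[OF open_upper_half_plane] continuous_on_psl_act[OF in_carrier[OF that]] open_core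
      by auto
  qed
  have ne: "U g \<noteq> {}" if g: "g \<in> \<Gamma>" for g
  proof -
    obtain z where z: "z \<in> core" using core(2) by auto
    then have "Im z > 0" using core_subset by (auto simp: upper_half_plane_def)
    then have "psl_act (inv\<^bsub>PSL2R\<^esub> g) z \<in> U g"
      using g z act_inv(2)[OF g] psl_act_in_upper[OF in_carrier[OF inv_in[OF g]]]
      by (simp add: U_def upper_half_plane_def)
    then show ?thesis by auto
  qed
  have disj: "g = h" if "g \<in> \<Gamma>" "h \<in> \<Gamma>" "z \<in> U g" "z \<in> U h" for g h z
    by (rule core_translates_disjoint[of g h z]) (use that in \<open>simp_all add: U_def upper_half_plane_def\<close>)
  have "countable (U ` \<Gamma>)"
  proof (rule countable_disjoint_open_subsets)
    show "pairwise disjnt (U ` \<Gamma>)"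
    proof (rule pairwiseI)
      fix S T assume "S \<in> U ` \<Gamma>" "T \<in> U ` \<Gamma>" "S \<noteq> T"
      then obtain g h where gh: "g \<in> \<Gamma>" "h \<in> \<Gamma>" "S = U g" "T = U h" "g \<noteq> h" by (elim imageE) metis
      then show "disjnt S T" using disj[OF gh(1,2)] by (simp add: disjnt_iff) metis
    qed
  qed (use op in auto)
  moreover have "inj_on U \<Gamma>"
  proof (rule inj_onI)
    fix g h assume gh: "g \<in> \<Gamma>" "h \<in> \<Gamma>" "U g = U h"
    obtain z where "z \<in> U g" using ne[OF gh(1)] by auto
    then show "g = h" using disj[OF gh(1,2)] gh(3) by simp
  qed
  ultimately show ?thesis by (rule countable_image_inj_on)
qed

text \<open>Every point has a translate in \<open>F\<close>. If no translate lies in the null set \<open>F - core\<close>, two translates in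
  \<open>F\<close> lie in the core, and they come from the same group element.\<close>

lemma translates_partition:
  "AE z in hyp_area. (\<integral>\<^sup>+g. indicator F (psl_act g z) \<partial>count_space \<Gamma>) = 1"
proof -
  have [measurable]: "core \<in> sets borel" using open_core by (rule borel_open)
  have "F - core \<in> sets hyp_area"
    unfolding sets_hyp_area by (subst sets_restrict_space_iff) (use F_subset in auto)
  then have null: "(\<integral>\<^sup>+z. indicator (F - core) z \<partial>hyp_area) = 0" using core(3) by simp
  have "AE z in hyp_area. \<forall>g\<in>\<Gamma>. psl_act g z \<notin> F - core"
    unfolding AE_ball_countable[OF countable_group]
  proof
    fix g assume g: "g \<in> \<Gamma>"
    note [measurable] = measurable_psl_act[OF in_carrier[OF g]]
    have "(\<integral>\<^sup>+z. indicator (F - core) (psl_act g z) \<partial>hyp_area) = 0"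
      using null by (subst hyp_area_psl_act_invariant[OF in_carrier[OF g], of "indicator (F - core)"]) auto
    then have "AE z in hyp_area. indicator (F - core) (psl_act g z) = (0::ennreal)"
      by (subst (asm) nn_integral_0_iff_AE) (auto intro!: measurable_hyp_area)
    then show "AE z in hyp_area. psl_act g z \<notin> F - core"
      by eventually_elim (auto split: split_indicator_asm)
  qed
  then show ?thesis
  proof (rule AE_mp, intro AE_I2 impI)
    fix z assume "z \<in> space hyp_area" and ok: "\<forall>g\<in>\<Gamma>. psl_act g z \<notin> F - core"
    then have z: "Im z > 0" by (simp add: space_hyp_area upper_half_plane_def)
    have "z \<in> (\<Union>\<gamma>\<in>\<Gamma>. psl_act \<gamma> ` F)" using core(4) z by (simp add: upper_half_plane_def)
    then obtain g w where g: "g \<in> \<Gamma>" "w \<in> F" "z = psl_act g w" by blast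
    define h where "h = inv\<^bsub>PSL2R\<^esub> g"
    have h: "h \<in> \<Gamma>" "psl_act h z \<in> F"
      using g F_subset act_inv(1)[OF g(1), of w] inv_in by (auto simp: h_def upper_half_plane_def)
    have "psl_act k z \<notin> F" if "k \<in> \<Gamma>" "k \<noteq> h" for k
      using core_translates_disjoint[OF that(1) h(1) z] ok h that by auto
    then have "(\<integral>\<^sup>+g. indicator F (psl_act g z) \<partial>count_space \<Gamma>) = (\<Sum>g\<in>{h}. indicator F (psl_act g z))"
      by (intro nn_integral_count_space') (use h in auto)
    then show "(\<integral>\<^sup>+g. indicator F (psl_act g z) \<partial>count_space \<Gamma>) = 1" using h by simp
  qed
qed

definition invariant :: "(complex \<Rightarrow> 'b) \<Rightarrow> bool" where
  "invariant u \<longleftrightarrow> (\<forall>g\<in>\<Gamma>. \<forall>z. Im z > 0 \<longrightarrow> u (psl_act g z) = u z)"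

text \<open>Unfolding: symmetry on the half-plane moves the circle mean to \<open>v\<close> cut off to \<open>F\<close>. The half-plane is then cut into
  translates of \<open>F\<close>, invariance brings each of them back to \<open>F\<close>, and the cut-off functions add up to \<open>v\<close>.\<close>

lemma quotient_circle_mean_symmetric:
  assumes X: "X \<ge> 1" and [measurable]: "u \<in> borel_measurable borel" "v \<in> borel_measurable borel"
    and inv: "invariant u" "invariant v"
  shows "(\<integral>\<^sup>+z. indicator F z * (v z * circle_mean X u z) \<partial>hyp_area)
       = (\<integral>\<^sup>+z. indicator F z * (u z * circle_mean X v z) \<partial>hyp_area)"
proof -
  let ?w = "\<lambda>z. indicator F z * v z"
  have pm: "psl_act g \<in> borel_measurable borel" if "g \<in> \<Gamma>" for g
    using that by (intro measurable_psl_act in_carrier)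
  have "(\<integral>\<^sup>+z. indicator F z * (v z * circle_mean X u z) \<partial>hyp_area) = (\<integral>\<^sup>+z. u z * circle_mean X ?w z \<partial>hyp_area)"
    by (subst circle_mean_symmetric[OF X, symmetric]) (auto simp: mult.assoc)
  also have "\<dots> = (\<integral>\<^sup>+z. \<integral>\<^sup>+g. indicator F (psl_act g z) * (u z * circle_mean X ?w z) \<partial>count_space \<Gamma> \<partial>hyp_area)"
    by (rule nn_integral_cong_AE, use translates_partition in eventually_elim) (simp add: nn_integral_multc)
  also have "\<dots> = (\<integral>\<^sup>+g. \<integral>\<^sup>+z. indicator F (psl_act g z) * (u z * circle_mean X ?w z) \<partial>hyp_area \<partial>count_space \<Gamma>)"
  proof (rule nn_integral_count_space_nn_integral[OF countable_group])
    fix g assume "g \<in> \<Gamma>"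
    note [measurable] = pm[OF this]
    show "(\<lambda>z. indicator F (psl_act g z) * (u z * circle_mean X ?w z)) \<in> borel_measurable hyp_area"
      by (rule measurable_hyp_area) measurable
  qed
  also have "\<dots> = (\<integral>\<^sup>+g. \<integral>\<^sup>+z. indicator F z * (u z * circle_mean X (\<lambda>w. indicator F (psl_act (inv\<^bsub>PSL2R\<^esub> g) w) * v w) z) \<partial>hyp_area \<partial>count_space \<Gamma>)"
  proof (rule nn_integral_cong)
    fix g assume "g \<in> space (count_space \<Gamma>)"
    then have g: "g \<in> \<Gamma>" by simp
    define h where "h = inv\<^bsub>PSL2R\<^esub> g"
    have h: "h \<in> \<Gamma>" unfolding h_def using g by (rule inv_in)
    note [measurable] = pm[OF g] pm[OF h]
    have "(\<integral>\<^sup>+z. indicator F (psl_act g z) * (u z * circle_mean X ?w z) \<partial>hyp_area)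
        = (\<integral>\<^sup>+z. indicator F (psl_act g (psl_act h z)) * (u (psl_act h z) * circle_mean X ?w (psl_act h z)) \<partial>hyp_area)"
      by (rule hyp_area_psl_act_invariant[OF in_carrier[OF h], symmetric]) measurable
    also have "\<dots> = (\<integral>\<^sup>+z. indicator F z * (u z * circle_mean X (\<lambda>w. indicator F (psl_act h w) * v w) z) \<partial>hyp_area)"
    proof (rule nn_integral_hyp_area_cong)
      fix z :: complex assume z: "Im z > 0"
      have "circle_mean X ?w (psl_act h z) = circle_mean X (\<lambda>w. ?w (psl_act h w)) z"
        by (rule circle_mean_psl_act[OF in_carrier[OF h] z X, symmetric]) measurable
      also have "\<dots> = circle_mean X (\<lambda>w. indicator F (psl_act h w) * v w) z"
        by (rule circle_mean_cong[OF X z]) (use inv(2) h in \<open>auto simp: invariant_def\<close>)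
      finally show "indicator F (psl_act g (psl_act h z)) * (u (psl_act h z) * circle_mean X ?w (psl_act h z))
        = indicator F z * (u z * circle_mean X (\<lambda>w. indicator F (psl_act h w) * v w) z)"
        using act_inv(2)[OF g z] inv(1) h z by (simp add: h_def invariant_def)
    qed
    finally show "(\<integral>\<^sup>+z. indicator F (psl_act g z) * (u z * circle_mean X ?w z) \<partial>hyp_area)
      = (\<integral>\<^sup>+z. indicator F z * (u z * circle_mean X (\<lambda>w. indicator F (psl_act (inv\<^bsub>PSL2R\<^esub> g) w) * v w) z) \<partial>hyp_area)"
      by (simp add: h_def)
  qed
  also have "\<dots> = (\<integral>\<^sup>+g. \<integral>\<^sup>+z. indicator F z * (u z * circle_mean X (\<lambda>w. indicator F (psl_act g w) * v w) z) \<partial>hyp_area \<partial>count_space \<Gamma>)"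
    by (rule nn_integral_bij_count_space[OF bij_inv])
  also have "\<dots> = (\<integral>\<^sup>+z. \<integral>\<^sup>+g. indicator F z * (u z * circle_mean X (\<lambda>w. indicator F (psl_act g w) * v w) z) \<partial>count_space \<Gamma> \<partial>hyp_area)"
  proof (rule nn_integral_count_space_nn_integral[OF countable_group, symmetric])
    fix g assume "g \<in> \<Gamma>"
    note [measurable] = pm[OF this]
    show "(\<lambda>z. indicator F z * (u z * circle_mean X (\<lambda>w. indicator F (psl_act g w) * v w) z)) \<in> borel_measurable hyp_area"
      by (rule measurable_hyp_area) measurable
  qed
  also have "\<dots> = (\<integral>\<^sup>+z. indicator F z * (u z * circle_mean X v z) \<partial>hyp_area)"
  proof (rule nn_integral_cong_AE)
    define S where "S w = (\<integral>\<^sup>+g. indicator F (psl_act g w) \<partial>count_space \<Gamma>) * v w" for w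
    have Sm: "S \<in> borel_measurable borel"
    proof -
      have "(\<lambda>w. \<integral>\<^sup>+g. indicator F (psl_act g w) \<partial>count_space \<Gamma>) \<in> borel_measurable borel"
      proof -
        interpret sigma_finite_measure "count_space \<Gamma>"
          by (rule sigma_finite_measure_count_space_countable[OF countable_group])
        have [measurable]: "(\<lambda>p. indicator F (psl_act (fst p) (snd p)) :: ennreal) \<in> borel_measurable (count_space \<Gamma> \<Otimes>\<^sub>M borel)"
        proof (rule measurable_pair_measure_countable1[OF countable_group])
          fix g assume "g \<in> \<Gamma>"
          note [measurable] = pm[OF this]
          show "(\<lambda>y. indicator F (psl_act (fst (g, y)) (snd (g, y))) :: ennreal) \<in> borel_measurable borel" by simp
        qed
        have "(\<lambda>p. indicator F (psl_act (snd p) (fst p)) :: ennreal) \<in> borel_measurable (borel \<Otimes>\<^sub>M count_space \<Gamma>)"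
          using measurable_compose[OF measurable_pair_swap' \<open>(\<lambda>p. indicator F (psl_act (fst p) (snd p)) :: ennreal) \<in> _\<close>]
          by (simp add: split_beta')
        then show ?thesis by (intro borel_measurable_nn_integral) (simp add: split_beta')
      qed
      then show ?thesis unfolding S_def[abs_def] by measurable
    qed
    have "AE z in hyp_area. S z = v z" using translates_partition by eventually_elim (simp add: S_def)
    then have ae: "AE z in hyp_area. circle_mean X S z = circle_mean X v z"
      by (intro circle_mean_AE_cong[OF Sm _ X]) auto
    have "(\<integral>\<^sup>+g. circle_mean X (\<lambda>w. indicator F (psl_act g w) * v w) z \<partial>count_space \<Gamma>) = circle_mean X S z" for z
    proof -
      have "(\<integral>\<^sup>+g. circle_mean X (\<lambda>w. indicator F (psl_act g w) * v w) z \<partial>count_space \<Gamma>)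
          = (\<integral>\<^sup>+t. \<integral>\<^sup>+g. indicator F (psl_act g (affine_move z (circle_point X t))) * v (affine_move z (circle_point X t)) \<partial>count_space \<Gamma> \<partial>angle_measure)"
        unfolding circle_mean_def
      proof (rule nn_integral_count_space_nn_integral[OF countable_group, symmetric])
        fix g assume "g \<in> \<Gamma>"
        note [measurable] = pm[OF this]
        show "(\<lambda>t. indicator F (psl_act g (affine_move z (circle_point X t))) * v (affine_move z (circle_point X t))) \<in> borel_measurable angle_measure"
          by measurable
      qed
      then show ?thesis by (simp add: circle_mean_def S_def nn_integral_multc)
    qed
    then have "(\<integral>\<^sup>+g. indicator F z * (u z * circle_mean X (\<lambda>w. indicator F (psl_act g w) * v w) z) \<partial>count_space \<Gamma>)
        = indicator F z * (u z * circle_mean X S z)" for z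
      by (simp add: nn_integral_cmult)
    with ae show "AE z in hyp_area. (\<integral>\<^sup>+g. indicator F z * (u z * circle_mean X (\<lambda>w. indicator F (psl_act g w) * v w) z) \<partial>count_space \<Gamma>)
        = indicator F z * (u z * circle_mean X v z)"
      by (auto elim: eventually_mono)
  qed
  finally show ?thesis .
qed

end

section \<open>The Abel transform of a function on the half-line\<close>

lemma integrable_abel_weight: "integrable lborel (abel_weight T)"
proof (rule integrableI_nonneg)
  show "(\<integral>\<^sup>+X. ennreal (abel_weight T X) \<partial>lborel) < \<infinity>"
    using abel_mass_finite[of T] by (simp add: abel_mass_def)
qed (auto simp: abel_weight_nonneg)

text \<open>If \<open>\<phi> X\<close> is the quadratic form of the circle mean at a function \<open>g\<close>, then \<open>abel_transform \<phi> T\<close> is that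
  of the Abel average.\<close>

definition abel_transform :: "(real \<Rightarrow> real) \<Rightarrow> real \<Rightarrow> real" where
  "abel_transform \<phi> U = (LINT X|lborel. abel_weight U X * \<phi> X)"

lemma integrable_abel_weight_mult:
  assumes [measurable]: "\<phi> \<in> borel_measurable borel" and B: "\<And>X. \<bar>\<phi> X\<bar> \<le> B"
  shows "integrable lborel (\<lambda>X. abel_weight U X * \<phi> X)"
proof (rule Bochner_Integration.integrable_bound)
  show "integrable lborel (\<lambda>X. B * abel_weight U X)" using integrable_abel_weight by simp
  have "B \<ge> 0" using B[of 0] by linarith
  show "AE X in lborel. norm (abel_weight U X * \<phi> X) \<le> norm (B * abel_weight U X)"
    using \<open>B \<ge> 0\<close> mult_right_mono[OF B abel_weight_nonneg[of U]]
    by (auto simp: abs_mult abel_weight_nonneg mult.commute)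
qed measurable

text \<open>Rescaling \<open>(1, U)\<close> to \<open>(1, 2)\<close> fixes the place of the singularity, so that continuity in \<open>U\<close> follows by
  dominated convergence.\<close>

lemma abel_transform_rescaled:
  assumes "U \<ge> 1"
  shows "abel_transform \<phi> U = sqrt (U - 1) * (LINT w|lborel. abel_weight 2 (1 + w) * \<phi> (1 + (U - 1) * w))"
proof (cases "U = 1")
  case True
  have "abel_weight 1 X = 0" for X by (simp add: abel_weight_def)
  then show ?thesis using True by (simp add: abel_transform_def)
next
  case False
  then have U: "U - 1 > 0" using assms by simp
  have "abel_transform \<phi> U = \<bar>U - 1\<bar> *\<^sub>R (LINT w|lborel. abel_weight U (1 + (U - 1) * w) * \<phi> (1 + (U - 1) * w))"
    unfolding abel_transform_def by (rule lborel_integral_real_affine) (use False in simp)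
  also have "\<dots> = (LINT w|lborel. (U - 1) * (abel_weight U (1 + (U - 1) * w) * \<phi> (1 + (U - 1) * w)))"
    using U by simp
  also have "\<dots> = (LINT w|lborel. sqrt (U - 1) * (abel_weight 2 (1 + w) * \<phi> (1 + (U - 1) * w)))"
  proof (rule Bochner_Integration.integral_cong[OF refl])
    fix w
    have "(U - 1) * abel_weight U (1 + (U - 1) * w) = sqrt (U - 1) * abel_weight 2 (1 + w)"
    proof (cases "0 < w \<and> w < 1")
      case True
      have "(U - 1) * w < (U - 1) * 1" using True U by (intro mult_strict_left_mono) auto
      then have in1: "1 + (U - 1) * w < U" by (simp only: mult_1_right less_diff_eq add.commute)
      have "2 * (U - (1 + (U - 1) * w)) = (U - 1) * (2 * (1 - w))" by (simp add: algebra_simps)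
      then have "sqrt (2 * (U - (1 + (U - 1) * w))) = sqrt (U - 1) * sqrt (2 * (1 - w))"
        by (simp only: real_sqrt_mult)
      moreover have "(U - 1) / (sqrt (U - 1) * sqrt (2 * (1 - w))) = sqrt (U - 1) / sqrt (2 * (1 - w))"
        using U by (simp add: divide_simps)
      ultimately show ?thesis using True U in1 by (simp add: abel_weight_def)
    next
      case False
      have "(U - 1) * w \<le> 0 \<or> (U - 1) * w \<ge> U - 1"
        using False U mult_left_mono[of 1 w "U - 1"] by (auto simp: not_less mult_nonneg_nonpos)
      then have "abel_weight U (1 + (U - 1) * w) = 0" by (auto simp: abel_weight_def)
      then show ?thesis using False by (auto simp: abel_weight_def)
    qed
    then show "(U - 1) * (abel_weight U (1 + (U - 1) * w) * \<phi> (1 + (U - 1) * w))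
        = sqrt (U - 1) * (abel_weight 2 (1 + w) * \<phi> (1 + (U - 1) * w))"
      by (simp only: mult.assoc[symmetric])
  qed
  also have "\<dots> = sqrt (U - 1) * (LINT w|lborel. abel_weight 2 (1 + w) * \<phi> (1 + (U - 1) * w))"
    by simp
  finally show ?thesis .
qed

lemma continuous_abel_transform:
  assumes cont: "continuous_on UNIV \<phi>" and B: "\<And>X. \<bar>\<phi> X\<bar> \<le> B"
  shows "continuous_on {1..} (abel_transform \<phi>)"
proof -
  have [measurable]: "\<phi> \<in> borel_measurable borel" using cont by (rule borel_measurable_continuous_onI)
  have "B \<ge> 0" using B[of 0] by linarith
  have int: "integrable lborel (\<lambda>w. abel_weight 2 (1 + w))"
    using lborel_integrable_real_affine[OF integrable_abel_weight[of 2], of 1 1] by simp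
  define G where "G U = (LINT w|lborel. abel_weight 2 (1 + w) * \<phi> (1 + (U - 1) * w))" for U
  have "continuous_on UNIV G"
  proof (rule continuous_on_sequentiallyI)
    fix u :: "nat \<Rightarrow> real" and a assume u: "u \<longlonglongrightarrow> a"
    show "(\<lambda>n. G (u n)) \<longlonglongrightarrow> G a"
      unfolding G_def
    proof (rule integral_dominated_convergence)
      show "integrable lborel (\<lambda>w. B * abel_weight 2 (1 + w))" using int by simp
      show "AE w in lborel. (\<lambda>n. abel_weight 2 (1 + w) * \<phi> (1 + (u n - 1) * w)) \<longlonglongrightarrow> abel_weight 2 (1 + w) * \<phi> (1 + (a - 1) * w)"
      proof (intro AE_I2 tendsto_mult tendsto_const)
        fix w
        have "(\<lambda>n. 1 + (u n - 1) * w) \<longlonglongrightarrow> 1 + (a - 1) * w" by (intro tendsto_intros u)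
        then show "(\<lambda>n. \<phi> (1 + (u n - 1) * w)) \<longlonglongrightarrow> \<phi> (1 + (a - 1) * w)"
          using continuous_on_tendsto_compose[OF cont] by auto
      qed
      show "AE w in lborel. norm (abel_weight 2 (1 + w) * \<phi> (1 + (u n - 1) * w)) \<le> B * abel_weight 2 (1 + w)" for n
        unfolding mult.commute[of B] real_norm_def abs_mult abs_of_nonneg[OF abel_weight_nonneg]
        by (intro AE_I2 mult_left_mono B abel_weight_nonneg)
    qed measurable
  qed
  then have "continuous_on {1..} (\<lambda>U. sqrt (U - 1) * G U)"
    by (intro continuous_intros) (auto intro: continuous_on_subset)
  then show ?thesis
    by (rule continuous_on_eq) (simp add: abel_transform_rescaled G_def)
qed

lemma integral_abel_weight:
  assumes t: "t \<ge> 0"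
  shows "(LINT X|lborel. abel_weight (cosh t) X) = 2 * sinh (t/2)"
proof -
  have "abel_mass (cosh t) = ennreal (1/2) * (\<integral>\<^sup>+u. indicator {-t<..<t} u * ennreal (exp (- u/2)) \<partial>lborel)"
    using abel_mean_height_function[of t \<i> "\<lambda>_. 1"] t by (simp add: abel_mean_const)
  also have "(\<integral>\<^sup>+u. indicator {-t<..<t} u * ennreal (exp (- u/2)) \<partial>lborel)
      = (\<integral>\<^sup>+u. ennreal (exp (- u/2)) * indicator {-t..t} u \<partial>lborel)"
  proof (rule nn_integral_cong_AE)
    have "AE u in lborel. u \<noteq> -t \<and> u \<noteq> t"
      using AE_lborel_singleton[of "-t"] AE_lborel_singleton[of t] by eventually_elim simp
    then show "AE u in lborel. indicator {-t<..<t} u * ennreal (exp (- u/2)) = ennreal (exp (- u/2)) * indicator {-t..t} u"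
      by eventually_elim (auto split: split_indicator)
  qed
  also have "\<dots> = ennreal ((- 2 * exp (- t/2)) - (- 2 * exp (- (- t)/2)))"
    by (rule nn_integral_FTC_Icc) (use t in \<open>auto intro!: derivative_eq_intros\<close>)
  also have "ennreal (1/2) * \<dots> = ennreal (2 * sinh (t/2))"
    by (subst ennreal_mult'[symmetric]) (auto simp: sinh_def field_simps)
  finally have *: "abel_mass (cosh t) = ennreal (2 * sinh (t/2))" .
  have "(LINT X|lborel. abel_weight (cosh t) X) = enn2real (abel_mass (cosh t))"
    unfolding abel_mass_def by (rule integral_eq_nn_integral) (auto simp: abel_weight_nonneg)
  then show ?thesis using * t by simp
qed

lemma abel_transform_upper_bound:
  assumes [measurable]: "\<phi> \<in> borel_measurable borel" and B: "\<And>X. \<bar>\<phi> X\<bar> \<le> B" and q: "\<And>X. \<phi> X \<le> q" and t: "t \<ge> 0"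
  shows "abel_transform \<phi> (cosh t) \<le> q * (2 * sinh (t/2))"
proof -
  have "abel_transform \<phi> (cosh t) \<le> (LINT X|lborel. abel_weight (cosh t) X * q)"
    unfolding abel_transform_def
    by (intro integral_mono integrable_abel_weight_mult[OF _ B] mult_left_mono q abel_weight_nonneg)
      (use integrable_abel_weight in auto)
  then show ?thesis using integral_abel_weight[OF t] by (simp add: mult.commute)
qed

section \<open>From second differences to monotonicity\<close>

lemma right_difference_quotient:
  fixes s :: "real \<Rightarrow> real"
  assumes s: "continuous_on {0..} s" and a: "a \<ge> 0" and d: "d > 0"
  defines "J \<equiv> \<lambda>t. integral {0..t} s"
  shows "(\<lambda>n. (J (a + d / real (Suc n)) - J a) / (d / real (Suc n))) \<longlonglongrightarrow> s a"
proof -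
  have "(J has_real_derivative s a) (at a within {0..a+d})"
    unfolding J_def by (rule integral_has_real_derivative) (use a d in \<open>auto intro: continuous_on_subset[OF s]\<close>)
  then have lim: "((\<lambda>y. (J y - J a) / (y - a)) \<longlongrightarrow> s a) (at a within {0..a+d})"
    by (simp add: has_field_derivative_iff)
  have "filterlim (\<lambda>n. a + d / real (Suc n)) (at a within {0..a+d}) sequentially"
    unfolding filterlim_at
  proof
    show "\<forall>\<^sub>F n in sequentially. a + d / real (Suc n) \<in> {0..a+d} \<and> a + d / real (Suc n) \<noteq> a"
      using a d by (intro always_eventually) (auto simp: field_simps)
    show "(\<lambda>n. a + d / real (Suc n)) \<longlonglongrightarrow> a" by real_asymp
  qed
  from filterlim_compose[OF lim this] show ?thesis by simp
qed

text \<open>The hypothesis bounds the second differences of the integral \<open>J\<close> of \<open>s\<close> below by \<open>- 2 J h\<close>, and the bound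
  on \<open>s\<close> makes this at least \<open>- 8 q (cosh (h/2) - 1)\<close>, which is about \<open>- q h\<^sup>2\<close>. Summing over a grid of step \<open>h\<close> from
  \<open>a\<close> to \<open>b\<close> and dividing by \<open>h\<close> gives \<open>s b - s a \<ge> - q (b - a)\<close> in the limit.\<close>

lemma second_difference_monotone:
  fixes s :: "real \<Rightarrow> real"
  assumes s: "continuous_on {0..} s" and q: "q \<ge> 0"
    and bound: "\<And>v. v \<ge> 0 \<Longrightarrow> s v \<le> q * (2 * sinh (v/2))"
    and pos: "\<And>T h. 0 \<le> h \<Longrightarrow> h \<le> T \<Longrightarrow>
      0 \<le> integral {0..T + h} s + integral {0..T - h} s - 2 * integral {0..T} s + 2 * integral {0..h} s"
    and ab: "0 \<le> a" "a \<le> b"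
  shows "s a + q * a \<le> s b + q * b"
proof (cases "a = b")
  case False
  then have d: "b - a > 0" using ab by simp
  define J where "J t = integral {0..t} s" for t
  have small: "J h \<le> 4 * q * (cosh (h/2) - 1)" if h: "h \<ge> 0" for h
  proof -
    have "((\<lambda>v. q * (2 * sinh (v/2))) has_integral (q * (4 * cosh (h/2)) - q * (4 * cosh (0/2)))) {0..h}"
      by (rule fundamental_theorem_of_calculus[OF h])
        (auto intro!: derivative_eq_intros simp flip: has_real_derivative_iff_has_vector_derivative)
    moreover have "s integrable_on {0..h}" by (intro integrable_continuous_real continuous_on_subset[OF s]) auto
    ultimately have "J h \<le> q * (4 * cosh (h/2)) - q * (4 * cosh (0/2))"
      unfolding J_def using bound by (intro has_integral_le[OF integrable_integral]) auto
    then show ?thesis by (simp add: algebra_simps)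
  qed
  have step: "(J (x + h) - J x) - (J x - J (x - h)) \<ge> - (8 * q * (cosh (h/2) - 1))" if "0 \<le> h" "h \<le> x" for x h
    using pos[OF that] small[OF that(1)] by (simp add: J_def)
  have tele: "(J (a + h + real n * h) - J (a + real n * h)) - (J (a + h) - J a) \<ge> - (real n * (8 * q * (cosh (h/2) - 1)))"
    if h: "h \<ge> 0" for h n
  proof (induction n)
    case (Suc n)
    have "h \<le> a + h + real n * h" using h ab by simp
    from step[OF h this] have "(J (a + h + real (Suc n) * h) - J (a + real (Suc n) * h)) - (J (a + h + real n * h) - J (a + real n * h))
      \<ge> - (8 * q * (cosh (h/2) - 1))" by (simp add: algebra_simps)
    then show ?case using Suc by (simp add: algebra_simps)
  qed simp
  define h where "h n = (b - a) / real (Suc n)" for n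
  have hpos: "h n > 0" for n using d by (simp add: h_def)
  have ineq: "(J (b + h n) - J b) / h n - (J (a + h n) - J a) / h n
      \<ge> - (q * ((b - a) * (8 * (cosh (h n / 2) - 1) / (h n)\<^sup>2)))" for n
  proof -
    have e: "a + real (Suc n) * h n = b" using d by (simp add: h_def)
    have "a + h n + real (Suc n) * h n = b + h n" using e by simp
    then have "(J (b + h n) - J b) - (J (a + h n) - J a) \<ge> - (real (Suc n) * (8 * q * (cosh (h n/2) - 1)))"
      using tele[of "h n" "Suc n", unfolded e \<open>a + h n + real (Suc n) * h n = b + h n\<close>] hpos[of n] by simp
    then have "((J (b + h n) - J b) - (J (a + h n) - J a)) / h n \<ge> - (real (Suc n) * (8 * q * (cosh (h n/2) - 1))) / h n"
      using hpos[of n] by (intro divide_right_mono) auto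
    moreover have "real (Suc n) = (b - a) / h n" using d by (simp add: h_def)
    then have "- (real (Suc n) * (8 * q * (cosh (h n/2) - 1))) / h n = - (q * ((b - a) * (8 * (cosh (h n / 2) - 1) / (h n)\<^sup>2)))"
      by (simp add: power2_eq_square)
    ultimately show ?thesis by (simp add: diff_divide_distrib)
  qed
  have "(\<lambda>n. (J (b + h n) - J b) / h n - (J (a + h n) - J a) / h n) \<longlonglongrightarrow> s b - s a"
    unfolding h_def J_def by (intro tendsto_diff right_difference_quotient s) (use ab d in auto)
  moreover have "(\<lambda>n. - (q * ((b - a) * (8 * (cosh (h n / 2) - 1) / (h n)\<^sup>2)))) \<longlonglongrightarrow> - (q * ((b - a) * 1))"
  proof -
    have "((\<lambda>x::real. 8 * (cosh (x / 2) - 1) / x\<^sup>2) \<longlongrightarrow> 1) (at_right 0)"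
      unfolding cosh_field_def by real_asymp
    moreover have "filterlim h (at_right 0) sequentially"
      unfolding filterlim_at using hpos
    proof (intro conjI)
      show "h \<longlonglongrightarrow> 0" unfolding h_def by real_asymp
      show "\<forall>\<^sub>F x in sequentially. h x \<in> {0<..} \<and> h x \<noteq> 0"
        using hpos by (intro always_eventually) (auto simp: less_imp_neq[THEN not_sym])
    qed
    ultimately have "(\<lambda>n. 8 * (cosh (h n / 2) - 1) / (h n)\<^sup>2) \<longlonglongrightarrow> 1" by (rule filterlim_compose)
    then show ?thesis by (intro tendsto_intros)
  qed
  ultimately have "- (q * ((b - a) * 1)) \<le> s b - s a"
    using ineq by (intro LIMSEQ_le) auto
  then show ?thesis by (simp add: algebra_simps)
qed simp

section \<open>Inverting the Abel transform\<close>

definition root_weight :: "real \<Rightarrow> real \<Rightarrow> real" where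
  "root_weight X U = (if U < X then 1 / sqrt (X - U) else 0)"

lemma measurable_root_weight [measurable (raw)]:
  assumes [measurable]: "f \<in> borel_measurable M" "g \<in> borel_measurable M"
  shows "(\<lambda>x. root_weight (f x) (g x)) \<in> borel_measurable M"
  unfolding root_weight_def by measurable

lemma root_weight_nonneg: "root_weight X U \<ge> 0"
  by (simp add: root_weight_def)

text \<open>Exchanging the integrals, the two inverse square roots combine to an arcsine density on \<open>(c, X)\<close>.\<close>

lemma abel_inversion:
  assumes [measurable]: "f \<in> borel_measurable borel"
  shows "(\<integral>\<^sup>+U. ennreal (root_weight X U) * (\<integral>\<^sup>+c. ennreal (abel_weight U c) * f c \<partial>lborel) \<partial>lborel)
    = ennreal (pi / sqrt 2) * (\<integral>\<^sup>+c. indicator {1<..<X} c * f c \<partial>lborel)"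
proof -
  have "(\<integral>\<^sup>+U. ennreal (root_weight X U) * (\<integral>\<^sup>+c. ennreal (abel_weight U c) * f c \<partial>lborel) \<partial>lborel)
      = (\<integral>\<^sup>+U. \<integral>\<^sup>+c. ennreal (root_weight X U) * ennreal (abel_weight U c) * f c \<partial>lborel \<partial>lborel)"
    by (simp add: nn_integral_cmult mult.assoc)
  also have "\<dots> = (\<integral>\<^sup>+c. \<integral>\<^sup>+U. ennreal (root_weight X U) * ennreal (abel_weight U c) * f c \<partial>lborel \<partial>lborel)"
    by (rule lborel_pair.Fubini') measurable
  also have "\<dots> = (\<integral>\<^sup>+c. ennreal (pi / sqrt 2) * (indicator {1<..<X} c * f c) \<partial>lborel)"
  proof (rule nn_integral_cong)
    fix c
    have "(\<integral>\<^sup>+U. ennreal (root_weight X U) * ennreal (abel_weight U c) \<partial>lborel) = ennreal (pi / sqrt 2) * indicator {1<..<X} c"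
    proof (cases "c \<in> {1<..<X}")
      case True
      have "ennreal (root_weight X U) * ennreal (abel_weight U c)
          = ennreal (1 / sqrt 2) * ennreal (if c < U \<and> U < X then 1 / sqrt ((X - U) * (U - c)) else 0)" for U
      proof (cases "c < U \<and> U < X")
        case c: True
        have "root_weight X U * abel_weight U c = 1 / sqrt 2 * (1 / sqrt ((X - U) * (U - c)))"
          using c True unfolding root_weight_def abel_weight_def real_sqrt_mult by simp
        then show ?thesis using c
          by (simp only: ennreal_mult'[symmetric] root_weight_nonneg) (subst ennreal_mult'[symmetric], auto simp: root_weight_nonneg)
      qed (auto simp: root_weight_def abel_weight_def)
      then have "(\<integral>\<^sup>+U. ennreal (root_weight X U) * ennreal (abel_weight U c) \<partial>lborel) = ennreal (1 / sqrt 2) * ennreal pi"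
        using nn_integral_arcsine[of c X] True by (simp add: nn_integral_cmult)
      also have "\<dots> = ennreal (pi / sqrt 2)" by (subst ennreal_mult'[symmetric]) auto
      finally show ?thesis using True by simp
    next
      case False
      then have "ennreal (root_weight X U) * ennreal (abel_weight U c) = 0" for U
        by (auto simp: root_weight_def abel_weight_def)
      then show ?thesis using False by (simp only: nn_integral_const mult_zero_left) simp
    qed
    moreover have "(\<integral>\<^sup>+U. ennreal (root_weight X U) * ennreal (abel_weight U c) * f c \<partial>lborel)
        = (\<integral>\<^sup>+U. ennreal (root_weight X U) * ennreal (abel_weight U c) \<partial>lborel) * f c"
      by (rule nn_integral_multc) measurable
    ultimately show "(\<integral>\<^sup>+U. ennreal (root_weight X U) * ennreal (abel_weight U c) * f c \<partial>lborel)
        = ennreal (pi / sqrt 2) * (indicator {1<..<X} c * f c)"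
      by (simp only: mult.assoc)
  qed
  also have "\<dots> = ennreal (pi / sqrt 2) * (\<integral>\<^sup>+c. indicator {1<..<X} c * f c \<partial>lborel)"
    by (rule nn_integral_cmult) measurable
  finally show ?thesis .
qed

definition arcosh_deriv :: "real \<Rightarrow> real" where
  "arcosh_deriv c = (if 1 < c then 1 / sqrt (c\<^sup>2 - 1) else 0)"

lemma measurable_arcosh_deriv [measurable]: "arcosh_deriv \<in> borel_measurable borel"
  unfolding arcosh_deriv_def[abs_def] by measurable

lemma nn_integral_arcosh_deriv:
  assumes U: "U \<ge> 1"
  shows "(\<integral>\<^sup>+c. ennreal (arcosh_deriv c) * indicator {..<U} c \<partial>lborel) = ennreal (arcosh U)"
proof (cases "U = 1")
  case True
  have "ennreal (arcosh_deriv c) * indicator {..<1} c = 0" for c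
    by (auto simp: arcosh_deriv_def split: split_indicator)
  then show ?thesis using True by (simp only: nn_integral_const) simp
next
  case False
  define r where "r = arcosh U"
  have r: "r > 0" "cosh r = U" using U False by (simp_all add: r_def)
  define f where "f c = ennreal (arcosh_deriv c) * indicator {..<U} c" for c
  have [measurable]: "f \<in> borel_measurable borel" unfolding f_def[abs_def] by measurable
  have "(\<integral>\<^sup>+c. f c * indicator {cosh 0..cosh r} c \<partial>lborel) = (\<integral>\<^sup>+t. f (cosh t) * ennreal (sinh t) * indicator {0..r} t \<partial>lborel)"
    by (rule nn_integral_substitution_aux) (use r in \<open>auto intro!: derivative_eq_intros continuous_intros\<close>)
  moreover have "(\<integral>\<^sup>+c. f c * indicator {cosh 0..cosh r} c \<partial>lborel) = (\<integral>\<^sup>+c. f c \<partial>lborel)"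
    by (intro nn_integral_cong) (auto simp: f_def r arcosh_deriv_def split: split_indicator)
  moreover have "(\<integral>\<^sup>+t. f (cosh t) * ennreal (sinh t) * indicator {0..r} t \<partial>lborel) = (\<integral>\<^sup>+t. indicator {0..r} t \<partial>lborel)"
  proof (rule nn_integral_cong_AE)
    have "AE t in lborel. t \<noteq> 0 \<and> t \<noteq> r"
      using AE_lborel_singleton[of 0] AE_lborel_singleton[of r] by eventually_elim simp
    then show "AE t in lborel. f (cosh t) * ennreal (sinh t) * indicator {0..r} t = indicator {0..r} t"
    proof eventually_elim
      fix t assume ne: "t \<noteq> 0 \<and> t \<noteq> r"
      show "f (cosh t) * ennreal (sinh t) * indicator {0..r} t = indicator {0..r} t"
      proof (cases "t \<in> {0..r}")
        case True
        then have t: "0 < t" "t < r" using ne by auto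
        have c: "1 < cosh t" "cosh t < U"
          using t r(2) cosh_real_nonneg_less_iff[of 0 t] cosh_real_nonneg_less_iff[of t r] by auto
        have "sqrt ((cosh t)\<^sup>2 - 1) = sinh t" using t by (simp add: cosh_square_eq)
        then have "f (cosh t) = ennreal (1 / sinh t)" using c by (simp add: f_def arcosh_deriv_def)
        moreover have "ennreal (1 / sinh t) * ennreal (sinh t) = 1"
          using t by (subst ennreal_mult[symmetric]) auto
        ultimately show ?thesis using True by simp
      qed simp
    qed
  qed
  ultimately show ?thesis using r by (simp add: f_def r_def)
qed

text \<open>Times \<open>sqrt 2 / \<pi>\<close>, this is the spherical function at the bottom of the tempered spectrum, evaluated at the
  radius with \<open>cosh r = c\<close>: the kernel of the inverse Abel transform applied to the derivative of
  \<open>arcosh\<close>.\<close>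

definition harish_chandra :: "real \<Rightarrow> ennreal" where
  "harish_chandra c = (\<integral>\<^sup>+U. ennreal (root_weight c U) * ennreal (arcosh_deriv U) \<partial>lborel)"

lemma measurable_harish_chandra [measurable]: "harish_chandra \<in> borel_measurable borel"
  unfolding harish_chandra_def[abs_def] by measurable

text \<open>From \<open>sqrt (c - 1) \<le> sqrt (U - 1) + sqrt (c - U)\<close> the integrand is at most \<open>1 / sqrt (c - 1)\<close> times the
  sum of the derivative of \<open>arcosh\<close> and an arcsine density on \<open>(-1, c)\<close>.\<close>

lemma harish_chandra_bound:
  assumes c: "c > 1"
  shows "harish_chandra c \<le> ennreal ((arcosh c + pi) / sqrt (c - 1))"
proof -
  define n where "n = sqrt (c - 1)"
  have n: "n > 0" using c by (simp add: n_def)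
  have "ennreal (root_weight c U) * ennreal (arcosh_deriv U)
      \<le> ennreal (1 / n) * (ennreal (arcosh_deriv U) * indicator {..<c} U + ennreal (if - 1 < U \<and> U < c then 1 / sqrt ((c - U) * (U - (- 1))) else 0))" for U
  proof (cases "1 < U \<and> U < c")
    case True
    define p r m where "p = sqrt (U - 1)" and "r = sqrt (c - U)" and "m = sqrt (U + 1)"
    have pos: "p > 0" "r > 0" "m > 0" using True by (simp_all add: p_def r_def m_def)
    have "n \<le> p + r"
      using sqrt_add_le_add_sqrt[of "U - 1" "c - U"] True by (simp add: n_def p_def r_def)
    have d: "arcosh_deriv U = 1 / (p * m)"
    proof -
      have "U\<^sup>2 - 1 = (U - 1) * (U + 1)" by (simp add: power2_eq_square algebra_simps)
      then show ?thesis using True by (simp add: arcosh_deriv_def p_def m_def real_sqrt_mult)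
    qed
    have w: "root_weight c U = 1 / r" using True by (simp add: root_weight_def r_def)
    have s: "sqrt ((c - U) * (U - (- 1))) = r * m" by (simp add: r_def m_def real_sqrt_mult)
    have "1 / r * (1 / (p * m)) \<le> 1 / n * (1 / (p * m) + 1 / (r * m))"
    proof -
      have "n * (1 / r * (1 / (p * m))) \<le> (p + r) * (1 / r * (1 / (p * m)))"
        using \<open>n \<le> p + r\<close> pos by (intro mult_right_mono) auto
      also have "\<dots> = 1 / (p * m) + 1 / (r * m)" using pos by (simp add: field_simps)
      finally show ?thesis using n by (simp add: field_simps)
    qed
    then have "ennreal (1 / r * (1 / (p * m))) \<le> ennreal (1 / n * (1 / (p * m) + 1 / (r * m)))" by (rule ennreal_leI)
    also have "\<dots> = ennreal (1 / n) * (ennreal (1 / (p * m)) + ennreal (1 / (r * m)))"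
      using n pos by (subst ennreal_mult) (auto intro!: ennreal_plus)
    also have "ennreal (1 / r * (1 / (p * m))) = ennreal (1 / r) * ennreal (1 / (p * m))"
      using pos by (intro ennreal_mult) auto
    finally have "ennreal (1 / r) * ennreal (1 / (p * m)) \<le> ennreal (1 / n) * (ennreal (1 / (p * m)) + ennreal (1 / (r * m)))" .
    moreover have "- 1 < U \<and> U < c" using True by simp
    ultimately show ?thesis unfolding d w s using True by simp
  qed (auto simp: root_weight_def arcosh_deriv_def)
  then have "harish_chandra c \<le> (\<integral>\<^sup>+U. ennreal (1 / n) * (ennreal (arcosh_deriv U) * indicator {..<c} U + ennreal (if - 1 < U \<and> U < c then 1 / sqrt ((c - U) * (U - (- 1))) else 0)) \<partial>lborel)"
    unfolding harish_chandra_def by (intro nn_integral_mono) auto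
  also have "\<dots> = ennreal (1 / n) * (ennreal (arcosh c) + ennreal pi)"
    using nn_integral_arcosh_deriv[of c] nn_integral_arcsine[of "-1" c] c
    by (simp add: nn_integral_cmult nn_integral_add)
  also have "\<dots> = ennreal ((arcosh c + pi) / n)"
    using n c by (simp add: ennreal_plus[symmetric] ennreal_mult'[symmetric] del: ennreal_plus)
  finally show ?thesis by (simp add: n_def)
qed

text \<open>A convolution may be differentiated in either factor: the inverse Abel kernel applied to \<open>arcosh\<close> is the integral of
  the kernel applied to its derivative.\<close>

lemma nn_integral_root_weight_arcosh:
  "(\<integral>\<^sup>+U. ennreal (root_weight X U) * (\<integral>\<^sup>+c. ennreal (arcosh_deriv c) * indicator {..<U} c \<partial>lborel) \<partial>lborel)
    = (\<integral>\<^sup>+c. indicator {..<X} c * harish_chandra c \<partial>lborel)"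
proof -
  let ?v = "\<lambda>v. ennreal (if 0 < v then 1 / sqrt v else 0)"
  define G where "G U = (\<integral>\<^sup>+c. ennreal (arcosh_deriv c) * indicator {p. fst p < snd p} (c, U) \<partial>lborel)" for U :: real
  have [measurable]: "{p::real \<times> real. fst p < snd p} \<in> sets (borel \<Otimes>\<^sub>M borel)"
  proof -
    have "{p \<in> space (borel \<Otimes>\<^sub>M borel). fst p < (snd p :: real)} \<in> sets (borel \<Otimes>\<^sub>M borel)" by measurable
    then show ?thesis by (simp add: space_pair_measure)
  qed
  have G: "G U = (\<integral>\<^sup>+c. ennreal (arcosh_deriv c) * indicator {..<U} c \<partial>lborel)" for U
    unfolding G_def by (intro nn_integral_cong) (auto split: split_indicator)
  have [measurable]: "G \<in> borel_measurable borel" unfolding G_def[abs_def] by measurable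
  have "(\<integral>\<^sup>+U. ennreal (root_weight X U) * G U \<partial>lborel) = (\<integral>\<^sup>+v. ennreal (root_weight X (X - v)) * G (X - v) \<partial>lborel)"
    by (rule nn_integral_real_reflect[symmetric]) measurable
  also have "\<dots> = (\<integral>\<^sup>+v. \<integral>\<^sup>+c. ?v v * (ennreal (arcosh_deriv (c - v)) * indicator {..<X} c) \<partial>lborel \<partial>lborel)"
  proof (rule nn_integral_cong)
    fix v
    have "G (X - v) = (\<integral>\<^sup>+c. ennreal (arcosh_deriv (c + - v)) * indicator {..<X - v} (c + - v) \<partial>lborel)"
      unfolding G by (rule nn_integral_real_shift[symmetric]) measurable
    also have "\<dots> = (\<integral>\<^sup>+c. ennreal (arcosh_deriv (c - v)) * indicator {..<X} c \<partial>lborel)"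
      by (intro nn_integral_cong) (auto split: split_indicator)
    finally show "ennreal (root_weight X (X - v)) * G (X - v)
        = (\<integral>\<^sup>+c. ?v v * (ennreal (arcosh_deriv (c - v)) * indicator {..<X} c) \<partial>lborel)"
      by (subst nn_integral_cmult) (auto simp: root_weight_def)
  qed
  also have "\<dots> = (\<integral>\<^sup>+c. \<integral>\<^sup>+v. ?v v * (ennreal (arcosh_deriv (c - v)) * indicator {..<X} c) \<partial>lborel \<partial>lborel)"
    by (rule lborel_pair.Fubini') measurable
  also have "\<dots> = (\<integral>\<^sup>+c. indicator {..<X} c * harish_chandra c \<partial>lborel)"
  proof (rule nn_integral_cong)
    fix c
    have "harish_chandra c = (\<integral>\<^sup>+v. ennreal (root_weight c (c - v)) * ennreal (arcosh_deriv (c - v)) \<partial>lborel)"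
      unfolding harish_chandra_def by (rule nn_integral_real_reflect[symmetric]) measurable
    also have "\<dots> = (\<integral>\<^sup>+v. ?v v * ennreal (arcosh_deriv (c - v)) \<partial>lborel)"
      by (intro nn_integral_cong) (auto simp: root_weight_def)
    finally have "indicator {..<X} c * harish_chandra c = (\<integral>\<^sup>+v. indicator {..<X} c * (?v v * ennreal (arcosh_deriv (c - v))) \<partial>lborel)"
      by (simp add: nn_integral_cmult)
    then show "(\<integral>\<^sup>+v. ?v v * (ennreal (arcosh_deriv (c - v)) * indicator {..<X} c) \<partial>lborel) = indicator {..<X} c * harish_chandra c"
      by (simp only: mult.commute[of "indicator _ _"] mult.assoc)
  qed
  finally show ?thesis by (simp only: G)
qed

lemma abel_transform_eq_nn_integral:
  assumes [measurable]: "\<phi> \<in> borel_measurable borel" and B: "\<And>X. \<bar>\<phi> X\<bar> \<le> B"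
  shows "ennreal (abel_transform \<phi> U + B * (LINT c|lborel. abel_weight U c))
    = (\<integral>\<^sup>+c. ennreal (abel_weight U c) * ennreal (\<phi> c + B) \<partial>lborel)"
    and "0 \<le> abel_transform \<phi> U + B * (LINT c|lborel. abel_weight U c)"
proof -
  have nn: "0 \<le> \<phi> c + B" for c using B[of c] by (simp add: abs_le_iff)
  have eq: "abel_transform \<phi> U + B * (LINT c|lborel. abel_weight U c) = (LINT c|lborel. abel_weight U c * (\<phi> c + B))"
    unfolding abel_transform_def distrib_left
    using integrable_abel_weight_mult[OF assms(1) B] integrable_abel_weight
    by (subst Bochner_Integration.integral_add) (auto simp: mult.commute)
  have "integrable lborel (\<lambda>c. abel_weight U c * (\<phi> c + B))"
    unfolding distrib_left
    by (intro Bochner_Integration.integrable_add integrable_abel_weight_mult[OF assms(1) B] integrable_mult_left)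
      (rule integrable_abel_weight)
  then have "(\<integral>\<^sup>+c. ennreal (abel_weight U c * (\<phi> c + B)) \<partial>lborel) = ennreal (LINT c|lborel. abel_weight U c * (\<phi> c + B))"
    by (rule nn_integral_eq_integral) (auto simp: nn abel_weight_nonneg)
  then show "ennreal (abel_transform \<phi> U + B * (LINT c|lborel. abel_weight U c))
    = (\<integral>\<^sup>+c. ennreal (abel_weight U c) * ennreal (\<phi> c + B) \<partial>lborel)"
    by (simp add: eq ennreal_mult nn abel_weight_nonneg)
  show "0 \<le> abel_transform \<phi> U + B * (LINT c|lborel. abel_weight U c)"
    unfolding eq by (intro integral_nonneg_AE) (auto simp: nn abel_weight_nonneg)
qed

lemma nonneg_at_left_endpoint:
  fixes g :: "real \<Rightarrow> real"
  assumes cont: "continuous_on {X..} g" and int: "\<And>Y. Y > X \<Longrightarrow> 0 \<le> integral {X..Y} g"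
  shows "0 \<le> g X"
proof (rule ccontr)
  assume "\<not> 0 \<le> g X"
  then have neg: "g X < 0" by simp
  have "\<exists>d>0. \<forall>y\<in>{X..}. dist y X < d \<longrightarrow> dist (g y) (g X) < - g X / 2"
    using cont[unfolded continuous_on_iff, rule_format, of X "- g X / 2"] neg by auto
  then obtain d where d: "d > 0" "\<And>y. y \<in> {X..} \<Longrightarrow> dist y X < d \<Longrightarrow> dist (g y) (g X) < - g X / 2" by blast
  have le: "g y \<le> g X / 2" if "y \<in> {X..X + d/2}" for y
  proof -
    have "dist (g y) (g X) < - g X / 2" using that d(1) by (intro d(2)) (auto simp: dist_real_def)
    then show ?thesis by (simp add: dist_real_def abs_if split: if_splits)
  qed
  have "integral {X..X + d/2} g \<le> integral {X..X + d/2} (\<lambda>_. g X / 2)"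
    by (intro integral_le le integrable_continuous_real continuous_on_subset[OF cont]) auto
  also have "\<dots> = d/2 * (g X / 2)" using d(1) by simp
  also have "\<dots> < 0" using d(1) neg by (simp add: mult_pos_neg)
  finally show False using int[of "X + d/2"] d(1) by simp
qed

text \<open>Let \<open>s\<close> be the Abel transform of \<open>\<phi>\<close> as a function of \<open>v\<close>, with \<open>U = cosh v\<close>. The hypothesis on second differences makes
  \<open>\<tau> = s + q v\<close> non-decreasing, hence so is its convolution \<open>A\<close> with the inverse square
  root. By Abel inversion \<open>A X\<close> is \<open>\<pi> / sqrt 2\<close> times the integral of \<open>\<phi>\<close> over \<open>(1, X)\<close>
  plus \<open>q\<close> times the integral of \<open>harish_chandra\<close>. So the integral of
  \<open>\<phi> * \<pi> / sqrt 2 + q * harish_chandra\<close> over every interval \<open>(X, Y)\<close> is non-negative. Once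
  \<open>harish_chandra\<close> is replaced by its continuous upper bound, this yields the inequality at \<open>X = cosh r\<close>.\<close>

theorem abel_lower_bound:
  fixes \<phi> :: "real \<Rightarrow> real"
  assumes cont: "continuous_on UNIV \<phi>" and B: "\<And>X. \<bar>\<phi> X\<bar> \<le> B" and q: "\<And>X. \<phi> X \<le> q" "q \<ge> 0"
    and pos: "\<And>T h. 0 \<le> h \<Longrightarrow> h \<le> T \<Longrightarrow>
      0 \<le> integral {0..T + h} (\<lambda>v. abel_transform \<phi> (cosh v)) + integral {0..T - h} (\<lambda>v. abel_transform \<phi> (cosh v))
        - 2 * integral {0..T} (\<lambda>v. abel_transform \<phi> (cosh v)) + 2 * integral {0..h} (\<lambda>v. abel_transform \<phi> (cosh v))"
    and r: "r > 0"
  shows "\<phi> (cosh r) \<ge> - q * ((r / pi + 1) / sinh (r / 2))"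
proof -
  have [measurable]: "\<phi> \<in> borel_measurable borel" using cont by (rule borel_measurable_continuous_onI)
  have Bnn: "B \<ge> 0" using B[of 0] by linarith
  have nn: "0 \<le> \<phi> c + B" for c using B[of c] by (simp add: abs_le_iff)
  define s where "s v = abel_transform \<phi> (cosh v)" for v
  have s_cont: "continuous_on {0..} s"
    unfolding s_def
    by (rule continuous_on_compose2[OF continuous_abel_transform[OF cont B]])
      (auto intro!: continuous_intros cosh_real_ge_1)
  have s_mono: "s a + q * a \<le> s b + q * b" if "0 \<le> a" "a \<le> b" for a b
  proof (rule second_difference_monotone[OF s_cont q(2)])
    show "s v \<le> q * (2 * sinh (v/2))" if "v \<ge> 0" for v
      unfolding s_def by (rule abel_transform_upper_bound[OF _ B q(1) that]) measurable
  qed (use pos that in \<open>auto simp: s_def[abs_def]\<close>)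
  define \<tau> where "\<tau> U = (if U \<ge> 1 then abel_transform \<phi> U + q * arcosh U else 0)" for U
  have \<tau>_eq: "\<tau> U = s (arcosh U) + q * arcosh U" if "U \<ge> 1" for U
    using that by (simp add: \<tau>_def s_def)
  have "abel_weight 1 X = 0" for X by (simp add: abel_weight_def)
  then have "\<tau> 1 = 0" by (simp add: \<tau>_def abel_transform_def)
  have arm: "arcosh U \<le> arcosh V" if "1 \<le> U" "U \<le> V" for U V :: real
    using that by (cases "U = V") (auto intro!: less_imp_le[OF arcosh_real_strict_mono])
  have \<tau>_mono1: "\<tau> U \<le> \<tau> V" if "1 \<le> U" "U \<le> V" for U V
    using that arm[OF that] s_mono[of "arcosh U" "arcosh V"] by (simp add: \<tau>_eq)
  have \<tau>_nn: "\<tau> U \<ge> 0" for U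
    using \<tau>_mono1[of 1 U] \<open>\<tau> 1 = 0\<close> by (cases "U \<ge> 1") (auto simp: \<tau>_def)
  have \<tau>_mono: "\<tau> U \<le> \<tau> V" if "U \<le> V" for U V
    using that \<tau>_mono1[of U V] \<tau>_nn[of V] by (cases "U \<ge> 1") (auto simp: \<tau>_def)
  have [measurable]: "\<tau> \<in> borel_measurable borel"
    using \<tau>_mono by (intro borel_measurable_mono) (auto simp: mono_def)
  define K where "K = pi / sqrt 2"
  have K: "K > 0" by (simp add: K_def)
  (* \<tau> was set to 0 below 1, so that it is monotone on the whole line *)
  define A where "A X = (\<integral>\<^sup>+U. ennreal (root_weight X U) * ennreal (\<tau> U) \<partial>lborel)" for X
  have A_mono: "A X \<le> A Y" if "X \<le> Y" for X Y
  proof -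
    have "A Z = (\<integral>\<^sup>+v. ennreal (root_weight 0 (0 - v)) * ennreal (\<tau> (Z - v)) \<partial>lborel)" for Z
    proof -
      have "A Z = (\<integral>\<^sup>+v. ennreal (root_weight Z (Z - v)) * ennreal (\<tau> (Z - v)) \<partial>lborel)"
        unfolding A_def by (rule nn_integral_real_reflect[symmetric]) measurable
      moreover have "root_weight Z (Z - v) = root_weight 0 (0 - v)" for v
        unfolding root_weight_def by simp
      ultimately show ?thesis by (simp only:)
    qed
    then show ?thesis using that \<tau>_mono
      by (auto intro!: nn_integral_mono mult_left_mono ennreal_leI)
  qed
  (* \<phi> changes sign; adding B makes all integrands non-negative, and the terms in B cancel at the end *)
  define \<Phi> where "\<Phi> X = (\<integral>\<^sup>+c. indicator {1<..<X} c * ennreal (\<phi> c + B) \<partial>lborel)" for X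
  define \<Psi> where "\<Psi> X = (\<integral>\<^sup>+c. indicator {..<X} c * harish_chandra c \<partial>lborel)" for X
  have A_eq: "A X + ennreal K * ennreal (B * (X - 1)) = ennreal K * \<Phi> X + ennreal q * \<Psi> X" if X: "X > 1" for X
  proof -
    have BX: "ennreal (B * (X - 1)) = (\<integral>\<^sup>+c. indicator {1<..<X} c * ennreal B \<partial>lborel)"
      unfolding mult.commute[of "indicator _ _"]
      using X Bnn by (subst nn_integral_cmult_indicator) (auto simp: ennreal_mult')
    have pt: "ennreal (\<tau> U) + (\<integral>\<^sup>+c. ennreal (abel_weight U c) * ennreal B \<partial>lborel)
        = (\<integral>\<^sup>+c. ennreal (abel_weight U c) * ennreal (\<phi> c + B) \<partial>lborel)
          + ennreal q * (\<integral>\<^sup>+c. ennreal (arcosh_deriv c) * indicator {..<U} c \<partial>lborel)" for U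
    proof (cases "U \<ge> 1")
      case True
      have "(\<integral>\<^sup>+c. ennreal (abel_weight U c) * ennreal B \<partial>lborel) = ennreal (B * (LINT c|lborel. abel_weight U c))"
      proof -
        have "(\<integral>\<^sup>+c. ennreal (abel_weight U c) \<partial>lborel) = ennreal (LINT c|lborel. abel_weight U c)"
          by (rule nn_integral_eq_integral[OF integrable_abel_weight]) (auto simp: abel_weight_nonneg)
        then show ?thesis using Bnn by (subst nn_integral_multc) (auto simp: ennreal_mult' mult.commute)
      qed
      then have "ennreal (\<tau> U) + (\<integral>\<^sup>+c. ennreal (abel_weight U c) * ennreal B \<partial>lborel)
          = ennreal (\<tau> U) + ennreal (B * (LINT c|lborel. abel_weight U c))" by (simp only:)
      also have "\<dots> = ennreal (\<tau> U + B * (LINT c|lborel. abel_weight U c))"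
      proof (rule ennreal_plus[symmetric, OF \<tau>_nn])
        have "0 \<le> (LINT c|lborel. abel_weight U c)"
          by (intro integral_nonneg_AE) (auto simp: abel_weight_nonneg)
        then show "0 \<le> B * (LINT c|lborel. abel_weight U c)" using Bnn by simp
      qed
      also have "\<tau> U + B * (LINT c|lborel. abel_weight U c)
          = (abel_transform \<phi> U + B * (LINT c|lborel. abel_weight U c)) + q * arcosh U"
        using True by (simp add: \<tau>_def)
      also have "ennreal \<dots> = ennreal (abel_transform \<phi> U + B * (LINT c|lborel. abel_weight U c)) + ennreal (q * arcosh U)"
        using True q(2) by (intro ennreal_plus abel_transform_eq_nn_integral(2)[OF _ B]) auto
      also have "ennreal (q * arcosh U) = ennreal q * (\<integral>\<^sup>+c. ennreal (arcosh_deriv c) * indicator {..<U} c \<partial>lborel)"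
        using True q(2) by (simp add: nn_integral_arcosh_deriv ennreal_mult')
      finally show ?thesis by (subst (asm) abel_transform_eq_nn_integral(1)[OF _ B]) auto
    next
      case False
      then have "abel_weight U c = 0" "ennreal (arcosh_deriv c) * indicator {..<U} c = 0" for c
        by (auto simp: abel_weight_def arcosh_deriv_def split: split_indicator)
      then show ?thesis using False by (simp only: \<tau>_def) simp
    qed
    have [measurable]: "(\<lambda>U. \<integral>\<^sup>+c. ennreal (arcosh_deriv c) * indicator {..<U} c \<partial>lborel) \<in> borel_measurable borel"
    proof -
      have "(\<lambda>U. \<integral>\<^sup>+c. ennreal (arcosh_deriv c) * indicator {..<U} c \<partial>lborel) = (\<lambda>U. ennreal (if U \<ge> 1 then arcosh U else 0))"
      proof
        fix U
        show "(\<integral>\<^sup>+c. ennreal (arcosh_deriv c) * indicator {..<U} c \<partial>lborel) = ennreal (if U \<ge> 1 then arcosh U else 0)"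
        proof (cases "U \<ge> 1")
          case False
          then have "ennreal (arcosh_deriv c) * indicator {..<U} c = 0" for c
            by (auto simp: arcosh_deriv_def split: split_indicator)
          then show ?thesis using False by (simp only: nn_integral_const) simp
        qed (simp add: nn_integral_arcosh_deriv)
      qed
      also have "\<dots> \<in> borel_measurable borel"
      proof -
        have "(\<lambda>U::real. if U \<ge> 1 then arcosh U else 0) \<in> borel_measurable borel"
          by (rule borel_measurable_mono) (auto simp: mono_def intro: arm)
        then show ?thesis by measurable
      qed
      finally show ?thesis .
    qed
    have "A X + ennreal K * ennreal (B * (X - 1))
        = (\<integral>\<^sup>+U. ennreal (root_weight X U) * (ennreal (\<tau> U) + (\<integral>\<^sup>+c. ennreal (abel_weight U c) * ennreal B \<partial>lborel)) \<partial>lborel)"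
      unfolding A_def BX K_def abel_inversion[OF borel_measurable_const, symmetric] distrib_left
      by (rule nn_integral_add[symmetric]) measurable
    also have "\<dots> = (\<integral>\<^sup>+U. ennreal (root_weight X U) * (\<integral>\<^sup>+c. ennreal (abel_weight U c) * ennreal (\<phi> c + B) \<partial>lborel) \<partial>lborel)
        + (\<integral>\<^sup>+U. ennreal q * (ennreal (root_weight X U) * (\<integral>\<^sup>+c. ennreal (arcosh_deriv c) * indicator {..<U} c \<partial>lborel)) \<partial>lborel)"
      unfolding pt distrib_left mult.left_commute[of _ "ennreal q"] by (rule nn_integral_add) measurable
    also have "\<dots> = ennreal K * \<Phi> X + ennreal q * \<Psi> X"
      by (simp add: nn_integral_cmult abel_inversion nn_integral_root_weight_arcosh \<Phi>_def \<Psi>_def K_def)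
    finally show ?thesis .
  qed
  define b where "b c = (arcosh c + pi) / sqrt (c - 1)" for c
  define X where "X = cosh r"
  have X: "X > 1" using r cosh_real_nonneg_less_iff[of 0 r] by (simp add: X_def)
  define g where "g c = K * \<phi> c + q * b c" for c
  have bcont: "continuous_on {X..} b"
    unfolding b_def using X by (intro continuous_intros) auto
  have gcont: "continuous_on {X..} g"
    unfolding g_def by (intro continuous_intros bcont continuous_on_subset[OF cont]) auto
  have bnn: "b c \<ge> 0" if "c \<ge> X" for c
    using that X by (simp add: b_def)
  have "0 \<le> g X"
  proof (rule nonneg_at_left_endpoint[OF gcont])
    fix Y assume Y: "Y > X"
    have \<Phi>_split: "\<Phi> Y = \<Phi> X + (\<integral>\<^sup>+c. ennreal (\<phi> c + B) * indicator {X..<Y} c \<partial>lborel)"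
      unfolding \<Phi>_def using X Y
      by (subst nn_integral_add[symmetric]) (auto intro!: nn_integral_cong split: split_indicator)
    have \<Psi>_split: "\<Psi> Y = \<Psi> X + (\<integral>\<^sup>+c. harish_chandra c * indicator {X..<Y} c \<partial>lborel)"
      unfolding \<Psi>_def using Y
      by (subst nn_integral_add[symmetric]) (auto intro!: nn_integral_cong split: split_indicator)
    have \<Phi>_fin: "\<Phi> X < \<infinity>"
    proof -
      have "\<phi> c + B \<le> 2 * B" for c using B[of c] by (simp add: abs_le_iff)
      then have "\<Phi> X \<le> (\<integral>\<^sup>+c. ennreal (2 * B) * indicator {1<..<X} c \<partial>lborel)"
        unfolding \<Phi>_def by (intro nn_integral_mono) (auto split: split_indicator intro: ennreal_leI)
      also have "\<dots> < \<infinity>" by (simp add: nn_integral_cmult emeasure_lborel_Ioo' ennreal_mult_less_top)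
      finally show ?thesis .
    qed
    have \<Psi>_fin: "\<Psi> X < \<infinity>"
    proof -
      have "ennreal (root_weight X U) * (\<integral>\<^sup>+c. ennreal (arcosh_deriv c) * indicator {..<U} c \<partial>lborel)
          \<le> ennreal (sqrt 2 * arcosh X) * ennreal (abel_weight X U)" for U
      proof (cases "1 < U \<and> U < X")
        case True
        have "ennreal (root_weight X U) * ennreal (arcosh U) \<le> ennreal (root_weight X U) * ennreal (arcosh X)"
          using True arm[of U X] by (intro mult_left_mono ennreal_leI) auto
        also have "\<dots> = ennreal (sqrt 2 * arcosh X) * ennreal (abel_weight X U)"
        proof -
          have "root_weight X U * arcosh X = sqrt 2 * arcosh X * abel_weight X U"
            using True unfolding root_weight_def abel_weight_def real_sqrt_mult by simp
          then show ?thesis using X by (subst (1 2) ennreal_mult[symmetric]) (auto simp: root_weight_nonneg abel_weight_nonneg)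
        qed
        finally show ?thesis using True by (simp add: nn_integral_arcosh_deriv)
      next
        case False
        show ?thesis
        proof (cases "U < X")
          case True
          then have "ennreal (arcosh_deriv c) * indicator {..<U} c = 0" for c
            using False by (auto simp: arcosh_deriv_def split: split_indicator)
          then show ?thesis by (simp only: nn_integral_const) simp
        qed (simp add: root_weight_def)
      qed
      then have "\<Psi> X \<le> (\<integral>\<^sup>+U. ennreal (sqrt 2 * arcosh X) * ennreal (abel_weight X U) \<partial>lborel)"
        unfolding \<Psi>_def nn_integral_root_weight_arcosh[symmetric] by (intro nn_integral_mono)
      also have "\<dots> < \<infinity>" using abel_mass_finite[of X] by (simp add: nn_integral_cmult abel_mass_def ennreal_mult_less_top)
      finally show ?thesis .
    qed
    (* M is the contribution of (1, X); being finite, it cancels from the inequality A X \<le> A Y *)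
    define M where "M = ennreal K * \<Phi> X + ennreal q * \<Psi> X"
    have M: "M < \<infinity>" using \<Phi>_fin \<Psi>_fin by (simp add: M_def ennreal_mult_less_top)
    have intb: "(\<integral>\<^sup>+c. ennreal (\<phi> c + B) * indicator {X..<Y} c \<partial>lborel) = ennreal (integral {X..Y} (\<lambda>c. \<phi> c + B))"
    proof -
      have "(\<integral>\<^sup>+c. ennreal (\<phi> c + B) * indicator {X..<Y} c \<partial>lborel) = (\<integral>\<^sup>+c. ennreal (\<phi> c + B) * indicator {X..Y} c \<partial>lborel)"
        by (rule nn_integral_cong_AE, use AE_lborel_singleton[of Y] in eventually_elim) (auto split: split_indicator)
      also have "\<dots> = ennreal (integral {X..Y} (\<lambda>c. \<phi> c + B))"
        by (rule nn_integral_has_integral_lebesgue'[OF _ integrable_integral])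
          (auto simp: nn intro!: integrable_continuous_real continuous_intros continuous_on_subset[OF cont])
      finally show ?thesis .
    qed
    have inth: "(\<integral>\<^sup>+c. harish_chandra c * indicator {X..<Y} c \<partial>lborel) \<le> ennreal (integral {X..Y} b)"
    proof -
      have "(\<integral>\<^sup>+c. harish_chandra c * indicator {X..<Y} c \<partial>lborel) \<le> (\<integral>\<^sup>+c. ennreal (b c) * indicator {X..Y} c \<partial>lborel)"
        using X harish_chandra_bound by (intro nn_integral_mono) (auto split: split_indicator simp: b_def)
      also have "\<dots> = ennreal (integral {X..Y} b)"
        by (rule nn_integral_has_integral_lebesgue'[OF _ integrable_integral])
          (auto simp: bnn intro!: integrable_continuous_real continuous_on_subset[OF bcont])
      finally show ?thesis .
    qed
    have 1: "ennreal K * ennreal (B * (Y - 1)) + M \<le> ennreal K * ennreal (B * (X - 1)) + (ennreal K * \<Phi> Y + ennreal q * \<Psi> Y)"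
    proof -
      have "ennreal K * ennreal (B * (Y - 1)) + M = ennreal K * ennreal (B * (Y - 1)) + (A X + ennreal K * ennreal (B * (X - 1)))"
        using A_eq[OF X] by (simp add: M_def)
      also have "\<dots> \<le> ennreal K * ennreal (B * (Y - 1)) + (A Y + ennreal K * ennreal (B * (X - 1)))"
        using A_mono[of X Y] Y by (intro add_left_mono add_right_mono) auto
      also have "\<dots> = ennreal K * ennreal (B * (X - 1)) + (A Y + ennreal K * ennreal (B * (Y - 1)))"
        by (simp only: add.commute add.left_commute)
      finally show ?thesis using A_eq[of Y] X Y by simp
    qed
    have 2: "ennreal K * \<Phi> Y + ennreal q * \<Psi> Y
        \<le> M + (ennreal K * ennreal (integral {X..Y} (\<lambda>c. \<phi> c + B)) + ennreal q * ennreal (integral {X..Y} b))"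
    proof -
      have "ennreal K * \<Phi> Y + ennreal q * \<Psi> Y = M + (ennreal K * ennreal (integral {X..Y} (\<lambda>c. \<phi> c + B))
          + ennreal q * (\<integral>\<^sup>+c. harish_chandra c * indicator {X..<Y} c \<partial>lborel))"
        unfolding \<Phi>_split \<Psi>_split intb M_def distrib_left by (simp only: add.assoc add.commute add.left_commute)
      also have "\<dots> \<le> M + (ennreal K * ennreal (integral {X..Y} (\<lambda>c. \<phi> c + B)) + ennreal q * ennreal (integral {X..Y} b))"
        by (intro add_left_mono mult_left_mono inth) auto
      finally show ?thesis .
    qed
    from order_trans[OF 1 add_left_mono[OF 2]]
    have "M + ennreal K * ennreal (B * (Y - 1)) \<le> M + (ennreal K * ennreal (B * (X - 1))
        + (ennreal K * ennreal (integral {X..Y} (\<lambda>c. \<phi> c + B)) + ennreal q * ennreal (integral {X..Y} b)))"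
      by (simp only: add.assoc add.commute add.left_commute)
    then have "ennreal K * ennreal (B * (Y - 1)) \<le> ennreal K * ennreal (B * (X - 1))
        + (ennreal K * ennreal (integral {X..Y} (\<lambda>c. \<phi> c + B)) + ennreal q * ennreal (integral {X..Y} b))"
      using M by (auto simp: ennreal_add_left_cancel_le)
    moreover have i1: "0 \<le> integral {X..Y} (\<lambda>c. \<phi> c + B)"
      by (intro integral_nonneg integrable_continuous_real continuous_intros continuous_on_subset[OF cont]) (auto simp: nn)
    moreover have i2: "0 \<le> integral {X..Y} b"
      by (intro integral_nonneg integrable_continuous_real continuous_on_subset[OF bcont]) (auto simp: bnn)
    ultimately have "ennreal (K * (B * (Y - 1))) \<le> ennreal (K * (B * (X - 1)) + (K * integral {X..Y} (\<lambda>c. \<phi> c + B) + q * integral {X..Y} b))"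
      using K q(2) Bnn X Y by (simp add: ennreal_mult'[symmetric] ennreal_plus[symmetric] del: ennreal_plus)
    then have main: "K * (B * (Y - 1)) \<le> K * (B * (X - 1)) + (K * integral {X..Y} (\<lambda>c. \<phi> c + B) + q * integral {X..Y} b)"
      using K q(2) Bnn X i1 i2 by (subst (asm) ennreal_le_iff) auto
    have "integral {X..Y} (\<lambda>c. \<phi> c + B) = integral {X..Y} \<phi> + B * (Y - X)"
      using Y by (subst integral_add) (auto intro!: integrable_continuous_real continuous_on_subset[OF cont])
    from main[unfolded this] have "0 \<le> K * integral {X..Y} \<phi> + q * integral {X..Y} b"
      by (simp add: algebra_simps)
    moreover have "integral {X..Y} g = K * integral {X..Y} \<phi> + q * integral {X..Y} b"
      unfolding g_def
      by (subst integral_add) (auto intro!: integrable_continuous_real continuous_intros continuous_on_subset[OF cont] continuous_on_subset[OF bcont])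
    ultimately show "0 \<le> integral {X..Y} g" by simp
  qed
  then have "K * \<phi> X \<ge> - (q * b X)" by (simp add: g_def)
  moreover have "b X = K * ((r / pi + 1) / sinh (r/2))"
  proof -
    have "X - 1 = 2 * (sinh (r/2))\<^sup>2"
      using cosh_double[of "r/2"] cosh_square_eq[of "r/2"] by (simp add: X_def)
    then have "sqrt (X - 1) = sqrt 2 * sinh (r/2)" using r by (simp add: real_sqrt_mult)
    then show ?thesis using r by (simp add: b_def X_def K_def arcosh_cosh_real divide_simps)
  qed
  ultimately have "K * \<phi> X \<ge> K * (- q * ((r / pi + 1) / sinh (r/2)))" by (simp add: mult.left_commute)
  then have "\<phi> X \<ge> - q * ((r / pi + 1) / sinh (r/2))" by (rule mult_left_le_imp_le[OF _ K])
  then show ?thesis by (simp only: X_def)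
qed

section \<open>Continuity in the radius\<close>

lemma compact_finite_hyp_area:
  assumes W: "compact W" "W \<subseteq> upper_half_plane"
  shows "(\<integral>\<^sup>+z. indicator W z \<partial>hyp_area) < \<infinity>"
proof (cases "W = {}")
  case False
  have [measurable]: "W \<in> sets borel" using W(1) by (simp add: borel_compact)
  have "continuous_on W (\<lambda>z. 1 / (Im z)\<^sup>2)"
    using W(2) by (intro continuous_intros) (auto simp: upper_half_plane_def)
  then obtain w where w: "w \<in> W" "\<And>z. z \<in> W \<Longrightarrow> 1 / (Im z)\<^sup>2 \<le> 1 / (Im w)\<^sup>2"
    using continuous_attains_sup[OF W(1) False] by blast
  have "(\<integral>\<^sup>+z. indicator W z \<partial>hyp_area) \<le> (\<integral>\<^sup>+z. ennreal (1 / (Im w)\<^sup>2) * indicator W z \<partial>lborel)"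
    by (subst nn_integral_hyp_area_lborel, simp, rule nn_integral_mono)
      (auto split: split_indicator intro!: ennreal_leI w(2))
  also have "\<dots> = ennreal (1 / (Im w)\<^sup>2) * emeasure lborel W"
    by (rule nn_integral_cmult_indicator) simp
  also have "\<dots> < \<infinity>" using emeasure_compact_finite[OF W(1)] by (simp add: ennreal_mult_less_top)
  finally show ?thesis .
qed simp

text \<open>The functions \<open>max 0 (1 - n * infdist z K)\<close>, suitably scaled, decrease to the indicator function of \<open>K\<close> and vanish
  off a compact neighbourhood of \<open>K\<close>.\<close>

lemma bump_function:
  assumes K: "compact K" "K \<subseteq> upper_half_plane" and e: "e > 0"
  obtains g :: "complex \<Rightarrow> real" and W where "continuous_on UNIV g" "\<And>z. 0 \<le> g z" "\<And>z. g z \<le> 1"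
    "\<And>z. z \<in> K \<Longrightarrow> g z = 1" "compact W" "W \<subseteq> upper_half_plane" "\<And>z. z \<notin> W \<Longrightarrow> g z = 0"
    "(\<integral>\<^sup>+z. ennreal (g z) * indicator (- K) z \<partial>hyp_area) \<le> ennreal e"
proof (cases "K = {}")
  case True
  then show thesis using that[of "\<lambda>_. 0" "{}"] by auto
next
  case False
  have [measurable]: "K \<in> sets borel" using K(1) by (simp add: borel_compact)
  obtain d where d: "d > 0" "(\<Union>x\<in>K. cball x d) \<subseteq> upper_half_plane"
    using compact_subset_open_imp_cball_epsilon_subset[OF K(1) open_upper_half_plane K(2)] by blast
  define W where "W = {z. infdist z K \<le> d}"
  have W: "compact W" unfolding W_def by (rule compact_infdist_le[OF False K(1) d(1)])
  have WH: "W \<subseteq> upper_half_plane"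
  proof
    fix z assume "z \<in> W"
    moreover obtain x where "x \<in> K" "infdist z K = dist z x"
      using infdist_attains_inf[OF compact_imp_closed[OF K(1)] False] by blast
    ultimately have "z \<in> cball x d" by (simp add: W_def dist_commute)
    then show "z \<in> upper_half_plane" using d(2) \<open>x \<in> K\<close> by blast
  qed
  define g where "g n z = max 0 (1 - real (Suc n) / d * infdist z K)" for n z
  have g_cont: "continuous_on UNIV (g n)" for n
    unfolding g_def by (intro continuous_intros)
  have [measurable]: "g n \<in> borel_measurable borel" for n
    using g_cont by (rule borel_measurable_continuous_onI)
  have g01: "0 \<le> g n z" "g n z \<le> 1" for n z
    using d(1) infdist_nonneg[of z K] by (auto simp: g_def)
  have gK: "g n z = 1" if "z \<in> K" for n z using that by (simp add: g_def)
  have gW: "g n z = 0" if "z \<notin> W" for n z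
  proof -
    have "1 \<le> infdist z K / d" using that d(1) by (simp add: W_def field_simps)
    also have "\<dots> \<le> real (Suc n) * (infdist z K / d)"
      using d(1) infdist_nonneg[of z K] mult_right_mono[of 1 "real (Suc n)" "infdist z K / d"] by simp
    finally show ?thesis by (simp add: g_def)
  qed
  have "(\<lambda>n. \<integral>\<^sup>+z. ennreal (g n z) * indicator (- K) z \<partial>hyp_area) \<longlonglongrightarrow> (\<integral>\<^sup>+z. 0 \<partial>hyp_area)"
  proof (rule nn_integral_dominated_convergence[where w="indicator W"])
    show "(\<integral>\<^sup>+z. indicator W z \<partial>hyp_area) < \<infinity>" by (rule compact_finite_hyp_area[OF W WH])
    show "indicator W \<in> borel_measurable hyp_area"
      using borel_compact[OF W] by (intro measurable_hyp_area) simp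
    show "(\<lambda>z. ennreal (g n z) * indicator (- K) z) \<in> borel_measurable hyp_area" for n
      by (intro measurable_hyp_area) measurable
    show "AE z in hyp_area. ennreal (g n z) * indicator (- K) z \<le> indicator W z" for n
      using g01(2)[of n] gW[of _ n] by (intro AE_I2) (auto split: split_indicator simp: ennreal_le_1)
    show "AE z in hyp_area. (\<lambda>n. ennreal (g n z) * indicator (- K) z) \<longlonglongrightarrow> 0"
    proof (intro AE_I2)
      fix z
      show "(\<lambda>n. ennreal (g n z) * indicator (- K) z) \<longlonglongrightarrow> 0"
      proof (cases "z \<in> K")
        case False
        then have pos: "infdist z K > 0"
          using infdist_pos_not_in_closed[OF compact_imp_closed[OF K(1)] \<open>K \<noteq> {}\<close>] by blast
        obtain N where N: "d / infdist z K < real N" using reals_Archimedean2 by blast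
        have "g n z = 0" if "n \<ge> N" for n
        proof -
          have "d / infdist z K \<le> real (Suc n)" using N that by linarith
          then have "1 \<le> real (Suc n) / d * infdist z K" using pos d(1) by (simp add: field_simps)
          then show ?thesis by (simp add: g_def)
        qed
        then have "eventually (\<lambda>n. ennreal (g n z) * indicator (- K) z = 0) sequentially"
          unfolding eventually_sequentially by (intro exI[of _ N]) simp
        then show ?thesis by (rule tendsto_eventually)
      qed simp
    qed
  qed auto
  then have "eventually (\<lambda>n. (\<integral>\<^sup>+z. ennreal (g n z) * indicator (- K) z \<partial>hyp_area) < ennreal e) sequentially"
    using e by (intro order_tendstoD(2)[of _ 0]) auto
  then obtain n where "(\<integral>\<^sup>+z. ennreal (g n z) * indicator (- K) z \<partial>hyp_area) < ennreal e"
    by (auto simp: eventually_sequentially)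
  then show thesis
    using that[of "g n" W] g_cont g01 gK W WH gW by (simp add: less_imp_le)
qed

text \<open>By inner regularity a compact \<open>K \<subseteq> E\<close> carries all but \<open>e/2\<close> of the area of \<open>E\<close>, and a bump function
  around \<open>K\<close> spreads over at most \<open>e/2\<close> more.\<close>

lemma continuous_L1_approximation:
  assumes [measurable]: "E \<in> sets borel" and fin: "(\<integral>\<^sup>+z. indicator E z \<partial>hyp_area) < \<infinity>" and E: "E \<subseteq> upper_half_plane"
    and e: "e > 0"
  obtains g :: "complex \<Rightarrow> real" and W where "continuous_on UNIV g" "\<And>z. 0 \<le> g z" "\<And>z. g z \<le> 1"
    "compact W" "W \<subseteq> upper_half_plane" "\<And>z. z \<notin> W \<Longrightarrow> g z = 0"
    "(\<integral>\<^sup>+z. ennreal \<bar>indicator E z - g z\<bar> \<partial>hyp_area) \<le> ennreal e"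
proof -
  (* inner regularity needs a finite measure on a complete space: the area on E, seen in the whole plane *)
  define M where "M = density lborel (\<lambda>z. ennreal (1 / (Im z)\<^sup>2) * indicator E z)"
  have sM: "sets M = sets borel" by (simp add: M_def)
  have M: "emeasure M A = (\<integral>\<^sup>+z. indicator (A \<inter> E) z \<partial>hyp_area)" if [measurable]: "A \<in> sets borel" for A
    unfolding M_def using E
    by (subst emeasure_density, simp, simp, subst nn_integral_hyp_area_lborel, simp)
      (auto intro!: nn_integral_cong split: split_indicator)
  have finM: "emeasure M (space M) \<noteq> \<infinity>"
    using fin M[of UNIV] by (simp add: M_def less_top[symmetric])
  have ME: "emeasure M E < \<infinity>" using fin M[of E] by simp
  obtain K where K: "K \<subseteq> E" "compact K" "emeasure M E \<le> emeasure M K + ennreal (e/2)"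
  proof (cases "emeasure M E \<le> ennreal (e/2)")
    case True
    then show thesis using that[of "{}"] by simp
  next
    case False
    have "emeasure M E - ennreal (e/2) < emeasure M E"
      using ME False e by (intro ennreal_between) (auto simp: not_le zero_less_iff_neq_zero)
    also have "\<dots> = (SUP K \<in> {K. K \<subseteq> E \<and> compact K}. emeasure M K)"
      by (rule inner_regular[OF sM finM]) measurable
    finally obtain K where K: "K \<subseteq> E" "compact K" "emeasure M E - ennreal (e/2) < emeasure M K"
      by (auto simp: less_SUP_iff)
    then have "emeasure M E \<le> emeasure M K + ennreal (e/2)"
      by (metis add.commute ennreal_minus_le_iff less_imp_le)
    with K that show thesis by blast
  qed
  have [measurable]: "K \<in> sets borel" using K(2) by (simp add: borel_compact)
  have KE: "K \<inter> E = K" using K(1) by auto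
  have K_fin: "(\<integral>\<^sup>+z. indicator K z \<partial>hyp_area) < \<infinity>" using K(1) E by (intro compact_finite_hyp_area K(2)) auto
  have EK: "(\<integral>\<^sup>+z. indicator (E - K) z \<partial>hyp_area) \<le> ennreal (e/2)"
  proof -
    have "(\<integral>\<^sup>+z. indicator E z \<partial>hyp_area) = (\<integral>\<^sup>+z. indicator K z + indicator (E - K) z \<partial>hyp_area)"
      using K(1) by (intro nn_integral_cong) (auto split: split_indicator)
    also have "\<dots> = (\<integral>\<^sup>+z. indicator K z \<partial>hyp_area) + (\<integral>\<^sup>+z. indicator (E - K) z \<partial>hyp_area)"
      by (intro nn_integral_add measurable_hyp_area) auto
    finally have "(\<integral>\<^sup>+z. indicator K z \<partial>hyp_area) + (\<integral>\<^sup>+z. indicator (E - K) z \<partial>hyp_area)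
        \<le> (\<integral>\<^sup>+z. indicator K z \<partial>hyp_area) + ennreal (e/2)"
      using K(3) M[of E] M[of K] by (simp add: KE)
    then show ?thesis using K_fin by (auto simp: ennreal_add_left_cancel_le)
  qed
  have KH: "K \<subseteq> upper_half_plane" and e2: "e/2 > 0" using K(1) E e by auto
  obtain g W where g: "continuous_on UNIV g" "\<And>z. 0 \<le> g z" "\<And>z. g z \<le> 1"
    "\<And>z. z \<in> K \<Longrightarrow> g z = 1" "compact W" "W \<subseteq> upper_half_plane" "\<And>z. z \<notin> W \<Longrightarrow> g z = 0"
    "(\<integral>\<^sup>+z. ennreal (g z) * indicator (- K) z \<partial>hyp_area) \<le> ennreal (e/2)"
    by (rule bump_function[OF K(2) KH e2]) (rule that)
  have [measurable]: "g \<in> borel_measurable borel" using g(1) by (rule borel_measurable_continuous_onI)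
  have "(\<integral>\<^sup>+z. ennreal \<bar>indicator E z - g z\<bar> \<partial>hyp_area)
      \<le> (\<integral>\<^sup>+z. indicator (E - K) z + ennreal (g z) * indicator (- K) z \<partial>hyp_area)"
  proof (rule nn_integral_mono)
    fix z
    have "\<bar>1 - g z\<bar> \<le> 1" using g(2,3)[of z] by simp
    then have "ennreal \<bar>1 - g z\<bar> \<le> 1 + ennreal (g z)"
      using ennreal_leI[of "\<bar>1 - g z\<bar>" 1] by (simp add: add_increasing2)
    then show "ennreal \<bar>indicator E z - g z\<bar> \<le> indicator (E - K) z + ennreal (g z) * indicator (- K) z"
      using g(2)[of z] g(4)[of z] K(1) by (cases "z \<in> K"; cases "z \<in> E") auto
  qed
  also have "\<dots> = (\<integral>\<^sup>+z. indicator (E - K) z \<partial>hyp_area) + (\<integral>\<^sup>+z. ennreal (g z) * indicator (- K) z \<partial>hyp_area)"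
    by (intro nn_integral_add measurable_hyp_area) measurable
  also have "\<dots> \<le> ennreal (e/2) + ennreal (e/2)" by (intro add_mono EK g(8))
  also have "\<dots> = ennreal e" using e by (simp add: ennreal_plus[symmetric] del: ennreal_plus)
  finally show thesis using that g by blast
qed

lemma continuous_circle_point: "continuous_on ({1..} \<times> UNIV) (\<lambda>(X, t). circle_point X t)"
proof -
  have "X - sqrt (X\<^sup>2 - 1) * cos t \<noteq> 0" if "X \<ge> 1" for X t
    using circle_denominator_pos[OF that, of t] by simp
  then show ?thesis
    unfolding circle_point_def split_beta' by (intro continuous_intros) auto
qed

text \<open>The image of \<open>\<i>\<close> under the inverse of \<open>affine_move p\<close>.\<close>

definition affine_inverse :: "complex \<Rightarrow> complex" where
  "affine_inverse p = Complex (- Re p / Im p) (1 / Im p)"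

lemma affine_move_inverse: "Im p > 0 \<Longrightarrow> affine_move (affine_move z p) (affine_inverse p) = z"
  by (simp add: affine_move_def affine_inverse_def complex_eq_iff)

text \<open>For radii in a compact interval all circle means of \<open>g\<close> are supported in one compact set \<open>V\<close>, the set of
  centres of such circles through a point of \<open>W\<close>; this gives the dominating function.\<close>

lemma continuous_circle_mean_compact_support:
  fixes g :: "complex \<Rightarrow> real"
  assumes g: "continuous_on UNIV g" "\<And>z. 0 \<le> g z" "\<And>z. g z \<le> 1"
    and W: "compact W" "W \<subseteq> upper_half_plane" "\<And>z. z \<notin> W \<Longrightarrow> g z = 0"
    and [measurable]: "S \<in> sets borel"
  shows "continuous_on {1..} (\<lambda>X. enn2real (\<integral>\<^sup>+z. indicator S z * circle_mean X (\<lambda>w. ennreal (g w)) z \<partial>hyp_area))"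
proof (rule continuous_on_sequentiallyI)
  fix u :: "nat \<Rightarrow> real" and a assume u: "\<forall>n. u n \<in> {1..}" and a: "a \<in> {1..}" and lim: "u \<longlonglongrightarrow> a"
  have [measurable]: "g \<in> borel_measurable borel" using g(1) by (rule borel_measurable_continuous_onI)
  let ?I = "\<lambda>X. \<integral>\<^sup>+z. indicator S z * circle_mean X (\<lambda>w. ennreal (g w)) z \<partial>hyp_area"
  have le1: "circle_mean X (\<lambda>w. ennreal (g w)) z \<le> 1" for X z
  proof -
    have "circle_mean X (\<lambda>w. ennreal (g w)) z \<le> circle_mean X (\<lambda>w. 1) z"
      unfolding circle_mean_def by (intro nn_integral_mono) (simp add: g(3) ennreal_le_1)
    then show ?thesis by (simp add: circle_mean_one)
  qed
  obtain B where B: "\<And>n. u n \<le> B"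
    using convergent_imp_bounded[OF lim] unfolding bounded_iff by (metis abs_le_D1 range_eqI real_norm_def)
  define C where "C = max B a"
  define V where "V = (\<lambda>(w, X, t). affine_move w (affine_inverse (circle_point X t))) ` (W \<times> {1..C} \<times> {0..pi})"
  have compV: "compact V"
    unfolding V_def
  proof (rule compact_continuous_image)
    show "compact (W \<times> {1..C} \<times> {0..pi})" by (intro compact_Times W) auto
    have "continuous_on (W \<times> {1..C} \<times> {0..pi}) (\<lambda>x. (\<lambda>(X, t). circle_point X t) (snd x))"
      by (rule continuous_on_compose2[OF continuous_circle_point]) (auto intro!: continuous_intros)
    then have cp: "continuous_on (W \<times> {1..C} \<times> {0..pi}) (\<lambda>x. circle_point (fst (snd x)) (snd (snd x)))"
      by (simp add: split_beta')
    show "continuous_on (W \<times> {1..C} \<times> {0..pi}) (\<lambda>(w, X, t). affine_move w (affine_inverse (circle_point X t)))"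
      unfolding affine_move_def affine_inverse_def split_beta'
      by (intro continuous_intros cp) (auto simp: Im_circle_point_pos less_imp_neq[THEN not_sym])
  qed
  have [measurable]: "V \<in> sets borel" using compV by (rule borel_compact)
  have VH: "V \<subseteq> upper_half_plane"
    unfolding V_def using W(2) Im_circle_point_pos
    by (auto simp: affine_move_def affine_inverse_def upper_half_plane_def)
  have supp: "circle_mean X (\<lambda>w. ennreal (g w)) z = 0" if X: "1 \<le> X" "X \<le> C" and z: "z \<notin> V" for X z
  proof -
    have "ennreal (g (affine_move z (circle_point X t))) * indicator {0..<pi} t = 0" for t
    proof (cases "t \<in> {0..<pi}")
      case True
      have "affine_move z (circle_point X t) \<notin> W"
      proof
        assume inW: "affine_move z (circle_point X t) \<in> W"
        have "affine_move (affine_move z (circle_point X t)) (affine_inverse (circle_point X t)) = z"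
          by (rule affine_move_inverse[OF Im_circle_point_pos[OF X(1)]])
        then have "z \<in> V" unfolding V_def using inW X True
          by (intro image_eqI[of _ _ "(affine_move z (circle_point X t), X, t)"]) auto
        then show False using z by simp
      qed
      then show ?thesis using W(3) by simp
    qed simp
    moreover have "circle_mean X (\<lambda>w. ennreal (g w)) z = (\<integral>\<^sup>+t. ennreal (g (affine_move z (circle_point X t))) * indicator {0..<pi} t \<partial>lborel) / pi"
      unfolding circle_mean_def by (rule nn_integral_angle) measurable
    ultimately show ?thesis by (simp only: nn_integral_const mult_zero_left) simp
  qed
  have dom: "indicator S z * circle_mean X (\<lambda>w. ennreal (g w)) z \<le> indicator V z" if "1 \<le> X" "X \<le> C" for X z
    using supp[OF that] le1[of X z] by (auto split: split_indicator)
  have "(\<lambda>n. ?I (u n)) \<longlonglongrightarrow> ?I a"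
  proof (rule nn_integral_dominated_convergence[where w="indicator V"])
    show "(\<integral>\<^sup>+z. indicator V z \<partial>hyp_area) < \<infinity>" by (rule compact_finite_hyp_area[OF compV VH])
    show "AE z in hyp_area. indicator S z * circle_mean (u n) (\<lambda>w. ennreal (g w)) z \<le> indicator V z" for n
      using u B[of n] by (intro AE_I2 dom) (auto simp: C_def le_max_iff_disj)
    show "AE z in hyp_area. (\<lambda>n. indicator S z * circle_mean (u n) (\<lambda>w. ennreal (g w)) z) \<longlonglongrightarrow> indicator S z * circle_mean a (\<lambda>w. ennreal (g w)) z"
    proof (intro AE_I2)
      fix z
      have "(\<lambda>n. circle_mean (u n) (\<lambda>w. ennreal (g w)) z) \<longlonglongrightarrow> circle_mean a (\<lambda>w. ennreal (g w)) z"
        unfolding circle_mean_def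
      proof (rule nn_integral_dominated_convergence[where w="\<lambda>_. 1"])
        show "AE t in angle_measure. (\<lambda>n. ennreal (g (affine_move z (circle_point (u n) t)))) \<longlonglongrightarrow> ennreal (g (affine_move z (circle_point a t)))"
        proof (intro AE_I2 tendsto_ennrealI)
          fix t
          have "continuous_on {1..} (\<lambda>X. (\<lambda>(X, t). circle_point X t) (X, t))"
            by (rule continuous_on_compose2[OF continuous_circle_point]) (auto intro!: continuous_intros)
          then have "(\<lambda>n. circle_point (u n) t) \<longlonglongrightarrow> circle_point a t"
            using continuous_on_tendsto_compose[of "{1..}" "\<lambda>X. circle_point X t", OF _ lim a] u by auto
          then have "(\<lambda>n. affine_move z (circle_point (u n) t)) \<longlonglongrightarrow> affine_move z (circle_point a t)"
            unfolding affine_move_def by (intro tendsto_intros)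
          then show "(\<lambda>n. g (affine_move z (circle_point (u n) t))) \<longlonglongrightarrow> g (affine_move z (circle_point a t))"
            using continuous_on_tendsto_compose[OF g(1)] by auto
        qed
      qed (auto simp: g(3) ennreal_le_1 emeasure_angle_UNIV)
      then show "(\<lambda>n. indicator S z * circle_mean (u n) (\<lambda>w. ennreal (g w)) z) \<longlonglongrightarrow> indicator S z * circle_mean a (\<lambda>w. ennreal (g w)) z"
        by (auto split: split_indicator)
    qed
  qed (auto intro!: measurable_hyp_area)
  moreover have "?I a < \<infinity>"
  proof -
    have "?I a \<le> (\<integral>\<^sup>+z. indicator V z \<partial>hyp_area)"
      using a by (intro nn_integral_mono dom) (auto simp: C_def)
    then show ?thesis using compact_finite_hyp_area[OF compV VH] by (rule order.strict_trans1)
  qed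
  ultimately show "(\<lambda>n. enn2real (?I (u n))) \<longlonglongrightarrow> enn2real (?I a)"
    by (intro tendsto_enn2real) (auto simp: less_top)
qed

lemma nn_integral_circle_mean:
  assumes "X \<ge> 1" and [measurable]: "u \<in> borel_measurable borel"
  shows "(\<integral>\<^sup>+z. circle_mean X u z \<partial>hyp_area) = (\<integral>\<^sup>+z. u z \<partial>hyp_area)"
  using circle_mean_symmetric[OF assms(1), of u "\<lambda>_. 1"] by (simp add: circle_mean_one)

lemma circle_mean_add:
  assumes [measurable]: "u \<in> borel_measurable borel" "v \<in> borel_measurable borel"
  shows "circle_mean X (\<lambda>z. u z + v z) z = circle_mean X u z + circle_mean X v z"
  unfolding circle_mean_def by (rule nn_integral_add) measurable

lemma circle_mean_mono:
  assumes "\<And>w. u w \<le> v w" shows "circle_mean X u z \<le> circle_mean X v z"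
  unfolding circle_mean_def by (intro nn_integral_mono assms)

text \<open>The circle mean does not increase the integral of a non-negative function, whatever the radius. So replacing the
  indicator function by a continuous approximation changes the correlation uniformly little.\<close>

lemma continuous_circle_correlation:
  assumes [measurable]: "S \<in> sets borel" "E \<in> sets borel"
    and fin: "(\<integral>\<^sup>+z. indicator E z \<partial>hyp_area) < \<infinity>" and E: "E \<subseteq> upper_half_plane"
  shows "continuous_on {1..} (\<lambda>X. enn2real (\<integral>\<^sup>+z. indicator S z * circle_mean X (indicator E) z \<partial>hyp_area))"
    (is "continuous_on _ ?f")
proof -
  have "\<exists>h. continuous_on {1..} h \<and> (\<forall>X\<in>{1..}. \<bar>h X - ?f X\<bar> \<le> 1 / real (Suc n))" for n
  proof -
    define e where "e = 1 / real (Suc n)"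
    have e: "e > 0" by (simp add: e_def)
    obtain g W where g: "continuous_on UNIV g" "\<And>z. 0 \<le> g z" "\<And>z. g z \<le> 1"
      "compact W" "W \<subseteq> upper_half_plane" "\<And>z. z \<notin> W \<Longrightarrow> g z = (0::real)"
      "(\<integral>\<^sup>+z. ennreal \<bar>indicator E z - g z\<bar> \<partial>hyp_area) \<le> ennreal e"
      by (rule continuous_L1_approximation[OF assms(2) fin E e]) (rule that)
    have [measurable]: "g \<in> borel_measurable borel" using g(1) by (rule borel_measurable_continuous_onI)
    define J where "J u X = (\<integral>\<^sup>+z. indicator S z * circle_mean X u z \<partial>hyp_area)" for u X
    have cmp: "J u X \<le> J v X + ennreal e"
      if [measurable]: "u \<in> borel_measurable borel" "v \<in> borel_measurable borel"
        and uv: "\<And>z. u z \<le> v z + ennreal \<bar>indicator E z - g z\<bar>" and X: "X \<ge> 1" for u v X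
    proof -
      let ?d = "\<lambda>z. ennreal \<bar>indicator E z - g z\<bar>"
      have "J u X \<le> (\<integral>\<^sup>+z. indicator S z * circle_mean X v z + circle_mean X ?d z \<partial>hyp_area)"
        unfolding J_def
      proof (rule nn_integral_mono)
        fix z
        have "circle_mean X u z \<le> circle_mean X (\<lambda>w. v w + ?d w) z" by (rule circle_mean_mono[OF uv])
        also have "\<dots> = circle_mean X v z + circle_mean X ?d z" by (rule circle_mean_add) measurable
        finally show "indicator S z * circle_mean X u z \<le> indicator S z * circle_mean X v z + circle_mean X ?d z"
          by (auto split: split_indicator)
      qed
      also have "\<dots> = J v X + (\<integral>\<^sup>+z. circle_mean X ?d z \<partial>hyp_area)"
        unfolding J_def by (intro nn_integral_add measurable_hyp_area) measurable
      also have "(\<integral>\<^sup>+z. circle_mean X ?d z \<partial>hyp_area) \<le> ennreal e"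
        using g(7) X by (subst nn_integral_circle_mean) auto
      finally show ?thesis by (simp add: add_left_mono)
    qed
    define h where "h X = enn2real (J (\<lambda>w. ennreal (g w)) X)" for X
    have "continuous_on {1..} h"
      unfolding h_def J_def using g by (intro continuous_circle_mean_compact_support[of g W]) auto
    moreover have "\<bar>h X - ?f X\<bar> \<le> e" if "X \<in> {1..}" for X
    proof -
      have X: "X \<ge> 1" using that by simp
      have 1: "J (indicator E) X \<le> J (\<lambda>w. ennreal (g w)) X + ennreal e"
      proof (rule cmp[OF _ _ _ X])
        show "indicator E z \<le> ennreal (g z) + ennreal \<bar>indicator E z - g z\<bar>" for z
          using g(2)[of z] by (auto split: split_indicator simp: ennreal_plus[symmetric] ennreal_1[symmetric] simp del: ennreal_plus ennreal_1 intro!: ennreal_leI)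
      qed auto
      have 2: "J (\<lambda>w. ennreal (g w)) X \<le> J (indicator E) X + ennreal e"
      proof (rule cmp[OF _ _ _ X])
        show "ennreal (g z) \<le> indicator E z + ennreal \<bar>indicator E z - g z\<bar>" for z
          using g(2)[of z] by (auto split: split_indicator simp: ennreal_plus[symmetric] ennreal_1[symmetric] simp del: ennreal_plus ennreal_1 intro!: ennreal_leI)
      qed auto
      have Jfin: "J (indicator E) X < \<infinity>"
      proof -
        have "J (indicator E) X \<le> (\<integral>\<^sup>+z. circle_mean X (indicator E) z \<partial>hyp_area)"
          unfolding J_def by (intro nn_integral_mono) (auto split: split_indicator)
        also have "\<dots> = (\<integral>\<^sup>+z. indicator E z \<partial>hyp_area)" using X by (intro nn_integral_circle_mean) auto
        finally show ?thesis using fin by (rule order.strict_trans1)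
      qed
      then have Gfin: "J (\<lambda>w. ennreal (g w)) X < \<infinity>" using 2 by (rule_tac order.strict_trans1[OF 2]) auto
      obtain p where p: "J (indicator E) X = ennreal p" "p \<ge> 0" using Jfin by (cases "J (indicator E) X") auto
      obtain q where q: "J (\<lambda>w. ennreal (g w)) X = ennreal q" "q \<ge> 0" using Gfin by (cases "J (\<lambda>w. ennreal (g w)) X") auto
      have "p \<le> q + e" "q \<le> p + e"
        using 1 2 p q e by (auto simp: ennreal_plus[symmetric] simp del: ennreal_plus)
      moreover have "?f X = p" using p by (simp add: J_def)
      moreover have "h X = q" using q by (simp add: h_def)
      ultimately show ?thesis by simp
    qed
    ultimately show ?thesis unfolding e_def by blast
  qed
  then obtain h where h: "\<And>n. continuous_on {1..} (h n)" "\<And>n X. X \<in> {1..} \<Longrightarrow> \<bar>h n X - ?f X\<bar> \<le> 1 / real (Suc n)"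
    by metis
  have "uniform_limit {1..} h ?f sequentially"
    unfolding uniform_limit_iff
  proof (intro allI impI)
    fix e :: real assume "e > 0"
    then obtain N where N: "1 / real (Suc N) < e" using nat_approx_posE by (metis inverse_eq_divide)
    show "\<forall>\<^sub>F n in sequentially. \<forall>X\<in>{1..}. dist (h n X) (?f X) < e"
      unfolding eventually_sequentially
    proof (intro exI[of _ N] allI impI ballI)
      fix n and X :: real assume n: "N \<le> n" and X: "X \<in> {1..}"
      have "1 / real (Suc n) \<le> 1 / real (Suc N)" using n by (intro divide_left_mono) auto
      then show "dist (h n X) (?f X) < e" using h(2)[OF X, of n] N by (simp add: dist_real_def)
    qed
  qed
  then show ?thesis by (intro uniform_limit_theorem[of _ h]) (use h(1) in auto)
qed

section \<open>The quadratic form of the circle means\<close>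

lemma sigma_finite_hyp_area: "sigma_finite_measure hyp_area"
proof -
  interpret N: sigma_finite_measure "restrict_space lborel upper_half_plane"
    by (rule sigma_finite_measure_restrict_space) (auto intro: lborel.sigma_finite_measure_axioms)
  have "(\<lambda>z. ennreal (1 / (Im z)\<^sup>2)) \<in> borel_measurable (restrict_space lborel upper_half_plane)"
    by (rule measurable_restrict_space1) measurable
  then show ?thesis unfolding hyp_area_def by (subst N.sigma_finite_iff_density_finite') auto
qed

lemma measurable_id_hyp_area [measurable]: "(\<lambda>z. z) \<in> hyp_area \<rightarrow>\<^sub>M borel"
  unfolding measurable_cong_sets[OF sets_hyp_area refl] by (rule measurable_restrict_space1) simp

lemma hyp_area_Fubini:
  fixes f :: "real \<Rightarrow> complex \<Rightarrow> ennreal"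
  assumes m: "(\<lambda>p. f (fst p) (snd p)) \<in> borel_measurable (borel \<Otimes>\<^sub>M borel)"
  shows "(\<integral>\<^sup>+z. \<integral>\<^sup>+X. f X z \<partial>lborel \<partial>hyp_area) = (\<integral>\<^sup>+X. \<integral>\<^sup>+z. f X z \<partial>hyp_area \<partial>lborel)"
proof -
  interpret sigma_finite_measure hyp_area by (rule sigma_finite_hyp_area)
  interpret pair_sigma_finite lborel hyp_area ..
  have "(\<lambda>p. (fst p, snd p)) \<in> (lborel \<Otimes>\<^sub>M hyp_area) \<rightarrow>\<^sub>M (borel \<Otimes>\<^sub>M borel)"
  proof (rule measurable_Pair)
    show "fst \<in> (lborel \<Otimes>\<^sub>M hyp_area) \<rightarrow>\<^sub>M borel" using measurable_fst[of lborel hyp_area] by simp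
    show "snd \<in> (lborel \<Otimes>\<^sub>M hyp_area) \<rightarrow>\<^sub>M borel"
      using measurable_compose[OF measurable_snd measurable_id_hyp_area, of lborel] by simp
  qed
  from measurable_compose[OF this m]
  have "(\<lambda>(X, z). f X z) \<in> borel_measurable (lborel \<Otimes>\<^sub>M hyp_area)" by (simp add: split_beta')
  then show ?thesis by (rule Fubini')
qed

lemma abel_mass_cosh:
  assumes "t \<ge> 0"
  shows "abel_mass (cosh t) = ennreal (2 * sinh (t/2))"
  unfolding abel_mass_def integral_abel_weight[OF assms, symmetric]
  by (rule nn_integral_eq_integral[OF integrable_abel_weight]) (auto simp: abel_weight_nonneg)

lemma circle_mean_indicator_le_1: "circle_mean X (indicator S) z \<le> 1"
proof -
  have "circle_mean X (indicator S) z \<le> circle_mean X (\<lambda>_. 1) z"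
    by (rule circle_mean_mono) (simp split: split_indicator)
  then show ?thesis by (simp add: circle_mean_one)
qed

lemma abel_mean_indicator_le: "abel_mean T (indicator S) z \<le> abel_mass T"
proof -
  have "abel_mean T (indicator S) z \<le> (\<integral>\<^sup>+X. ennreal (abel_weight T X) * 1 \<partial>lborel)"
    unfolding abel_mean_def by (intro nn_integral_mono mult_left_mono circle_mean_indicator_le_1) auto
  then show ?thesis by (simp add: abel_mass_def)
qed

lemma measurable_quotient_area: "u \<in> borel_measurable borel \<Longrightarrow> u \<in> borel_measurable (quotient_area F)"
  unfolding quotient_area_def by (intro measurable_restrict_space1 measurable_hyp_area)

context fuchsian_region
begin

lemma nn_integral_quotient_area: "(\<integral>\<^sup>+z. u z \<partial>quotient_area F) = (\<integral>\<^sup>+z. indicator F z * u z \<partial>hyp_area)"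
proof -
  have "F \<inter> space hyp_area \<in> sets hyp_area"
    unfolding sets_hyp_area space_hyp_area by (subst sets_restrict_space_iff) (use F_subset in auto)
  then show ?thesis unfolding quotient_area_def by (simp add: nn_integral_restrict_space mult.commute)
qed

lemma invariant_circle_mean:
  assumes X: "X \<ge> 1" and u: "invariant u" and [measurable]: "u \<in> borel_measurable borel"
  shows "invariant (circle_mean X u)"
  unfolding invariant_def
proof (intro ballI allI impI)
  fix g z assume g: "g \<in> \<Gamma>" and z: "Im z > 0"
  have "circle_mean X u (psl_act g z) = circle_mean X (\<lambda>w. u (psl_act g w)) z"
    by (rule circle_mean_psl_act[OF in_carrier[OF g] z X, symmetric]) measurable
  also have "\<dots> = circle_mean X u z"
    by (rule circle_mean_cong[OF X z]) (use u g in \<open>auto simp: invariant_def\<close>)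
  finally show "circle_mean X u (psl_act g z) = circle_mean X u z" .
qed

lemma invariant_abel_mean:
  assumes u: "invariant u" and [measurable]: "u \<in> borel_measurable borel"
  shows "invariant (abel_mean T u)"
  unfolding invariant_def abel_mean_def
proof (intro ballI allI impI nn_integral_cong)
  fix g z X assume "g \<in> \<Gamma>" "Im z > 0"
  then show "ennreal (abel_weight T X) * circle_mean X u (psl_act g z) = ennreal (abel_weight T X) * circle_mean X u z"
    using invariant_circle_mean[OF _ u assms(2), of X]
    by (cases "X > 1") (auto simp: invariant_def abel_weight_def)
qed

lemma quotient_abel_mean:
  assumes [measurable]: "u \<in> borel_measurable borel" "v \<in> borel_measurable borel"
  shows "(\<integral>\<^sup>+z. indicator F z * (v z * abel_mean T u z) \<partial>hyp_area)
    = (\<integral>\<^sup>+X. ennreal (abel_weight T X) * (\<integral>\<^sup>+z. indicator F z * (v z * circle_mean X u z) \<partial>hyp_area) \<partial>lborel)"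
proof -
  have "(\<integral>\<^sup>+z. indicator F z * (v z * abel_mean T u z) \<partial>hyp_area)
      = (\<integral>\<^sup>+z. \<integral>\<^sup>+X. ennreal (abel_weight T X) * (indicator F z * (v z * circle_mean X u z)) \<partial>lborel \<partial>hyp_area)"
  proof (rule nn_integral_cong)
    fix z
    have "(\<integral>\<^sup>+X. ennreal (abel_weight T X) * (indicator F z * (v z * circle_mean X u z)) \<partial>lborel)
        = (\<integral>\<^sup>+X. (indicator F z * v z) * (ennreal (abel_weight T X) * circle_mean X u z) \<partial>lborel)"
      by (intro nn_integral_cong) (simp only: mult.left_commute mult.assoc)
    also have "\<dots> = (indicator F z * v z) * (\<integral>\<^sup>+X. ennreal (abel_weight T X) * circle_mean X u z \<partial>lborel)"
      by (rule nn_integral_cmult) measurable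
    finally show "indicator F z * (v z * abel_mean T u z)
        = (\<integral>\<^sup>+X. ennreal (abel_weight T X) * (indicator F z * (v z * circle_mean X u z)) \<partial>lborel)"
      by (simp only: abel_mean_def mult.assoc)
  qed
  also have "\<dots> = (\<integral>\<^sup>+X. \<integral>\<^sup>+z. ennreal (abel_weight T X) * (indicator F z * (v z * circle_mean X u z)) \<partial>hyp_area \<partial>lborel)"
    by (rule hyp_area_Fubini) measurable
  also have "\<dots> = (\<integral>\<^sup>+X. ennreal (abel_weight T X) * (\<integral>\<^sup>+z. indicator F z * (v z * circle_mean X u z) \<partial>hyp_area) \<partial>lborel)"
    by (intro nn_integral_cong nn_integral_cmult measurable_hyp_area) measurable
  finally show ?thesis .
qed

lemma quotient_abel_mean_symmetric:
  assumes [measurable]: "u \<in> borel_measurable borel" "v \<in> borel_measurable borel" and inv: "invariant u" "invariant v"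
  shows "(\<integral>\<^sup>+z. indicator F z * (v z * abel_mean T u z) \<partial>hyp_area)
    = (\<integral>\<^sup>+z. indicator F z * (u z * abel_mean T v z) \<partial>hyp_area)"
  unfolding quotient_abel_mean[OF assms(1,2)] quotient_abel_mean[OF assms(2,1)]
proof (rule nn_integral_cong)
  fix X
  show "ennreal (abel_weight T X) * (\<integral>\<^sup>+z. indicator F z * (v z * circle_mean X u z) \<partial>hyp_area)
    = ennreal (abel_weight T X) * (\<integral>\<^sup>+z. indicator F z * (u z * circle_mean X v z) \<partial>hyp_area)"
    using quotient_circle_mean_symmetric[OF _ assms, of X] by (cases "X > 1") (auto simp: abel_weight_def)
qed

text \<open>Symmetry moves one Abel average to the other side, where the product rule applies.\<close>

lemma quotient_abel_mean_product:
  assumes [measurable]: "u \<in> borel_measurable borel" and inv: "invariant u" and t: "t \<ge> 0" "t' \<ge> 0"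
  shows "(\<integral>\<^sup>+z. indicator F z * (abel_mean (cosh t) u z * abel_mean (cosh t') u z) \<partial>hyp_area)
    = ennreal (1/2) * (\<integral>\<^sup>+v. indicator {\<bar>t - t'\<bar><..<t + t'} v *
        (\<integral>\<^sup>+X. ennreal (abel_weight (cosh v) X) * (\<integral>\<^sup>+z. indicator F z * (u z * circle_mean X u z) \<partial>hyp_area) \<partial>lborel) \<partial>lborel)"
proof -
  have "(\<integral>\<^sup>+z. indicator F z * (abel_mean (cosh t) u z * abel_mean (cosh t') u z) \<partial>hyp_area)
      = (\<integral>\<^sup>+z. indicator F z * (abel_mean (cosh t') u z * abel_mean (cosh t) u z) \<partial>hyp_area)"
    by (simp only: mult.commute)
  also have "\<dots> = (\<integral>\<^sup>+z. indicator F z * (u z * abel_mean (cosh t) (abel_mean (cosh t') u) z) \<partial>hyp_area)"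
    by (rule quotient_abel_mean_symmetric) (auto intro: inv invariant_abel_mean)
  also have "\<dots> = (\<integral>\<^sup>+z. indicator F z * (u z * abel_mean_window \<bar>t - t'\<bar> (t + t') u z) \<partial>hyp_area)"
    by (rule nn_integral_hyp_area_cong) (simp add: abel_mean_product[OF t])
  also have "\<dots> = (\<integral>\<^sup>+z. \<integral>\<^sup>+v. ennreal (1/2) * (indicator {\<bar>t - t'\<bar><..<t + t'} v * (indicator F z * (u z * abel_mean (cosh v) u z))) \<partial>lborel \<partial>hyp_area)"
  proof (rule nn_integral_cong)
    fix z
    have "(\<integral>\<^sup>+v. ennreal (1/2) * (indicator {\<bar>t - t'\<bar><..<t + t'} v * (indicator F z * (u z * abel_mean (cosh v) u z))) \<partial>lborel)
        = (\<integral>\<^sup>+v. (indicator F z * u z * ennreal (1/2)) * (indicator {\<bar>t - t'\<bar><..<t + t'} v * abel_mean (cosh v) u z) \<partial>lborel)"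
      by (intro nn_integral_cong) (simp only: mult.left_commute mult.assoc)
    also have "\<dots> = (indicator F z * u z * ennreal (1/2)) * (\<integral>\<^sup>+v. indicator {\<bar>t - t'\<bar><..<t + t'} v * abel_mean (cosh v) u z \<partial>lborel)"
      by (rule nn_integral_cmult) measurable
    finally show "indicator F z * (u z * abel_mean_window \<bar>t - t'\<bar> (t + t') u z)
      = (\<integral>\<^sup>+v. ennreal (1/2) * (indicator {\<bar>t - t'\<bar><..<t + t'} v * (indicator F z * (u z * abel_mean (cosh v) u z))) \<partial>lborel)"
      by (simp only: abel_mean_window_def mult.assoc)
  qed
  also have "\<dots> = (\<integral>\<^sup>+v. \<integral>\<^sup>+z. ennreal (1/2) * (indicator {\<bar>t - t'\<bar><..<t + t'} v * (indicator F z * (u z * abel_mean (cosh v) u z))) \<partial>hyp_area \<partial>lborel)"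
    by (rule hyp_area_Fubini) measurable
  also have "\<dots> = (\<integral>\<^sup>+v. ennreal (1/2) * (indicator {\<bar>t - t'\<bar><..<t + t'} v *
        (\<integral>\<^sup>+X. ennreal (abel_weight (cosh v) X) * (\<integral>\<^sup>+z. indicator F z * (u z * circle_mean X u z) \<partial>hyp_area) \<partial>lborel)) \<partial>lborel)"
  proof (rule nn_integral_cong)
    fix v
    have m: "(\<lambda>z. indicator F z * (u z * abel_mean (cosh v) u z)) \<in> borel_measurable hyp_area"
      by (intro measurable_hyp_area) measurable
    show "(\<integral>\<^sup>+z. ennreal (1/2) * (indicator {\<bar>t - t'\<bar><..<t + t'} v * (indicator F z * (u z * abel_mean (cosh v) u z))) \<partial>hyp_area)
      = ennreal (1/2) * (indicator {\<bar>t - t'\<bar><..<t + t'} v *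
        (\<integral>\<^sup>+X. ennreal (abel_weight (cosh v) X) * (\<integral>\<^sup>+z. indicator F z * (u z * circle_mean X u z) \<partial>hyp_area) \<partial>lborel))"
      unfolding quotient_abel_mean[OF assms(1,1), symmetric] mult.assoc[symmetric, of "ennreal (1/2)"]
      by (rule nn_integral_cmult[OF m])
  qed
  also have "\<dots> = ennreal (1/2) * (\<integral>\<^sup>+v. indicator {\<bar>t - t'\<bar><..<t + t'} v *
        (\<integral>\<^sup>+X. ennreal (abel_weight (cosh v) X) * (\<integral>\<^sup>+z. indicator F z * (u z * circle_mean X u z) \<partial>hyp_area) \<partial>lborel) \<partial>lborel)"
  proof (rule nn_integral_cmult)
    interpret sigma_finite_measure hyp_area by (rule sigma_finite_hyp_area)
    have id: "(\<lambda>p. (fst p, snd p)) \<in> (borel \<Otimes>\<^sub>M hyp_area) \<rightarrow>\<^sub>M (borel \<Otimes>\<^sub>M borel)"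
    proof (rule measurable_Pair)
      show "fst \<in> (borel \<Otimes>\<^sub>M hyp_area) \<rightarrow>\<^sub>M borel" by (rule measurable_fst)
      show "snd \<in> (borel \<Otimes>\<^sub>M hyp_area) \<rightarrow>\<^sub>M borel"
        using measurable_compose[OF measurable_snd measurable_id_hyp_area, of borel] by simp
    qed
    have "(\<lambda>p. indicator F (snd p) * (u (snd p) * circle_mean (fst p) u (snd p))) \<in> borel_measurable (borel \<Otimes>\<^sub>M borel)"
      by measurable
    from measurable_compose[OF id this]
    have [measurable]: "(\<lambda>X::real. \<integral>\<^sup>+z. indicator F z * (u z * circle_mean X u z) \<partial>hyp_area) \<in> borel_measurable borel"
      by (intro borel_measurable_nn_integral) (simp add: split_beta')
    show "(\<lambda>v. indicator {\<bar>t - t'\<bar><..<t + t'} v *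
        (\<integral>\<^sup>+X. ennreal (abel_weight (cosh v) X) * (\<integral>\<^sup>+z. indicator F z * (u z * circle_mean X u z) \<partial>hyp_area) \<partial>lborel)) \<in> borel_measurable lborel"
      by measurable
  qed
  finally show ?thesis .
qed

text \<open>Hoffman's bound. The spectral inequality is applied to \<open>\<psi> = \<phi> - m\<^sup>2 / V\<close>, the correlation function of
  \<open>1\<^sub>S\<close> minus its mean; \<open>\<psi>\<close> equals \<open>- m\<^sup>2 / V\<close> at the avoided radius, and its
  upper bound \<open>m - m\<^sup>2 / V\<close> is the square norm.\<close>

theorem avoided_distance_density:
  assumes fin: "(\<integral>\<^sup>+z. indicator F z \<partial>hyp_area) < \<infinity>"
    and S [measurable]: "S \<in> sets borel" and inv: "invariant (indicator S :: complex \<Rightarrow> ennreal)" and r: "r > 0"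
    and avoid: "(\<integral>\<^sup>+z. indicator F z * (indicator S z * circle_mean (cosh r) (indicator S) z) \<partial>hyp_area) = 0"
  defines "m \<equiv> measure (quotient_area F) (S \<inter> F)" and "V \<equiv> measure (quotient_area F) F"
  assumes V: "V > 0"
  shows "m / V \<le> (1 - m / V) * ((r / pi + 1) / sinh (r / 2))"
proof -
  define u where "u = (indicator S :: complex \<Rightarrow> ennreal)"
  have [measurable]: "u \<in> borel_measurable borel" by (simp add: u_def)
  have inv_u: "invariant u" using inv by (simp add: u_def)
  have F_sets: "F \<inter> space hyp_area \<in> sets hyp_area"
    unfolding sets_hyp_area space_hyp_area by (subst sets_restrict_space_iff) (use F_subset in auto)
  have space_Q: "space (quotient_area F) = F"
    using F_subset by (simp add: quotient_area_def space_restrict_space space_hyp_area Int_absorb2)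
  have Q_meas: "measure (quotient_area F) A = enn2real (\<integral>\<^sup>+z. indicator F z * indicator A z \<partial>hyp_area)"
    if [measurable]: "A \<in> sets borel" and "A \<subseteq> F" for A
  proof -
    have "A \<in> sets (quotient_area F)"
      using that F_subset F_sets unfolding quotient_area_def
      by (subst sets_restrict_space_iff) (auto simp: sets_hyp_area sets_restrict_space_iff)
    then show ?thesis unfolding measure_def nn_integral_quotient_area[symmetric] by simp
  qed
  interpret Q: finite_measure "quotient_area F"
  proof (rule finite_measureI)
    have "emeasure (quotient_area F) (space (quotient_area F)) = (\<integral>\<^sup>+z. 1 \<partial>quotient_area F)" by simp
    also have "\<dots> = (\<integral>\<^sup>+z. indicator F z \<partial>hyp_area)" unfolding nn_integral_quotient_area by simp
    finally show "emeasure (quotient_area F) (space (quotient_area F)) \<noteq> \<infinity>" using fin by simp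
  qed
  have m_nn: "(\<integral>\<^sup>+z. indicator F z * u z \<partial>hyp_area) = ennreal m"
  proof -
    have le: "(\<integral>\<^sup>+z. indicator F z * u z \<partial>hyp_area) \<le> (\<integral>\<^sup>+z. indicator F z \<partial>hyp_area)"
      by (intro nn_integral_mono) (auto simp: u_def split: split_indicator)
    have "m = enn2real (\<integral>\<^sup>+z. indicator F z * indicator (S \<inter> F) z \<partial>hyp_area)"
      unfolding m_def by (rule Q_meas) auto
    also have "(\<integral>\<^sup>+z. indicator F z * indicator (S \<inter> F) z \<partial>hyp_area) = (\<integral>\<^sup>+z. indicator F z * u z \<partial>hyp_area)"
      by (intro nn_integral_cong) (auto simp: u_def split: split_indicator)
    finally show ?thesis using order.strict_trans1[OF le fin] by (simp add: less_top)
  qed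
  have m0: "m \<ge> 0" by (simp add: m_def)
  have mV: "m \<le> V" unfolding m_def V_def
    by (rule Q.finite_measure_mono) (use sets.top[of "quotient_area F"] space_Q in auto)
  define \<phi>n where "\<phi>n X = (\<integral>\<^sup>+z. indicator F z * (u z * circle_mean X u z) \<partial>hyp_area)" for X
  have \<phi>n_le: "\<phi>n X \<le> ennreal m" for X
    unfolding \<phi>n_def m_nn[symmetric]
    using circle_mean_indicator_le_1[of X S]
    by (intro nn_integral_mono mult_left_mono) (auto simp: u_def split: split_indicator)
  (* radii X < 1 have no meaning; the value at 1 extends the function continuously to the line *)
  define \<phi> where "\<phi> X = enn2real (\<phi>n (max 1 X))" for X
  have \<phi>n_fin: "\<phi>n X < \<infinity>" for X
    by (rule order.strict_trans1[OF \<phi>n_le]) simp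
  have \<phi>_eq: "ennreal (\<phi> X) = \<phi>n X" if "X \<ge> 1" for X
    using that \<phi>n_fin[of X] by (simp add: \<phi>_def max_def less_top)
  have \<phi>_bounds: "0 \<le> \<phi> X" "\<phi> X \<le> m" for X
    using enn2real_mono[OF \<phi>n_le, of "max 1 X"] m0 by (auto simp: \<phi>_def)
  have \<phi>_cont: "continuous_on UNIV \<phi>"
  proof -
    let ?f = "\<lambda>X. enn2real (\<integral>\<^sup>+z. indicator S z * circle_mean X (indicator (F \<inter> S)) z \<partial>hyp_area)"
    have "(\<integral>\<^sup>+z. indicator (F \<inter> S) z \<partial>hyp_area) \<le> (\<integral>\<^sup>+z. indicator F z \<partial>hyp_area)"
      by (intro nn_integral_mono) (auto split: split_indicator)
    then have "continuous_on {1..} ?f"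
      using fin F_subset by (intro continuous_circle_correlation) (auto intro: order.strict_trans1)
    then have "continuous_on UNIV (\<lambda>X. ?f (max 1 X))"
      by (rule continuous_on_compose2) (auto intro!: continuous_intros)
    moreover have "?f (max 1 X) = \<phi> X" for X
    proof -
      have "(\<integral>\<^sup>+z. indicator (F \<inter> S) z * circle_mean (max 1 X) u z \<partial>hyp_area) = (\<integral>\<^sup>+z. u z * circle_mean (max 1 X) (indicator (F \<inter> S)) z \<partial>hyp_area)"
        by (rule circle_mean_symmetric) auto
      moreover have "\<phi>n (max 1 X) = (\<integral>\<^sup>+z. indicator (F \<inter> S) z * circle_mean (max 1 X) u z \<partial>hyp_area)"
        unfolding \<phi>n_def by (intro nn_integral_cong) (auto simp: u_def split: split_indicator)
      ultimately show ?thesis by (simp add: \<phi>_def u_def)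
    qed
    ultimately show ?thesis by simp
  qed
  have [measurable]: "\<phi> \<in> borel_measurable borel" using \<phi>_cont by (rule borel_measurable_continuous_onI)
  have \<phi>_abs: "\<bar>\<phi> X\<bar> \<le> m" for X using \<phi>_bounds[of X] by simp
  define s where "s v = abel_transform \<phi> (cosh v)" for v
  have s_cont: "continuous_on {0..} s"
    unfolding s_def
    by (rule continuous_on_compose2[OF continuous_abel_transform[OF \<phi>_cont \<phi>_abs]])
      (auto intro!: continuous_intros cosh_real_ge_1)
  have s_nn: "s v \<ge> 0" for v
    unfolding s_def abel_transform_def by (intro integral_nonneg_AE) (auto simp: abel_weight_nonneg \<phi>_bounds)
  have s_eq: "(\<integral>\<^sup>+X. ennreal (abel_weight (cosh v) X) * \<phi>n X \<partial>lborel) = ennreal (s v)" for v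
  proof -
    have "(\<integral>\<^sup>+X. ennreal (abel_weight (cosh v) X) * \<phi>n X \<partial>lborel) = (\<integral>\<^sup>+X. ennreal (abel_weight (cosh v) X * \<phi> X) \<partial>lborel)"
    proof (rule nn_integral_cong)
      fix X
      show "ennreal (abel_weight (cosh v) X) * \<phi>n X = ennreal (abel_weight (cosh v) X * \<phi> X)"
        by (cases "X > 1") (auto simp: \<phi>_eq[symmetric] ennreal_mult abel_weight_nonneg \<phi>_bounds, auto simp: abel_weight_def)
    qed
    also have "\<dots> = ennreal (s v)"
      unfolding s_def abel_transform_def
      by (rule nn_integral_eq_integral[OF integrable_abel_weight_mult[OF _ \<phi>_abs]]) (auto simp: abel_weight_nonneg \<phi>_bounds)
    finally show ?thesis .
  qed
  have win: "(\<integral>\<^sup>+v. indicator {a<..<b} v * ennreal (s v) \<partial>lborel) = ennreal (integral {a..b} s)" if "0 \<le> a" for a b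
  proof -
    have "(\<integral>\<^sup>+v. indicator {a<..<b} v * ennreal (s v) \<partial>lborel) = (\<integral>\<^sup>+v. ennreal (s v) * indicator {a..b} v \<partial>lborel)"
    proof (rule nn_integral_cong_AE)
      have "AE v in lborel. v \<noteq> a \<and> v \<noteq> b"
        using AE_lborel_singleton[of a] AE_lborel_singleton[of b] by eventually_elim simp
      then show "AE v in lborel. indicator {a<..<b} v * ennreal (s v) = ennreal (s v) * indicator {a..b} v"
        by eventually_elim (auto split: split_indicator)
    qed
    also have "\<dots> = ennreal (integral {a..b} s)"
      by (rule nn_integral_has_integral_lebesgue'[OF _ integrable_integral])
        (use that in \<open>auto simp: s_nn intro!: integrable_continuous_real continuous_on_subset[OF s_cont]\<close>)
    finally show ?thesis .
  qed
  define G where "G t z = enn2real (abel_mean (cosh t) u z)" for t z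
  define \<sigma> where "\<sigma> t = 2 * sinh (t/2)" for t :: real
  have \<sigma>0: "\<sigma> t \<ge> 0" if "t \<ge> 0" for t using that by (simp add: \<sigma>_def)
  have G_eq: "ennreal (G t z) = abel_mean (cosh t) u z" for t z
    using order.strict_trans1[OF abel_mean_indicator_le abel_mass_finite, of "cosh t" S z]
    by (simp add: G_def u_def less_top)
  have G_bounds: "0 \<le> G t z" for t z by (simp add: G_def)
  have G_le: "G t z \<le> \<sigma> t" if "t \<ge> 0" for t z
    using enn2real_mono[OF abel_mean_indicator_le, of "cosh t" S z] abel_mass_cosh[OF that] \<sigma>0[OF that]
    by (simp add: G_def u_def \<sigma>_def)
  have [measurable]: "G t \<in> borel_measurable borel" for t unfolding G_def[abs_def] by measurable
  have G_int: "integrable (quotient_area F) (G t)" if "t \<ge> 0" for t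
    by (rule Q.integrable_const_bound[where B="\<sigma> t"])
      (use G_le[OF that] G_bounds in \<open>auto intro!: measurable_quotient_area\<close>)
  have GG_int: "integrable (quotient_area F) (\<lambda>z. G t z * G t' z)" if "t \<ge> 0" "t' \<ge> 0" for t t'
    by (rule Q.integrable_const_bound[where B="\<sigma> t * \<sigma> t'"])
      (use G_le that G_bounds \<sigma>0 in \<open>auto intro!: measurable_quotient_area mult_mono simp: abs_mult\<close>)
  have G_lint: "(LINT z|quotient_area F. G t z) = \<sigma> t * m" if t: "t \<ge> 0" for t
  proof -
    have "(\<integral>\<^sup>+z. ennreal (G t z) \<partial>quotient_area F) = (\<integral>\<^sup>+z. indicator F z * (1 * abel_mean (cosh t) u z) \<partial>hyp_area)"
      unfolding nn_integral_quotient_area G_eq by simp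
    also have "\<dots> = (\<integral>\<^sup>+z. indicator F z * (u z * abel_mean (cosh t) (\<lambda>_. 1) z) \<partial>hyp_area)"
      by (rule quotient_abel_mean_symmetric) (auto simp: inv_u, simp add: invariant_def)
    also have "\<dots> = (\<integral>\<^sup>+z. (indicator F z * u z) * abel_mass (cosh t) \<partial>hyp_area)"
      by (simp add: abel_mean_const mult.assoc)
    also have "\<dots> = ennreal m * abel_mass (cosh t)"
      unfolding m_nn[symmetric] by (intro nn_integral_multc measurable_hyp_area) measurable
    also have "\<dots> = ennreal (\<sigma> t * m)"
      using m0 \<sigma>0[OF t] by (simp add: abel_mass_cosh[OF t] \<sigma>_def ennreal_mult' mult.commute)
    finally have "enn2real (\<integral>\<^sup>+z. ennreal (G t z) \<partial>quotient_area F) = \<sigma> t * m"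
      using m0 \<sigma>0[OF t] by simp
    then show ?thesis
      by (subst integral_eq_nn_integral) (auto simp: G_bounds intro!: measurable_quotient_area)
  qed
  have GG_lint: "(LINT z|quotient_area F. G t z * G t' z) = integral {\<bar>t - t'\<bar>..t + t'} s / 2"
    if t: "t \<ge> 0" "t' \<ge> 0" for t t'
  proof -
    have nn: "integral {\<bar>t - t'\<bar>..t + t'} s \<ge> 0"
      by (intro integral_nonneg integrable_continuous_real continuous_on_subset[OF s_cont]) (auto simp: s_nn)
    have "(\<integral>\<^sup>+z. ennreal (G t z * G t' z) \<partial>quotient_area F)
        = (\<integral>\<^sup>+z. indicator F z * (abel_mean (cosh t) u z * abel_mean (cosh t') u z) \<partial>hyp_area)"
      unfolding nn_integral_quotient_area by (simp add: ennreal_mult G_bounds G_eq)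
    also have "\<dots> = ennreal (1/2) * ennreal (integral {\<bar>t - t'\<bar>..t + t'} s)"
      unfolding quotient_abel_mean_product[OF \<open>u \<in> borel_measurable borel\<close> inv_u t] \<phi>n_def[symmetric] s_eq
      by (subst win) auto
    also have "\<dots> = ennreal (integral {\<bar>t - t'\<bar>..t + t'} s / 2)"
      using nn by (subst ennreal_mult[symmetric]) auto
    finally have "enn2real (\<integral>\<^sup>+z. ennreal (G t z * G t' z) \<partial>quotient_area F) = integral {\<bar>t - t'\<bar>..t + t'} s / 2"
      using nn by simp
    then show ?thesis
      by (subst integral_eq_nn_integral) (auto simp: G_bounds intro!: measurable_quotient_area)
  qed
  have variance: "integral {0..2 * t} s / 2 + integral {0..2 * t'} s / 2 - integral {t - t'..t + t'} s \<ge> (\<sigma> t - \<sigma> t')\<^sup>2 * (m\<^sup>2 / V)"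
    if t: "t' \<ge> 0" "t \<ge> t'" for t t'
  proof -
    have t0: "t \<ge> 0" using t by simp
    (* c is the mean of G t - G t' over the quotient, the constant for which the inequality is best *)
    define c where "c = (\<sigma> t - \<sigma> t') * m / V"
    have "0 \<le> (LINT z|quotient_area F. (G t z - G t' z - c)\<^sup>2)"
      by (intro integral_nonneg_AE) auto
    also have "\<dots> = (LINT z|quotient_area F. G t z * G t z + G t' z * G t' z - 2 * (G t z * G t' z) - 2 * c * G t z + 2 * c * G t' z + c\<^sup>2)"
      by (intro Bochner_Integration.integral_cong refl) (simp add: power2_eq_square algebra_simps)
    also have "\<dots> = (LINT z|quotient_area F. G t z * G t z) + (LINT z|quotient_area F. G t' z * G t' z)
        - 2 * (LINT z|quotient_area F. G t z * G t' z) - 2 * c * (LINT z|quotient_area F. G t z)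
        + 2 * c * (LINT z|quotient_area F. G t' z) + c\<^sup>2 * V"
    proof -
      have "(LINT z|quotient_area F. c\<^sup>2) = c\<^sup>2 * V" by (simp add: V_def space_Q mult.commute)
      then show ?thesis
        using G_int[OF t0] G_int[OF t(1)] GG_int[OF t0 t0] GG_int[OF t(1) t(1)] GG_int[OF t0 t(1)]
        by simp
    qed
    also have "\<dots> = integral {0..2 * t} s / 2 + integral {0..2 * t'} s / 2 - integral {t - t'..t + t'} s
        - 2 * c * (\<sigma> t - \<sigma> t') * m + c\<^sup>2 * V"
      using t by (simp add: G_lint GG_lint algebra_simps)
    also have "c\<^sup>2 * V = c * (\<sigma> t - \<sigma> t') * m" using V by (simp add: c_def power2_eq_square)
    also have "integral {0..2 * t} s / 2 + integral {0..2 * t'} s / 2 - integral {t - t'..t + t'} s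
        - 2 * c * (\<sigma> t - \<sigma> t') * m + c * (\<sigma> t - \<sigma> t') * m
      = integral {0..2 * t} s / 2 + integral {0..2 * t'} s / 2 - integral {t - t'..t + t'} s - c * (\<sigma> t - \<sigma> t') * m"
      by (simp add: algebra_simps)
    also have "c * (\<sigma> t - \<sigma> t') * m = (\<sigma> t - \<sigma> t')\<^sup>2 * (m\<^sup>2 / V)" by (simp add: c_def power2_eq_square)
    finally show ?thesis by simp
  qed
  define \<kappa> where "\<kappa> = m\<^sup>2 / V"
  have \<kappa>: "0 \<le> \<kappa>" "\<kappa> \<le> m"
  proof -
    show "0 \<le> \<kappa>" using V by (simp add: \<kappa>_def)
    have "m * m \<le> m * V" using mV m0 by (rule mult_left_mono)
    then show "\<kappa> \<le> m" using V by (simp add: \<kappa>_def power2_eq_square divide_le_eq)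
  qed
  define \<psi> where "\<psi> X = \<phi> X - \<kappa>" for X
  have \<psi>_transform: "abel_transform \<psi> (cosh v) = s v - \<kappa> * \<sigma> v" if "v \<ge> 0" for v
  proof -
    have "abel_transform \<psi> (cosh v) = (LINT X|lborel. abel_weight (cosh v) X * \<phi> X - abel_weight (cosh v) X * \<kappa>)"
      unfolding abel_transform_def \<psi>_def by (simp add: right_diff_distrib)
    also have "\<dots> = s v - (LINT X|lborel. abel_weight (cosh v) X * \<kappa>)"
      unfolding s_def abel_transform_def
      by (rule Bochner_Integration.integral_diff) (auto intro!: integrable_abel_weight_mult[OF _ \<phi>_abs] integrable_abel_weight)
    also have "(LINT X|lborel. abel_weight (cosh v) X * \<kappa>) = \<kappa> * \<sigma> v"
      by (simp add: integral_abel_weight[OF that] \<sigma>_def)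
    finally show ?thesis .
  qed
  have \<psi>_int: "integral {0..x} (\<lambda>v. abel_transform \<psi> (cosh v)) = integral {0..x} s - \<kappa> * (4 * cosh (x/2) - 4)" if x: "x \<ge> 0" for x
  proof -
    have i1: "(s has_integral integral {0..x} s) {0..x}"
      by (intro integrable_integral integrable_continuous_real continuous_on_subset[OF s_cont]) auto
    have i2: "((\<lambda>v. \<kappa> * \<sigma> v) has_integral (\<kappa> * (4 * cosh (x/2)) - \<kappa> * (4 * cosh (0/2)))) {0..x}"
      unfolding \<sigma>_def
      by (rule fundamental_theorem_of_calculus[OF x])
        (auto intro!: derivative_eq_intros simp flip: has_real_derivative_iff_has_vector_derivative)
    have "((\<lambda>v. s v - \<kappa> * \<sigma> v) has_integral (integral {0..x} s - (\<kappa> * (4 * cosh (x/2)) - \<kappa> * (4 * cosh (0/2))))) {0..x}"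
      by (rule has_integral_diff[OF i1 i2])
    then have "((\<lambda>v. abel_transform \<psi> (cosh v)) has_integral (integral {0..x} s - (\<kappa> * (4 * cosh (x/2)) - \<kappa> * (4 * cosh (0/2))))) {0..x}"
      by (rule has_integral_eq[rotated]) (simp add: \<psi>_transform)
    then show ?thesis by (simp add: integral_unique right_diff_distrib)
  qed
  have "\<psi> (cosh r) \<ge> - (m - \<kappa>) * ((r / pi + 1) / sinh (r / 2))"
  proof (rule abel_lower_bound[where B="2 * m"])
    show "continuous_on UNIV \<psi>" unfolding \<psi>_def by (intro continuous_intros \<phi>_cont)
    show "\<bar>\<psi> X\<bar> \<le> 2 * m" for X using \<phi>_bounds[of X] \<kappa> by (auto simp: \<psi>_def)
    show "\<psi> X \<le> m - \<kappa>" for X using \<phi>_bounds[of X] by (simp add: \<psi>_def)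
    show "0 \<le> m - \<kappa>" using \<kappa> by simp
    show "r > 0" by (rule r)
    fix T h :: real assume h: "0 \<le> h" "h \<le> T"
    (* the choice with t + t' = T and t - t' = h: the square norm of G t - G t' involves the integrals of s over {0..2t}, {0..2t'} and {t - t'..t + t'} *)
    define t where "t = (T + h)/2"
    define t' where "t' = (T - h)/2"
    have tt: "t' \<ge> 0" "t \<ge> t'" "2 * t = T + h" "2 * t' = T - h" "t - t' = h" "t + t' = T"
      using h by (auto simp: t_def t'_def field_simps)
    have split: "integral {0..h} s + integral {h..T} s = integral {0..T} s"
      using h by (intro Henstock_Kurzweil_Integration.integral_combine integrable_continuous_real continuous_on_subset[OF s_cont]) auto
    have sq: "(\<sigma> t - \<sigma> t')\<^sup>2 = 2 * (cosh t - 1) + 2 * (cosh t' - 1) - 4 * (cosh (T/2) - cosh (h/2))"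
    proof -
      have half: "2 * (sinh (x/2))\<^sup>2 = cosh x - 1" for x :: real
        using cosh_double[of "x/2"] cosh_square_eq[of "x/2"] by simp
      have "(\<sigma> t)\<^sup>2 = 2 * (cosh t - 1)" "(\<sigma> t')\<^sup>2 = 2 * (cosh t' - 1)"
        unfolding half[symmetric] by (simp_all add: \<sigma>_def power_mult_distrib)
      moreover have "\<sigma> t * \<sigma> t' = 2 * (cosh (T/2) - cosh (h/2))"
      proof -
        have "T/2 = t/2 + t'/2" "h/2 = t/2 - t'/2" using tt by simp_all
        then show ?thesis by (simp only: \<sigma>_def cosh_add cosh_diff) simp
      qed
      moreover have "(\<sigma> t - \<sigma> t')\<^sup>2 = (\<sigma> t)\<^sup>2 + (\<sigma> t')\<^sup>2 - 2 * (\<sigma> t * \<sigma> t')"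
        by (simp add: power2_eq_square algebra_simps)
      ultimately show ?thesis by simp
    qed
    have v: "integral {0..T + h} s / 2 + integral {0..T - h} s / 2 - integral {h..T} s \<ge> (\<sigma> t - \<sigma> t')\<^sup>2 * \<kappa>"
      using variance[OF tt(1,2)] unfolding tt \<kappa>_def .
    have I: "integral {0..T + h} (\<lambda>v. abel_transform \<psi> (cosh v)) = integral {0..T + h} s - \<kappa> * (4 * cosh t - 4)"
      "integral {0..T - h} (\<lambda>v. abel_transform \<psi> (cosh v)) = integral {0..T - h} s - \<kappa> * (4 * cosh t' - 4)"
      "integral {0..T} (\<lambda>v. abel_transform \<psi> (cosh v)) = integral {0..T} s - \<kappa> * (4 * cosh (T/2) - 4)"
      "integral {0..h} (\<lambda>v. abel_transform \<psi> (cosh v)) = integral {0..h} s - \<kappa> * (4 * cosh (h/2) - 4)"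
      using \<psi>_int[of "T + h"] \<psi>_int[of "T - h"] \<psi>_int[of T] \<psi>_int[of h] h by (simp_all add: t_def t'_def)
    show "0 \<le> integral {0..T + h} (\<lambda>v. abel_transform \<psi> (cosh v)) + integral {0..T - h} (\<lambda>v. abel_transform \<psi> (cosh v))
        - 2 * integral {0..T} (\<lambda>v. abel_transform \<psi> (cosh v)) + 2 * integral {0..h} (\<lambda>v. abel_transform \<psi> (cosh v))"
      using v[unfolded sq] split unfolding I by (simp add: algebra_simps)
  qed
  moreover have "\<phi> (cosh r) = 0"
    using avoid cosh_real_ge_1[of r] by (simp add: \<phi>_def \<phi>n_def u_def max_def)
  ultimately have "\<kappa> \<le> (m - \<kappa>) * ((r / pi + 1) / sinh (r / 2))"
    by (simp only: \<psi>_def diff_0 mult_minus_left neg_le_iff_le)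
  moreover have "\<kappa> = m * (m / V)" "m - \<kappa> = m * (1 - m / V)" by (simp_all add: \<kappa>_def power2_eq_square right_diff_distrib)
  ultimately have le: "m * (m / V) \<le> m * ((1 - m / V) * ((r / pi + 1) / sinh (r / 2)))" by (simp only: mult.assoc)
  show ?thesis
  proof (cases "m = 0")
    case True then show ?thesis using r by simp
  next
    case False
    then have "m > 0" using m0 by simp
    then show ?thesis using le by (rule mult_left_le_imp_le[rotated])
  qed
qed

end

section \<open>The averaging operator as a circle mean\<close>

lemma det_geodesic_matrix: "det (geodesic_matrix r) = 1"
  by (simp add: geodesic_matrix_def det_2 flip: exp_add)

lemma moebius_geodesic_matrix: "moebius_map (geodesic_matrix r) \<i> = \<i> * of_real (exp r)"
proof -
  have "exp (r/2) = exp r * exp (- r/2)" by (simp flip: exp_add)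
  then have "complex_of_real (exp (r/2)) = of_real (exp r) * of_real (exp (- r/2))" by (simp flip: of_real_mult)
  then show ?thesis by (simp add: moebius_map_def geodesic_matrix_def)
qed

lemma circle_point_cosh:
  assumes "r \<ge> 0"
  shows "circle_point (cosh r) t = moebius_map (rotation t) (moebius_map (geodesic_matrix r) \<i>)"
proof -
  have "sqrt ((cosh r)\<^sup>2 - 1) = sinh r" using assms by (simp add: cosh_square_eq)
  then have "cosh r + sqrt ((cosh r)\<^sup>2 - 1) = exp r" by (simp add: cosh_plus_sinh)
  then show ?thesis
    using circle_point_moebius[OF cosh_real_ge_1, of r t] by (simp only: moebius_geodesic_matrix)
qed

lemma psl_act_triple:
  assumes "det A = 1" "det B = 1"
  shows "psl_act (psl A \<otimes>\<^bsub>PSL2R\<^esub> psl B \<otimes>\<^bsub>PSL2R\<^esub> psl (geodesic_matrix r)) \<i>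
    = moebius_map A (moebius_map B (moebius_map (geodesic_matrix r) \<i>))"
  using assms Im_moebius_map_pos[OF det_geodesic_matrix, of \<i> r]
  by (simp add: psl_mult det_mul det_geodesic_matrix psl_act_psl moebius_map_compose)

text \<open>The Borel sets of \<open>PSO2\<close> come from the quotient topology, so it suffices that the map is continuous in the
  matrix entries on the matrices of determinant \<open>1\<close>.\<close>

lemma measurable_psl_act_PSO2:
  assumes A: "det A = 1"
  shows "(\<lambda>k. psl_act (psl A \<otimes>\<^bsub>PSL2R\<^esub> k \<otimes>\<^bsub>PSL2R\<^esub> psl (geodesic_matrix r)) \<i>) \<in> borel_measurable PSO2_borel"
    (is "?h \<in> _")
proof (rule borel_measurableI)
  fix U :: "complex set" assume U: "open U"
  define V where "V = {g \<in> carrier PSL2R. ?h g \<in> U}"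
  define c where "c B = moebius_map (A ** (B ** geodesic_matrix r)) \<i>" for B
  have h_eq: "?h (psl B) = c B" if "det B = 1" for B
    using psl_act_triple[OF A that] A that
    by (simp add: c_def moebius_map_compose det_mul det_geodesic_matrix)
  have cont: "continuous_on (carrier SL2R) c"
    unfolding c_def moebius_map_def
  proof (intro continuous_intros ballI)
    fix B assume "B \<in> carrier SL2R"
    then have "det (A ** (B ** geodesic_matrix r)) = 1"
      using A by (simp add: SL2R_def det_mul det_geodesic_matrix)
    then show "complex_of_real ((A ** (B ** geodesic_matrix r)) $ 2 $ 1) * \<i> + complex_of_real ((A ** (B ** geodesic_matrix r)) $ 2 $ 2) \<noteq> 0"
      by (intro moebius_denominator_nonzero) simp_all
  qed (simp_all add: matrix_matrix_mult_def sum_2, (intro continuous_intros)+)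
  have "{B. det B = 1 \<and> psl B \<in> V} = carrier SL2R \<inter> c -` U"
    using h_eq by (auto simp: V_def SL2R_def carrier_PSL2R)
  then have "openin PSL2R_topology V"
    unfolding openin_PSL2R_topology using continuous_openin_preimage_gen[OF cont U] by (auto simp: V_def)
  moreover have "?h -` U \<inter> space PSO2_borel = V \<inter> PSO2"
    by (auto simp: space_PSO2_borel V_def PSO2_def carrier_PSL2R)
  ultimately show "?h -` U \<inter> space PSO2_borel \<in> sets PSO2_borel"
    by (intro openin_imp_sets_PSO2_borel) (auto simp: openin_subtopology)
qed

text \<open>The group element chosen in \<open>averaging\<close> and \<open>affine_matrix z\<close> both take \<open>\<i>\<close> to \<open>z\<close>, and by
  \<open>circle_mean_at_moebius\<close> they induce the same distribution on the circle about \<open>z\<close>.\<close>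

lemma averaging_eq_circle_integral:
  fixes f f' :: "complex \<Rightarrow> real"
  assumes z: "Im z > 0" and r: "r \<ge> 0" and [measurable]: "f' \<in> borel_measurable borel"
    and ff': "\<And>w. Im w > 0 \<Longrightarrow> f' w = f w"
  shows "averaging r f z = (LINT t|angle_measure. f' (affine_move z (circle_point (cosh r) t)))"
proof -
  define g where "g = (SOME g. g \<in> carrier PSL2R \<and> psl_act g \<i> = z)"
  have "\<exists>g. g \<in> carrier PSL2R \<and> psl_act g \<i> = z"
    using z by (intro exI[of _ "psl (affine_matrix z)"])
      (auto simp: carrier_PSL2R det_affine_matrix psl_act_psl moebius_affine_matrix affine_move_i)
  from someI_ex[OF this] have g: "g \<in> carrier PSL2R" "psl_act g \<i> = z" by (simp_all add: g_def)
  from g(1) obtain A where A: "det A = 1" "g = psl A" by (rule carrier_PSL2R_cases)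
  have Ai: "moebius_map A \<i> = z" using g(2) by (simp add: A psl_act_psl)
  define \<theta> where "\<theta> k = psl_act (psl A \<otimes>\<^bsub>PSL2R\<^esub> k \<otimes>\<^bsub>PSL2R\<^esub> psl (geodesic_matrix r)) \<i>" for k
  have \<theta>_rot: "\<theta> (psl (rotation t)) = moebius_map A (circle_point (cosh r) t)" for t
    unfolding \<theta>_def psl_act_triple[OF A(1) det_rotation] circle_point_cosh[OF r] ..
  have [measurable]: "\<theta> \<in> borel_measurable PSO2_borel"
    unfolding \<theta>_def by (rule measurable_psl_act_PSO2[OF A(1)])
  have haar: "PSO2_haar = distr angle_measure PSO2_borel (\<lambda>t. psl (rotation t))"
    by (simp add: PSO2_haar_def angle_measure_def)
  have rot: "(\<lambda>t. psl (rotation t)) \<in> angle_measure \<rightarrow>\<^sub>M PSO2_borel"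
    unfolding angle_measure_def by (rule measurable_psl_rotation_uniform)
  have "averaging r f z = (LINT k|PSO2_haar. f (\<theta> k))"
    by (simp add: averaging_def g_def[symmetric] A \<theta>_def)
  also have "\<dots> = (LINT k|PSO2_haar. f' (\<theta> k))"
  proof (rule Bochner_Integration.integral_cong[OF refl])
    fix k assume "k \<in> space PSO2_haar"
    then obtain t where "k = psl (rotation t)" by (auto simp: space_PSO2_haar PSO2_eq_rotations)
    then have "Im (\<theta> k) > 0"
      using Im_moebius_map_pos[OF A(1) Im_circle_point_pos[OF cosh_real_ge_1]] by (simp add: \<theta>_rot)
    then show "f (\<theta> k) = f' (\<theta> k)" by (simp add: ff')
  qed
  also have "\<dots> = (LINT t|angle_measure. f' (moebius_map A (circle_point (cosh r) t)))"
    unfolding haar by (subst integral_distr[OF rot]) (auto simp: \<theta>_rot)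
  also have "\<dots> = (LINT w|distr angle_measure borel (\<lambda>t. moebius_map A (circle_point (cosh r) t)). f' w)"
    by (subst integral_distr) auto
  also have "distr angle_measure borel (\<lambda>t. moebius_map A (circle_point (cosh r) t))
      = distr angle_measure borel (\<lambda>t. affine_move z (circle_point (cosh r) t))" (is "?M = ?N")
  proof (rule measure_eqI)
    fix B assume "B \<in> sets ?M"
    then have [measurable]: "B \<in> sets borel" by simp
    have "emeasure ?M B = (\<integral>\<^sup>+w. indicator B w \<partial>?M)" by simp
    also have "\<dots> = (\<integral>\<^sup>+t. indicator B (moebius_map A (circle_point (cosh r) t)) \<partial>angle_measure)"
      by (subst nn_integral_distr) auto
    also have "\<dots> = circle_mean (cosh r) (indicator B) z"
      using circle_mean_at_moebius[OF A(1) cosh_real_ge_1, of "indicator B" r] by (simp add: Ai)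
    also have "\<dots> = (\<integral>\<^sup>+w. indicator B w \<partial>?N)"
      unfolding circle_mean_def by (subst nn_integral_distr) auto
    also have "\<dots> = emeasure ?N B" by simp
    finally show "emeasure ?M B = emeasure ?N B" .
  qed simp
  also have "(LINT w|?N. f' w) = (LINT t|angle_measure. f' (affine_move z (circle_point (cosh r) t)))"
    by (subst integral_distr) auto
  finally show ?thesis .
qed

section \<open>The support of the function avoids the distance\<close>

lemma ennreal_mult_le_sum_squares: "(a::ennreal) * b \<le> a * a + b * b"
proof (cases "a \<le> b")
  case True
  then have "a * b \<le> b * b" by (rule mult_right_mono) simp
  then show ?thesis by (simp add: add_increasing)
next
  case False
  then have "a * b \<le> a * a" by (intro mult_left_mono) auto
  then show ?thesis by (simp add: add_increasing2)
qed

context fuchsian_region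
begin

lemma AE_quotient_area: "AE z in hyp_area. P z \<Longrightarrow> AE z in quotient_area F. P z"
proof -
  assume P: "AE z in hyp_area. P z"
  have "F \<inter> space hyp_area \<in> sets hyp_area"
    unfolding sets_hyp_area space_hyp_area by (subst sets_restrict_space_iff) (use F_subset in auto)
  then show ?thesis unfolding quotient_area_def using P by (subst AE_restrict_space_iff) auto
qed

text \<open>The half-plane is covered by countably many translates of \<open>F\<close>, up to a null set.\<close>

lemma invariant_null_set:
  assumes [measurable]: "N \<in> sets borel" and inv: "invariant (indicator N :: complex \<Rightarrow> ennreal)"
    and null: "(\<integral>\<^sup>+z. indicator F z * indicator N z \<partial>hyp_area) = 0"
  shows "(\<integral>\<^sup>+z. indicator N z \<partial>hyp_area) = 0"
proof -
  have "(\<integral>\<^sup>+z. indicator N z \<partial>hyp_area) = (\<integral>\<^sup>+z. \<integral>\<^sup>+g. indicator F (psl_act g z) * indicator N z \<partial>count_space \<Gamma> \<partial>hyp_area)"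
    by (rule nn_integral_cong_AE, use translates_partition in eventually_elim) (simp add: nn_integral_multc)
  also have "\<dots> = (\<integral>\<^sup>+g. \<integral>\<^sup>+z. indicator F (psl_act g z) * indicator N z \<partial>hyp_area \<partial>count_space \<Gamma>)"
  proof (rule nn_integral_count_space_nn_integral[OF countable_group])
    fix g assume "g \<in> \<Gamma>"
    note [measurable] = measurable_psl_act[OF in_carrier[OF this]]
    show "(\<lambda>z. indicator F (psl_act g z) * indicator N z :: ennreal) \<in> borel_measurable hyp_area"
      by (rule measurable_hyp_area) measurable
  qed
  also have "\<dots> = (\<integral>\<^sup>+g. 0 \<partial>count_space \<Gamma>)"
  proof (rule nn_integral_cong)
    fix g assume "g \<in> space (count_space \<Gamma>)"
    then have g: "g \<in> \<Gamma>" by simp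
    have "(\<integral>\<^sup>+z. indicator F (psl_act g z) * indicator N z \<partial>hyp_area)
        = (\<integral>\<^sup>+z. indicator F (psl_act g z) * indicator N (psl_act g z) \<partial>hyp_area)"
      using inv g unfolding invariant_def by (intro nn_integral_hyp_area_cong) simp
    also have "\<dots> = (\<integral>\<^sup>+z. indicator F z * indicator N z \<partial>hyp_area)"
      by (rule hyp_area_psl_act_invariant[OF in_carrier[OF g]]) measurable
    finally show "(\<integral>\<^sup>+z. indicator F (psl_act g z) * indicator N z \<partial>hyp_area) = 0" using null by simp
  qed
  finally show ?thesis by simp
qed

text \<open>Off the null set of \<open>z\<close> with negative values at \<open>z\<close> or on a non-null part of the circle, the inner integral agrees with
  \<open>circle_mean X p z\<close>, where \<open>p\<close> is the positive part of \<open>f\<close>. Since \<open>a b \<le> a\<^sup>2 + b\<^sup>2\<close>, the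
  function \<open>p * circle_mean X p\<close> is integrable over the quotient, so that the integral in the
  hypothesis is not zero merely by default. Hence this function vanishes almost everywhere, and
  so does the circle mean of \<open>f\<close> at the points of the support.\<close>

lemma support_avoids_radius:
  assumes X: "X \<ge> 1" and [measurable]: "f \<in> borel_measurable borel" and inv: "invariant f"
    and sq: "(\<integral>\<^sup>+z. indicator F z * ennreal ((f z)\<^sup>2) \<partial>hyp_area) < \<infinity>"
    and nonneg: "AE z in quotient_area F. f z \<ge> 0"
    and zero: "(LINT z|quotient_area F. (LINT t|angle_measure. f (affine_move z (circle_point X t))) * f z) = 0"
  shows "(\<integral>\<^sup>+z. indicator F z * (indicator {z. f z \<noteq> 0} z * circle_mean X (indicator {z. f z \<noteq> 0}) z) \<partial>hyp_area) = 0"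
proof -
  define N where "N = {z. f z < 0}"
  define S where "S = {z. f z \<noteq> 0}"
  define p where "p z = ennreal (f z)" for z
  have [measurable]: "N \<in> sets borel" "S \<in> sets borel" unfolding N_def S_def by measurable
  have [measurable]: "p \<in> borel_measurable borel" unfolding p_def[abs_def] by measurable
  have inv_p: "invariant (\<lambda>z. p z * p z)" using inv by (simp add: invariant_def p_def)
  have null: "(\<integral>\<^sup>+z. indicator N z \<partial>hyp_area) = 0"
  proof (rule invariant_null_set)
    show "invariant (indicator N :: complex \<Rightarrow> ennreal)"
      using inv by (auto simp: invariant_def N_def indicator_def)
    have "(\<integral>\<^sup>+z. indicator N z \<partial>quotient_area F) = 0"
      by (subst nn_integral_0_iff_AE)
        (use nonneg in \<open>auto simp: N_def not_less intro!: measurable_quotient_area split: split_indicator\<close>)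
    then show "(\<integral>\<^sup>+z. indicator F z * indicator N z \<partial>hyp_area) = 0"
      by (simp only: nn_integral_quotient_area)
  qed measurable
  have AE_N: "AE z in hyp_area. z \<notin> N"
    using null by (subst (asm) nn_integral_0_iff_AE) (auto intro!: measurable_hyp_area)
  have AE_circle: "AE z in hyp_area. circle_mean X (indicator N) z = 0"
    by (rule circle_mean_null_set[OF _ null X]) measurable
  have good: "AE t in angle_measure. f (affine_move z (circle_point X t)) \<ge> 0" if "circle_mean X (indicator N) z = 0" for z
  proof -
    have "AE t in angle_measure. indicator N (affine_move z (circle_point X t)) = (0::ennreal)"
      using that unfolding circle_mean_def by (subst (asm) nn_integral_0_iff_AE) auto
    then show ?thesis by eventually_elim (simp add: indicator_eq_0_iff N_def not_less)
  qed
  define Q where "Q = (\<integral>\<^sup>+z. indicator F z * (p z * circle_mean X p z) \<partial>hyp_area)"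
  have Q_fin: "Q < \<infinity>"
  proof -
    have pp: "(\<integral>\<^sup>+z. indicator F z * (p z * p z) \<partial>hyp_area) < \<infinity>"
    proof -
      have "(\<integral>\<^sup>+z. indicator F z * (p z * p z) \<partial>hyp_area) \<le> (\<integral>\<^sup>+z. indicator F z * ennreal ((f z)\<^sup>2) \<partial>hyp_area)"
      proof (intro nn_integral_mono mult_left_mono)
        fix z
        show "p z * p z \<le> ennreal ((f z)\<^sup>2)"
          by (cases "f z \<ge> 0") (auto simp: p_def power2_eq_square ennreal_mult'[symmetric] ennreal_neg)
      qed simp
      then show ?thesis using sq by (rule order.strict_trans1)
    qed
    have "Q \<le> (\<integral>\<^sup>+z. indicator F z * (p z * p z) + indicator F z * (1 * circle_mean X (\<lambda>w. p w * p w) z) \<partial>hyp_area)"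
      unfolding Q_def distrib_left[symmetric]
    proof (intro nn_integral_mono mult_left_mono)
      fix z
      have "p z * circle_mean X p z = circle_mean X (\<lambda>w. p z * p w) z"
        unfolding circle_mean_def by (rule nn_integral_cmult[symmetric]) measurable
      also have "\<dots> \<le> circle_mean X (\<lambda>w. p z * p z + p w * p w) z"
        by (intro circle_mean_mono ennreal_mult_le_sum_squares)
      also have "\<dots> = p z * p z + circle_mean X (\<lambda>w. p w * p w) z"
        by (subst circle_mean_add) (auto simp: circle_mean_one)
      finally show "p z * circle_mean X p z \<le> p z * p z + 1 * circle_mean X (\<lambda>w. p w * p w) z" by simp
    qed simp
    also have "\<dots> = (\<integral>\<^sup>+z. indicator F z * (p z * p z) \<partial>hyp_area)
        + (\<integral>\<^sup>+z. indicator F z * (1 * circle_mean X (\<lambda>w. p w * p w) z) \<partial>hyp_area)"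
      by (intro nn_integral_add measurable_hyp_area) measurable
    also have "(\<integral>\<^sup>+z. indicator F z * (1 * circle_mean X (\<lambda>w. p w * p w) z) \<partial>hyp_area)
        = (\<integral>\<^sup>+z. indicator F z * ((p z * p z) * circle_mean X (\<lambda>_. 1) z) \<partial>hyp_area)"
      by (rule quotient_circle_mean_symmetric[OF X]) (auto simp: inv_p, simp add: invariant_def)
    also have "\<dots> = (\<integral>\<^sup>+z. indicator F z * (p z * p z) \<partial>hyp_area)" by (simp add: circle_mean_one)
    also have "(\<integral>\<^sup>+z. indicator F z * (p z * p z) \<partial>hyp_area) + (\<integral>\<^sup>+z. indicator F z * (p z * p z) \<partial>hyp_area) < \<infinity>"
      using pp by (simp add: ennreal_add_less_top)
    finally show ?thesis .
  qed
  have Q_quot: "Q = (\<integral>\<^sup>+z. p z * circle_mean X p z \<partial>quotient_area F)"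
    by (simp only: Q_def nn_integral_quotient_area)
  have "AE z in quotient_area F. p z * circle_mean X p z \<noteq> \<infinity>"
    using Q_fin unfolding Q_quot
    by (intro nn_integral_noteq_infinite) (auto simp: less_top intro!: measurable_quotient_area)
  define L where "L z = (LINT t|angle_measure. f (affine_move z (circle_point X t)))" for z
  have [measurable]: "L \<in> borel_measurable borel"
    unfolding L_def[abs_def] by (rule angle.borel_measurable_lebesgue_integral) measurable
  have "(LINT z|quotient_area F. L z * f z) = (LINT z|quotient_area F. enn2real (p z * circle_mean X p z))"
  proof (rule integral_cong_AE)
    show "AE z in quotient_area F. L z * f z = enn2real (p z * circle_mean X p z)"
      using AE_quotient_area[OF AE_circle] nonneg
    proof eventually_elim
      case (elim z)
      have "L z = enn2real (circle_mean X p z)"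
        unfolding L_def circle_mean_def p_def using good[OF elim(1)] by (intro integral_eq_nn_integral) auto
      then show ?case using elim(2) by (simp add: enn2real_mult p_def)
    qed
  qed (auto intro!: measurable_quotient_area)
  also have "\<dots> = enn2real (\<integral>\<^sup>+z. ennreal (enn2real (p z * circle_mean X p z)) \<partial>quotient_area F)"
    by (rule integral_eq_nn_integral) (auto intro!: measurable_quotient_area)
  also have "(\<integral>\<^sup>+z. ennreal (enn2real (p z * circle_mean X p z)) \<partial>quotient_area F) = Q"
    unfolding Q_quot
    by (rule nn_integral_cong_AE, use \<open>AE z in quotient_area F. p z * circle_mean X p z \<noteq> \<infinity>\<close> in eventually_elim)
      (simp add: less_top)
  finally have "enn2real Q = 0" using zero by (simp add: L_def)
  then have "Q = 0" using Q_fin by (auto simp: enn2real_eq_0_iff)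
  then have AE_Q: "AE z in hyp_area. indicator F z * (p z * circle_mean X p z) = 0"
    unfolding Q_def by (subst (asm) nn_integral_0_iff_AE) (auto intro!: measurable_hyp_area)
  have "AE z in hyp_area. indicator F z * (indicator S z * circle_mean X (indicator S) z) = (0::ennreal)"
    using AE_Q AE_N AE_circle
  proof eventually_elim
    case (elim z)
    show ?case
    proof (cases "z \<in> F \<and> z \<in> S")
      case True
      then have "f z > 0" using elim(2) by (auto simp: N_def S_def)
      then have "p z \<noteq> 0" by (simp add: p_def)
      then have "circle_mean X p z = 0" using elim(1) True by simp
      then have "AE t in angle_measure. p (affine_move z (circle_point X t)) = 0"
        unfolding circle_mean_def by (subst (asm) nn_integral_0_iff_AE) auto
      then have "AE t in angle_measure. indicator S (affine_move z (circle_point X t)) = (0::ennreal)"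
        using good[OF elim(3)] by eventually_elim (auto simp: p_def S_def ennreal_eq_0_iff split: split_indicator)
      then have "circle_mean X (indicator S) z = 0"
        unfolding circle_mean_def by (subst nn_integral_0_iff_AE) auto
      then show ?thesis by simp
    qed auto
  qed
  then show ?thesis
    unfolding S_def[symmetric] by (subst nn_integral_0_iff_AE) (auto intro!: measurable_hyp_area)
qed

end

section \<open>From the spectral bound to the density bound\<close>

text \<open>For \<open>r \<le> 2\<close> the right-hand side is at least \<open>1\<close>. Otherwise solving for \<open>p\<close>, with \<open>\<pi>\<close> replaced by \<open>3\<close>, reduces
  the claim to \<open>E (3 - r) / 6 \<le> (r + 1) (r/3 + 1 - 1 / (2 E))\<close> with \<open>E = exp (r/2)\<close>, where the
  left side is at most \<open>1\<close> and the right side is at least \<open>3/2\<close>.\<close>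

lemma spectral_ratio_bound:
  fixes p r :: real
  assumes r: "r > 0" and p: "0 \<le> p" "p \<le> 1" and bound: "p \<le> (1 - p) * ((r / pi + 1) / sinh (r / 2))"
  shows "p \<le> (r + 1) / exp (r / 2)"
proof (cases "r \<le> 2")
  case True
  have "exp (r/2) \<le> 1 + r/2 + (r/2)\<^sup>2" using True r by (intro exp_bound) auto
  also have "(r/2)\<^sup>2 \<le> r/2 * 1" unfolding power2_eq_square using True r by (intro mult_left_mono) auto
  finally have "exp (r/2) \<le> r + 1" by simp
  then have "1 \<le> (r + 1) / exp (r/2)" by simp
  with p(2) show ?thesis by (rule order_trans)
next
  case False
  define E where "E = exp (r/2)"
  have E1: "E \<ge> 1" using r by (simp add: E_def)
  have sh: "sinh (r/2) = (E - 1/E) / 2" by (simp add: sinh_def E_def exp_minus field_simps)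
  have shpos: "sinh (r/2) > 0" using r by simp
  define c where "c = r / 3 + 1"
  have "r / pi \<le> r / 3" using pi_gt3 r by (intro divide_left_mono) auto
  then have "(1 - p) * ((r / pi + 1) / sinh (r / 2)) \<le> (1 - p) * (c / sinh (r/2))"
    using p shpos by (intro mult_left_mono divide_right_mono) (auto simp: c_def)
  then have "p \<le> (1 - p) * (c / sinh (r/2))" using bound by linarith
  then have "p * sinh (r/2) \<le> (1 - p) * c" using shpos by (simp add: field_simps)
  then have pc: "p * (sinh (r/2) + c) \<le> c" by (simp add: algebra_simps)
  have key: "c * E \<le> (r + 1) * (sinh (r/2) + c)"
  proof -
    have "E * (3 - r) \<le> 6"
    proof (cases "r \<ge> 3")
      case True
      then have "E * (3 - r) \<le> 0" using E1 by (intro mult_nonneg_nonpos) auto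
      then show ?thesis by simp
    next
      case r3: False
      have "E = exp (r/4) * exp (r/4)" by (simp add: E_def flip: exp_add)
      (* r/4 < 3/4, so exp (r/4) is at most 1 + 3/4 + 9/16 = 37/16 *)
      moreover have "exp (r/4) \<le> 1 + r/4 + (r/4)\<^sup>2" using r r3 by (intro exp_bound) auto
      moreover have "(r/4)\<^sup>2 \<le> (3/4)\<^sup>2" using r r3 by (intro power_mono) auto
      ultimately have "exp (r/4) \<le> 37/16" using r3 by (simp add: power2_eq_square)
      then have "E \<le> 37/16 * (37/16)" unfolding \<open>E = exp (r/4) * exp (r/4)\<close> by (intro mult_mono) auto
      then have "E * (3 - r) \<le> 6 * 1" using False r3 E1 by (intro mult_mono) auto
      then show ?thesis by simp
    qed
    moreover have "1 / E \<le> 1" using E1 by simp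
    then have "(r + 1) * (c - 1 / E / 2) \<ge> 3 * (1/2)"
      using False by (intro mult_mono) (auto simp: c_def)
    moreover have "(r + 1) * (sinh (r/2) + c) - c * E = (r + 1) * (c - 1 / E / 2) - E * (3 - r) / 6"
      unfolding sh c_def by (simp add: algebra_simps add_divide_distrib diff_divide_distrib)
    ultimately show ?thesis by linarith
  qed
  have den: "sinh (r/2) + c > 0" using shpos r by (simp add: c_def add_pos_pos)
  have "p * E * (sinh (r/2) + c) \<le> c * E"
    using mult_right_mono[OF pc, of E] E1 by (simp add: mult_ac)
  then have "p * E * (sinh (r/2) + c) \<le> (r + 1) * (sinh (r/2) + c)" using key by linarith
  then have "p * E \<le> r + 1" using den by (rule mult_right_le_imp_le)
  then show ?thesis using E1 by (simp add: E_def pos_le_divide_eq)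
qed

theorem theorem1p1:
  fixes r :: real and \<Gamma> :: "(real^2^2) set set" and F :: "complex set"
    and f :: "complex \<Rightarrow> real"
  assumes "r > 0"
    and "fuchsian \<Gamma>"
    and "fundamental_region \<Gamma> F"
    and "emeasure (quotient_area F) F < \<infinity>"
    and "f \<in> L2_quotient \<Gamma> F"
    and "AE z in quotient_area F. f z \<ge> 0"
    and "L2_inner F (averaging r f) f = 0"
  shows "measure (quotient_area F) {z \<in> F. f z \<noteq> 0} / measure (quotient_area F) F
           \<le> (r + 1) / exp (r / 2)"
proof -
  interpret fuchsian_region \<Gamma> F by (rule fuchsian_region.intro) (use assms in auto)
  have f: "f \<in> borel_measurable hyp_area" "\<And>g z. g \<in> \<Gamma> \<Longrightarrow> z \<in> upper_half_plane \<Longrightarrow> f (psl_act g z) = f z"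
    "integrable (quotient_area F) (\<lambda>z. (f z)\<^sup>2)"
    using assms(5) by (auto simp: L2_quotient_def)
  (* f is measurable only on the half-plane; its extension by 0 is measurable on the whole plane *)
  define f' where "f' z = indicator upper_half_plane z *\<^sub>R f z" for z
  have ff': "f' z = f z" if "Im z > 0" for z using that by (simp add: f'_def upper_half_plane_def)
  have space_Q: "space (quotient_area F) = F"
    using F_subset by (simp add: quotient_area_def space_restrict_space space_hyp_area Int_absorb2)
  have FH: "Im z > 0" if "z \<in> F" for z using that F_subset by (auto simp: upper_half_plane_def)
  have "f \<in> borel_measurable (restrict_space borel upper_half_plane)"
    using f(1) unfolding measurable_cong_sets[OF sets_hyp_area refl] .
  then have [measurable]: "f' \<in> borel_measurable borel"
    unfolding f'_def[abs_def] by (subst (asm) borel_measurable_restrict_space_iff) auto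
  have inv: "invariant f'"
    unfolding invariant_def using f(2) psl_act_in_upper[OF in_carrier]
    by (auto simp: ff' upper_half_plane_def)
  define S where "S = {z. f' z \<noteq> 0}"
  have [measurable]: "S \<in> sets borel" unfolding S_def by measurable
  have avoid: "(\<integral>\<^sup>+z. indicator F z * (indicator S z * circle_mean (cosh r) (indicator S) z) \<partial>hyp_area) = 0"
    unfolding S_def
  proof (rule support_avoids_radius[OF cosh_real_ge_1 _ inv])
    have "(\<integral>\<^sup>+z. ennreal ((f' z)\<^sup>2) \<partial>quotient_area F) = (\<integral>\<^sup>+z. ennreal (norm ((f z)\<^sup>2)) \<partial>quotient_area F)"
      by (intro nn_integral_cong) (simp add: space_Q ff' FH)
    also have "\<dots> < \<infinity>" using f(3) unfolding integrable_iff_bounded by simp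
    finally show "(\<integral>\<^sup>+z. indicator F z * ennreal ((f' z)\<^sup>2) \<partial>hyp_area) < \<infinity>"
      by (simp only: nn_integral_quotient_area)
    show "AE z in quotient_area F. 0 \<le> f' z"
      using assms(6) by (rule AE_mp) (intro AE_I2, simp add: space_Q ff' FH)
    have "(LINT z|quotient_area F. (LINT t|angle_measure. f' (affine_move z (circle_point (cosh r) t))) * f' z)
        = L2_inner F (averaging r f) f"
      unfolding L2_inner_def using assms(1)
      by (intro Bochner_Integration.integral_cong refl)
        (simp add: space_Q FH ff' averaging_eq_circle_integral[where f'=f'])
    then show "(LINT z|quotient_area F. (LINT t|angle_measure. f' (affine_move z (circle_point (cosh r) t))) * f' z) = 0"
      using assms(7) by simp
  qed measurable
  have fin: "(\<integral>\<^sup>+z. indicator F z \<partial>hyp_area) < \<infinity>"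
  proof -
    have "(\<integral>\<^sup>+z. indicator F z \<partial>hyp_area) = (\<integral>\<^sup>+z. 1 \<partial>quotient_area F)"
      by (simp only: nn_integral_quotient_area mult_1_right)
    also have "\<dots> = emeasure (quotient_area F) F" by (simp add: space_Q)
    finally show ?thesis using assms(4) by simp
  qed
  define m where "m = measure (quotient_area F) (S \<inter> F)"
  define V where "V = measure (quotient_area F) F"
  have m_eq: "{z \<in> F. f z \<noteq> 0} = S \<inter> F" by (auto simp: S_def ff' FH)
  have "m / V \<le> (r + 1) / exp (r / 2)"
  proof (cases "V > 0")
    case True
    have S_inv: "invariant (indicator S :: complex \<Rightarrow> ennreal)"
      using inv by (auto simp: invariant_def S_def indicator_def)
    have "F \<in> sets (quotient_area F)" using sets.top[of "quotient_area F"] by (simp add: space_Q)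
    then have "m \<le> V"
      unfolding m_def V_def measure_def using assms(4)
      by (intro enn2real_mono emeasure_mono) (auto simp: less_top)
    show ?thesis
    proof (rule spectral_ratio_bound[OF assms(1)])
      show "0 \<le> m / V" using True by (simp add: m_def)
      show "m / V \<le> 1" using True \<open>m \<le> V\<close> by simp
      show "m / V \<le> (1 - m / V) * ((r / pi + 1) / sinh (r / 2))"
        unfolding m_def V_def
        by (rule avoided_distance_density[OF fin _ S_inv assms(1) avoid]) (use True in \<open>auto simp: V_def\<close>)
    qed
  next
    case False
    (* the quotient by V = 0 has the value 0 *)
    then have "V = 0" using measure_nonneg[of "quotient_area F" F] by (simp add: V_def)
    then show ?thesis using assms(1) by simp
  qed
  then show ?thesis by (simp only: m_eq m_def V_def)
qed

end
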